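(* Let $P$ be a $d$-polytope with slack ideal $I_P$ and non-incidence toric ideal $T_P$ (defined in the context). Then $I_P=T_P$ if and only if $P$ is projectively unique and $I_P$ is a toric ideal.
   Context: Let $P\subset\mathbb{R}^d$ be a $d$-dimensional polytope with labelled vertices $\mathbf p_1,\dots,\mathbf p_v$ and labelled facets $F_1,\dots,F_f$. The symbolic slack matrix $S_P(\mathbf x)$ is the $v\times f$ matrix with a $0$ in entry $(i,j)$ if $\mathbf p_i\in F_j$ and a distinct variable $x_{ij}$ otherwise; let $x_1,\dots,x_t$ denote all these variables. The slack ideal is $I_P=\langle (d+2)\text{-minors of } S_P(\mathbf x)\rangle : (x_1\cdots x_t)^\infty\subseteq\mathbb{C}[x_1,\dots,x_t]$. The non-incidence graph $G_P$ is the bipartite graph on the vertices and facets of $P$ with an edge $\{\mathbf p_i,F_j\}$ iff $\mathbf p_i\notin F_j$ (labelled by $x_{ij}$). $T_P$ is the toric ideal of the vertex-edge incidence matrix of $G_P$, i.e. the kernel of the map $x_{ij}\mapsto s_iu_j$ into the Laurent polynomial ring $\mathbb{C}[s_1^{\pm1},\dots,s_v^{\pm1},u_1^{\pm1},\dots,u_f^{\pm1}]$. An ideal of $\mathbb{C}[x_1,\dots,x_t]$ is toric if it is the kernel of a map $x_j\mapsto \mathbf z^{\mathbf a_j}$ into a Laurent polynomial ring $\mathbb{C}[z_1^{\pm1},\dots,z_n^{\pm1}]$ for some $\mathbf a_1,\dots,\mathbf a_t\in\mathbb{Z}^n$. $P$ is projectively unique if every polytope combinatorially equivalent to $P$ is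 projectively equivalent to $P$. *)

theory Defs
  imports "HOL-Analysis.Analysis" "HOL-Library.Poly_Mapping"
begin

type_synonym 'v cpoly = "('v \<Rightarrow>\<^sub>0 nat) \<Rightarrow>\<^sub>0 complex"

type_synonym laurent = "(nat \<Rightarrow>\<^sub>0 int) \<Rightarrow>\<^sub>0 complex"

definition Var :: "'v \<Rightarrow> 'v cpoly" where
  "Var e = Poly_Mapping.single (Poly_Mapping.single e 1) 1"

definition poly_ring :: "'v set \<Rightarrow> 'v cpoly set" where
  "poly_ring E = {p. \<forall>m \<in> Poly_Mapping.keys p. Poly_Mapping.keys m \<subseteq> E}"

definition ideal_gen :: "'a::comm_ring_1 set \<Rightarrow> 'a set \<Rightarrow> 'a set" where
  "ideal_gen R G = {p. \<exists>t r. finite t \<and> t \<subseteq> G \<and> (\<forall>g\<in>t. r g \<in> R) \<and> p = (\<Sum>g\<in>t. r g * g)}"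

definition saturation :: "'a::comm_ring_1 set \<Rightarrow> 'a set \<Rightarrow> 'a \<Rightarrow> 'a set" where
  "saturation R J h = {p \<in> R. \<exists>n::nat. h ^ n * p \<in> J}"

text \<open>The C-algebra homomorphism x_e |-> z^(a e) into the Laurent polynomial ring.\<close>
definition monomial_map :: "('v \<Rightarrow> (nat \<Rightarrow>\<^sub>0 int)) \<Rightarrow> 'v cpoly \<Rightarrow> laurent" where
  "monomial_map a p =
     (\<Sum>m \<in> Poly_Mapping.keys p.
        Poly_Mapping.single
          (\<Sum>e \<in> Poly_Mapping.keys m. Poly_Mapping.map (\<lambda>c. int (Poly_Mapping.lookup m e) * c) (a e))
          (Poly_Mapping.lookup p m))"

definition is_toric :: "'v set \<Rightarrow> 'v cpoly set \<Rightarrow> bool" where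
  "is_toric E I \<longleftrightarrow> (\<exists>a :: 'v \<Rightarrow> (nat \<Rightarrow>\<^sub>0 int). I = {p \<in> poly_ring E. monomial_map a p = 0})"

definition det_fun :: "nat \<Rightarrow> (nat \<Rightarrow> nat \<Rightarrow> 'a::comm_ring_1) \<Rightarrow> 'a" where
  "det_fun k A = (\<Sum>\<sigma> | \<sigma> permutes {..<k}. of_int (sign \<sigma>) * (\<Prod>i<k. A i (\<sigma> i)))"

definition minors :: "nat \<Rightarrow> nat \<Rightarrow> nat \<Rightarrow> (nat \<Rightarrow> nat \<Rightarrow> 'a::comm_ring_1) \<Rightarrow> 'a set" where
  "minors k m n A = {det_fun k (\<lambda>a b. A (sorted_list_of_set I ! a) (sorted_list_of_set J ! b)) | I J.
      I \<subseteq> {..<m} \<and> J \<subseteq> {..<n} \<and> card I = k \<and> card J = k}"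

text \<open>pv : labels of vertices 0..v-1, pF : labels of facets 0..f-1.\<close>
definition noninc :: "nat \<Rightarrow> nat \<Rightarrow> (nat \<Rightarrow> 'x) \<Rightarrow> (nat \<Rightarrow> 'x set) \<Rightarrow> (nat \<times> nat) set" where
  "noninc v f pv pF = {(i, j). i < v \<and> j < f \<and> pv i \<notin> pF j}"

definition symbolic_slack :: "(nat \<Rightarrow> 'x) \<Rightarrow> (nat \<Rightarrow> 'x set) \<Rightarrow> nat \<Rightarrow> nat \<Rightarrow> (nat \<times> nat) cpoly" where
  "symbolic_slack pv pF i j = (if pv i \<in> pF j then 0 else Var (i, j))"

definition slack_ideal :: "nat \<Rightarrow> nat \<Rightarrow> nat \<Rightarrow> (nat \<Rightarrow> 'x) \<Rightarrow> (nat \<Rightarrow> 'x set) \<Rightarrow> (nat \<times> nat) cpoly set" where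
  "slack_ideal d v f pv pF =
     (let E = noninc v f pv pF; R = poly_ring E in
      saturation R (ideal_gen R (minors (d + 2) v f (symbolic_slack pv pF))) (\<Prod>e\<in>E. Var e))"

text \<open>T_P: kernel of x_ij |-> s_i u_j, where s_i = z_(2i) and u_j = z_(2j+1).\<close>
definition nonincidence_toric_ideal :: "nat \<Rightarrow> nat \<Rightarrow> (nat \<Rightarrow> 'x) \<Rightarrow> (nat \<Rightarrow> 'x set) \<Rightarrow> (nat \<times> nat) cpoly set" where
  "nonincidence_toric_ideal v f pv pF =
     {p \<in> poly_ring (noninc v f pv pF).
        monomial_map (\<lambda>(i, j). Poly_Mapping.single (2 * i) 1 + Poly_Mapping.single (2 * j + 1) 1) p = 0}"

definition comb_equiv :: "('a::real_vector) set \<Rightarrow> 'a set \<Rightarrow> bool" where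
  "comb_equiv P Q \<longleftrightarrow> (\<exists>\<phi>. bij_betw \<phi> {F. F face_of P} {G. G face_of Q} \<and>
      (\<forall>F1 F2. F1 face_of P \<longrightarrow> F2 face_of P \<longrightarrow> (F1 \<subseteq> F2 \<longleftrightarrow> \<phi> F1 \<subseteq> \<phi> F2)))"

definition homog :: "real ^ 'd \<Rightarrow> real ^ ('d option)" where
  "homog x = (\<chi> k. case k of None \<Rightarrow> 1 | Some i \<Rightarrow> x $ i)"

definition proj_map :: "real ^ ('d option) ^ ('d option) \<Rightarrow> real ^ 'd \<Rightarrow> real ^ 'd" where
  "proj_map M x = (\<chi> i. (M *v homog x) $ Some i / (M *v homog x) $ None)"

definition proj_equiv :: "(real ^ 'd) set \<Rightarrow> (real ^ 'd) set \<Rightarrow> bool" where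
  "proj_equiv P Q \<longleftrightarrow> (\<exists>M. invertible M \<and> (\<forall>x\<in>P. (M *v homog x) $ None \<noteq> 0) \<and> proj_map M ` P = Q)"

definition projectively_unique :: "(real ^ 'd) set \<Rightarrow> bool" where
  "projectively_unique P \<longleftrightarrow> (\<forall>Q. polytope Q \<and> comb_equiv P Q \<longrightarrow> proj_equiv P Q)"

end

theory Submission
  imports Defs
begin

text \<open>
  A toric ideal, being the kernel of a monomial map, is the set of polynomials vanishing on the
  positive real points of its variety, since distinct characters of the positive torus are linearly
  independent. Hence both ideals can be compared through these points. For \<open>T\<^sub>P\<close> they are the matrices
  \<open>s i * u j\<close> on the non-incidences; for \<open>I\<^sub>P\<close> they are the positive matrices of rank at most \<open>d + 1\<close>
  with the zero pattern of a slack matrix of \<open>P\<close>, and up to row scaling these are exactly the slack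
  matrices of the polytopes combinatorially equivalent to \<open>P\<close>.

  If the two ideals agree, then the slack matrices of \<open>P\<close> and of an equivalent \<open>Q\<close> are both of the form
  \<open>s i * u j\<close>, so they differ by scaling rows and columns, and such a scaling is induced by a projective
  map. Conversely, if \<open>I\<^sub>P\<close> is toric, then the all-ones pattern is a point of its variety; if moreover
  \<open>P\<close> is projectively unique, then every positive point is, up to a relabelling by a combinatorial
  automorphism, a scaling of the slack matrix of \<open>P\<close>. The all-ones pattern is invariant under
  relabelling, so every positive point is of the form \<open>s i * u j\<close>.
\<close>

section \<open>Vanishing minors and factorizations\<close>

text \<open>I_P is never shown to be radical or prime; its points determine it only through the
  assumption that it is toric. Positive torus points are written z_n = exp (w n) with
  \<open>w\<close> real: \<open>w = 0\<close> gives the all-ones point of every toric ideal, and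
  replacing \<open>w\<close> by its multiples turns vanishing on the torus into vanishing power
  sums.

  The main obstacle is to see that a nonnegative matrix of rank at most d + 1 with the zero pattern
  of P comes from a polytope of the type of P. A factorization yields only points and half-spaces of
  R^d with prescribed incidences; that the hull of the points is d-dimensional and is the
  intersection of the half-spaces has to be proved. Passing from a facet of a face to the face
  raises the dimension of the image by at least one, and R^d leaves no room for more, so every face
  keeps its dimension. Equality with the intersection of half-spaces then follows by induction on
  the dimension, and with it the isomorphism of face lattices.\<close>

text \<open>Rank at most \<open>k\<close> of the \<open>m\<close> by \<open>n\<close> corner,
  phrased as a factorization because the factors later become the points and hyperplanes of a
  polytope.\<close>

definition factors_through :: "nat \<Rightarrow> nat \<Rightarrow> nat \<Rightarrow> (nat \<Rightarrow> nat \<Rightarrow> 'a::field) \<Rightarrow> bool" where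
  "factors_through k m n X \<longleftrightarrow>
     (\<exists>A B. \<forall>i<m. \<forall>j<n. X i j = (\<Sum>l<k. A i l * B l j))"

lemma det_fun_transpose: "det_fun k (\<lambda>i j. X j i) = det_fun k X"
proof -
  have "(\<Prod>i<k. X (inv \<sigma> i) i) = (\<Prod>i<k. X i (\<sigma> i))" if "\<sigma> permutes {..<k}" for \<sigma>
    using prod.permute[OF that, of "\<lambda>i. X (inv \<sigma> i) i"] permutes_inverses(2)[OF that]
    by (simp add: o_def)
  moreover have "sign (inv \<sigma>) = sign \<sigma>" if "\<sigma> permutes {..<k}" for \<sigma>
    using that sign_inverse permutation_permutes by blast
  ultimately show ?thesis
    unfolding det_fun_def by (subst sum_permutations_inverse) (auto intro!: sum.cong)
qed

lemma det_fun_permute_rows: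
  assumes "\<pi> permutes {..<k}"
  shows "det_fun k (\<lambda>i j. X (\<pi> i) j) = of_int (sign \<pi>) * det_fun k X"
proof -
  have "det_fun k (\<lambda>i j. X (\<pi> i) j)
      = (\<Sum>\<sigma> | \<sigma> permutes {..<k}. of_int (sign (\<sigma> \<circ> \<pi>)) * (\<Prod>i<k. X (\<pi> i) ((\<sigma> \<circ> \<pi>) i)))"
    unfolding det_fun_def by (rule sum_permutations_compose_right[OF assms])
  also have "\<dots> = (\<Sum>\<sigma> | \<sigma> permutes {..<k}. of_int (sign \<pi>) * (of_int (sign \<sigma>) * (\<Prod>i<k. X i (\<sigma> i))))"
  proof (rule sum.cong)
    fix \<sigma> assume "\<sigma> \<in> {\<sigma>. \<sigma> permutes {..<k}}"
    then have "sign (\<sigma> \<circ> \<pi>) = sign \<sigma> * sign \<pi>"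
      using assms by (intro sign_compose) (auto simp: permutation_permutes)
    moreover have "(\<Prod>i<k. X (\<pi> i) ((\<sigma> \<circ> \<pi>) i)) = (\<Prod>i<k. X i (\<sigma> i))"
      using prod.permute[OF assms, of "\<lambda>i. X i (\<sigma> i)"] by (simp add: o_def)
    ultimately show "of_int (sign (\<sigma> \<circ> \<pi>)) * (\<Prod>i<k. X (\<pi> i) ((\<sigma> \<circ> \<pi>) i))
        = of_int (sign \<pi>) * (of_int (sign \<sigma>) * (\<Prod>i<k. X i (\<sigma> i)))"
      by (simp only: of_int_mult mult.assoc mult.left_commute)
  qed simp
  also have "\<dots> = of_int (sign \<pi>) * det_fun k X"
    by (simp add: det_fun_def sum_distrib_left)
  finally show ?thesis .
qed

text \<open>Exchanging the two rows changes the sign of the determinant but not the matrix; in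
  characteristic 0 a value equal to its negative is 0.\<close>

lemma det_fun_repeated_row:
  fixes X :: "nat \<Rightarrow> nat \<Rightarrow> 'a::field_char_0"
  assumes "a < k" "b < k" "a \<noteq> b" "\<And>j. X a j = X b j"
  shows "det_fun k X = 0"
proof -
  let ?t = "Transposition.transpose a b"
  have "(\<lambda>i j. X (?t i) j) = X"
    using assms(4) by (auto simp: fun_eq_iff Transposition.transpose_def)
  then have "det_fun k X = of_int (sign ?t) * det_fun k X"
    using det_fun_permute_rows[of ?t k X] permutes_swap_id[of a "{..<k}" b] assms(1,2) by simp
  then have "det_fun k X = - det_fun k X"
    using assms(3) by (simp add: sign_swap_id)
  then show ?thesis
    by simp
qed

text \<open>The signed cofactor of the entry \<open>(a, K)\<close> in the last column: the
  permutations with \<open>\<sigma> a = K\<close> give the terms containing that entry, and keeping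
  their signs avoids renumbering the rows.\<close>

definition col_cofactor :: "nat \<Rightarrow> (nat \<Rightarrow> nat \<Rightarrow> 'a::comm_ring_1) \<Rightarrow> nat \<Rightarrow> 'a" where
  "col_cofactor K M a = (\<Sum>\<sigma> | \<sigma> permutes {..<Suc K} \<and> \<sigma> a = K.
     of_int (sign \<sigma>) * (\<Prod>i\<in>{..<Suc K} - {a}. M i (\<sigma> i)))"

lemma det_fun_expand_last_column:
  "det_fun (Suc K) M = (\<Sum>a<Suc K. M a K * col_cofactor K M a)"
proof -
  let ?P = "{\<sigma>. \<sigma> permutes {..<Suc K}}"
  let ?h = "\<lambda>\<sigma>. of_int (sign \<sigma>) * (\<Prod>i<Suc K. M i (\<sigma> i))"
  have "det_fun (Suc K) M = sum ?h ?P"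
    by (simp add: det_fun_def)
  \<comment> \<open>The terms are sorted by the row in which they use the last column.\<close>
  also have "\<dots> = (\<Sum>a<Suc K. sum ?h {\<sigma> \<in> ?P. inv \<sigma> K = a})"
  proof (rule sum.group[symmetric])
    show "finite ?P"
      by (rule finite_permutations) simp
    show "(\<lambda>\<sigma>. inv \<sigma> K) ` ?P \<subseteq> {..<Suc K}"
    proof (rule image_subsetI)
      fix \<sigma> assume "\<sigma> \<in> ?P"
      then have "\<sigma> permutes {..<Suc K}"
        by simp
      then show "inv \<sigma> K \<in> {..<Suc K}"
        using permutes_in_image[OF permutes_inv, of \<sigma> "{..<Suc K}" K] by simp
    qed
  qed simp
  also have "\<dots> = (\<Sum>a<Suc K. M a K * col_cofactor K M a)"
  proof (rule sum.cong)
    fix a assume a: "a \<in> {..<Suc K}"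
    have set: "{\<sigma> \<in> ?P. inv \<sigma> K = a} = {\<sigma>. \<sigma> permutes {..<Suc K} \<and> \<sigma> a = K}"
      by (auto simp: permutes_inv_eq permutes_inverses)
    have summand: "?h \<sigma> = M a K * (of_int (sign \<sigma>) * (\<Prod>i\<in>{..<Suc K} - {a}. M i (\<sigma> i)))"
      if "\<sigma> a = K" for \<sigma>
      using prod.remove[OF finite_lessThan a, of "\<lambda>i. M i (\<sigma> i)"] that
      by (simp only: mult.left_commute)
    show "sum ?h {\<sigma> \<in> ?P. inv \<sigma> K = a} = M a K * col_cofactor K M a"
      unfolding set col_cofactor_def sum_distrib_left
      by (rule sum.cong[OF refl], rule summand) simp
  qed simp
  finally show ?thesis .
qed

text \<open>\<open>\<sigma>\<close> already uses column \<open>K\<close> in row \<open>a\<close>, so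
  by injectivity all other factors lie in earlier columns. Bordered minors that differ only in the
  bordering column therefore share these cofactors.\<close>

lemma col_cofactor_cong:
  assumes "\<And>i b. b < K \<Longrightarrow> M i b = N i b"
  shows "col_cofactor K M a = col_cofactor K N a"
proof -
  have "(\<Prod>i\<in>{..<Suc K} - {a}. M i (\<sigma> i)) = (\<Prod>i\<in>{..<Suc K} - {a}. N i (\<sigma> i))"
    if \<sigma>: "\<sigma> permutes {..<Suc K}" "\<sigma> a = K" for \<sigma>
  proof (rule prod.cong)
    fix i assume i: "i \<in> {..<Suc K} - {a}"
    then have "\<sigma> i < Suc K"
      using permutes_in_image[OF \<sigma>(1), of i] by simp
    moreover have "\<sigma> i \<noteq> \<sigma> a"
      using i inj_eq[OF permutes_inj[OF \<sigma>(1)]] by simp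
    ultimately show "M i (\<sigma> i) = N i (\<sigma> i)"
      using assms \<sigma>(2) by simp
  qed simp
  then show ?thesis
    unfolding col_cofactor_def by (intro sum.cong) simp_all
qed

lemma col_cofactor_last: "col_cofactor K M K = det_fun K M"
proof -
  have "{\<sigma>. \<sigma> permutes {..<Suc K} \<and> \<sigma> K = K} = {\<sigma>. \<sigma> permutes {..<K}}"
  proof -
    have "\<sigma> permutes {..<K}" if "\<sigma> permutes {..<Suc K}" "\<sigma> K = K" for \<sigma>
      by (rule permutes_superset[OF that(1)]) (use that(2) in \<open>auto simp: less_Suc_eq\<close>)
    moreover have "\<sigma> permutes {..<Suc K} \<and> \<sigma> K = K" if \<sigma>: "\<sigma> permutes {..<K}" for \<sigma>
      using permutes_subset[OF \<sigma>, of "{..<Suc K}"] permutes_not_in[OF \<sigma>, of K] by auto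
    ultimately show ?thesis
      by blast
  qed
  moreover have "{..<Suc K} - {K} = {..<K}"
    by auto
  ultimately show ?thesis
    by (simp add: col_cofactor_def det_fun_def)
qed

lemma det_fun_cong:
  assumes "\<And>i j. i < k \<Longrightarrow> j < k \<Longrightarrow> X i j = Y i j"
  shows "det_fun k X = det_fun k Y"
proof -
  have "(\<Prod>i<k. X i (\<sigma> i)) = (\<Prod>i<k. Y i (\<sigma> i))" if "\<sigma> permutes {..<k}" for \<sigma>
  proof (rule prod.cong)
    fix i assume "i \<in> {..<k}"
    then show "X i (\<sigma> i) = Y i (\<sigma> i)"
      using assms permutes_in_image[OF that, of i] by simp
  qed simp
  then show ?thesis
    unfolding det_fun_def by (intro sum.cong) simp_all
qed

text \<open>Expanding the product of sums gives a sum over all maps \<open>\<phi>\<close> from \<open>k + 1\<close> to \<open>k\<close> indices;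
  none of them is injective, so each summand is a determinant with a repeated row.\<close>
lemma det_fun_rank_deficient:
  fixes A B :: "nat \<Rightarrow> nat \<Rightarrow> 'a::field_char_0"
  shows "det_fun (Suc k) (\<lambda>i j. \<Sum>l<k. A i l * B l j) = 0"
proof -
  let ?\<Phi> = "{..<Suc k} \<rightarrow>\<^sub>E {..<k}"
  have expand: "(\<Prod>i<Suc k. \<Sum>l<k. A i l * B l (\<sigma> i))
      = (\<Sum>\<phi>\<in>?\<Phi>. (\<Prod>i<Suc k. A i (\<phi> i)) * (\<Prod>i<Suc k. B (\<phi> i) (\<sigma> i)))" for \<sigma>
    by (subst prod.distrib[symmetric], rule prod_sum_PiE) auto
  have "det_fun (Suc k) (\<lambda>i j. \<Sum>l<k. A i l * B l j)
      = (\<Sum>\<sigma> | \<sigma> permutes {..<Suc k}. \<Sum>\<phi>\<in>?\<Phi>.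
          (\<Prod>i<Suc k. A i (\<phi> i)) * (of_int (sign \<sigma>) * (\<Prod>i<Suc k. B (\<phi> i) (\<sigma> i))))"
    unfolding det_fun_def expand sum_distrib_left by (simp only: mult.left_commute)
  also have "\<dots> = (\<Sum>\<phi>\<in>?\<Phi>. (\<Prod>i<Suc k. A i (\<phi> i)) * det_fun (Suc k) (\<lambda>i j. B (\<phi> i) j))"
    by (subst sum.swap) (simp only: det_fun_def sum_distrib_left)
  also have "\<dots> = 0"
  proof (rule sum.neutral, rule ballI)
    fix \<phi> assume "\<phi> \<in> ?\<Phi>"
    then have "\<phi> ` {..<Suc k} \<subseteq> {..<k}"
      by auto
    then have "\<not> inj_on \<phi> {..<Suc k}"
      using card_inj_on_le[of \<phi> "{..<Suc k}" "{..<k}"] by auto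
    then obtain a b where ab: "a < Suc k" "b < Suc k" "a \<noteq> b" "\<phi> a = \<phi> b"
      by (auto simp: inj_on_def)
    then have "det_fun (Suc k) (\<lambda>i j. B (\<phi> i) j) = 0"
      by (intro det_fun_repeated_row[OF ab(1-3)]) simp
    then show "(\<Prod>i<Suc k. A i (\<phi> i)) * det_fun (Suc k) (\<lambda>i j. B (\<phi> i) j) = 0"
      by simp
  qed
  finally show ?thesis .
qed

text \<open>\<open>minors\<close> lists its rows and columns in increasing order, whereas bordering
  produces arbitrary index sequences; this relates the two by a permutation.\<close>

lemma sorted_index_permutation:
  assumes "inj_on r {..<k}" "r ` {..<k} = I"
  shows "\<exists>\<pi>. \<pi> permutes {..<k} \<and> (\<forall>i<k. r i = sorted_list_of_set I ! \<pi> i)"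
proof -
  let ?L = "sorted_list_of_set I"
  have fin: "finite I" and card: "card I = k"
    using assms by (auto simp: card_image)
  have L: "bij_betw ((!) ?L) {..<k} I"
    using bij_betw_nth[of ?L "{..<k}" I] fin card by simp
  have r: "bij_betw r {..<k} I" and rI: "\<And>i. i < k \<Longrightarrow> r i \<in> I"
    using assms by (auto simp add: bij_betw_def)
  define \<pi> where "\<pi> i = (if i < k then inv_into {..<k} ((!) ?L) (r i) else i)" for i
  have "bij_betw (inv_into {..<k} ((!) ?L) \<circ> r) {..<k} {..<k}"
    using r bij_betw_inv_into[OF L] by (rule bij_betw_trans)
  moreover have "bij_betw \<pi> {..<k} {..<k} \<longleftrightarrow>
      bij_betw (inv_into {..<k} ((!) ?L) \<circ> r) {..<k} {..<k}"
    by (rule bij_betw_cong) (simp add: \<pi>_def)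
  ultimately have "bij_betw \<pi> {..<k} {..<k}"
    by simp
  then have "\<pi> permutes {..<k}"
    by (rule bij_imp_permutes) (simp add: \<pi>_def lessThan_iff)
  moreover have "r i = ?L ! \<pi> i" if "i < k" for i
    using that bij_betw_inv_into_right[OF L rI[OF that]] by (simp add: \<pi>_def)
  ultimately show ?thesis
    by blast
qed

text \<open>A repeated index makes two rows or two columns equal; without repetition, sorting the
  indices changes the determinant only by a sign.\<close>

lemma minors_zero_indices:
  fixes X :: "nat \<Rightarrow> nat \<Rightarrow> 'a::field_char_0"
  assumes zero: "\<forall>x\<in>minors k m n X. x = 0"
    and r: "\<And>i. i < k \<Longrightarrow> r i < m" and s: "\<And>i. i < k \<Longrightarrow> s i < n"
  shows "det_fun k (\<lambda>i j. X (r i) (s j)) = 0"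
proof -
  consider "\<not> inj_on r {..<k}" | "\<not> inj_on s {..<k}" | "inj_on r {..<k}" "inj_on s {..<k}" by blast
  then show ?thesis
  proof cases
    case 1
    then obtain a b where "a < k" "b < k" "a \<noteq> b" "r a = r b"
      by (auto simp: inj_on_def)
    then show ?thesis
      by (intro det_fun_repeated_row[of a k b]) auto
  next
    case 2
    then obtain a b where "a < k" "b < k" "a \<noteq> b" "s a = s b"
      by (auto simp: inj_on_def)
    then have "det_fun k (\<lambda>i j. X (r j) (s i)) = 0"
      by (intro det_fun_repeated_row[of a k b]) auto
    then show ?thesis
      using det_fun_transpose[of k "\<lambda>i j. X (r i) (s j)"] by simp
  next
    case 3
    define I J where "I = r ` {..<k}" and "J = s ` {..<k}"
    obtain \<pi> where \<pi>: "\<pi> permutes {..<k}" "\<And>i. i < k \<Longrightarrow> r i = sorted_list_of_set I ! \<pi> i"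
      using sorted_index_permutation[OF 3(1) I_def[symmetric]] by blast
    obtain \<tau> where \<tau>: "\<tau> permutes {..<k}" "\<And>i. i < k \<Longrightarrow> s i = sorted_list_of_set J ! \<tau> i"
      using sorted_index_permutation[OF 3(2) J_def[symmetric]] by blast
    let ?Y = "\<lambda>i j. X (sorted_list_of_set I ! i) (sorted_list_of_set J ! j)"
    have "det_fun k ?Y \<in> minors k m n X"
    proof -
      have "I \<subseteq> {..<m}" "J \<subseteq> {..<n}" "card I = k" "card J = k"
        using 3 r s by (auto simp: I_def J_def card_image)
      then show ?thesis
        unfolding minors_def by blast
    qed
    then have Y0: "det_fun k ?Y = 0"
      using zero by blast
    have "det_fun k (\<lambda>i j. X (r i) (s j)) = det_fun k (\<lambda>i j. ?Y (\<pi> i) (\<tau> j))"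
      by (rule det_fun_cong) (simp add: \<pi>(2) \<tau>(2))
    also have "\<dots> = of_int (sign \<pi>) * det_fun k (\<lambda>i j. ?Y i (\<tau> j))"
      by (rule det_fun_permute_rows[OF \<pi>(1)])
    also have "det_fun k (\<lambda>i j. ?Y i (\<tau> j)) = det_fun k (\<lambda>i j. ?Y j (\<tau> i))"
      by (rule det_fun_transpose[symmetric])
    also have "\<dots> = of_int (sign \<tau>) * det_fun k (\<lambda>i j. ?Y j i)"
      by (rule det_fun_permute_rows[OF \<tau>(1), of "\<lambda>i j. ?Y j i"])
    also have "det_fun k (\<lambda>i j. ?Y j i) = det_fun k ?Y"
      by (rule det_fun_transpose)
    finally show ?thesis
      using Y0 by simp
  qed
qed

text \<open>With a nonvanishing minor of maximal size \<open>K\<close>, expanding the vanishing bordered minors along the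
  bordering column writes every row as a combination of the \<open>K\<close> chosen rows.\<close>
lemma minors_zero_imp_factors:
  fixes X :: "nat \<Rightarrow> nat \<Rightarrow> 'a::field_char_0"
  assumes zero: "\<forall>x\<in>minors (Suc k) m n X. x = 0"
  shows "factors_through k m n X"
proof -
  define Q where "Q = (\<lambda>K. \<forall>r s. (\<forall>i<K. r i < m) \<longrightarrow> (\<forall>i<K. s i < n) \<longrightarrow>
    det_fun K (\<lambda>i j. X (r i) (s j)) = 0)"
  have "Q (Suc k)"
    unfolding Q_def using minors_zero_indices[OF zero] by blast
  \<comment> \<open>The empty determinant is 1. So some \<open>K \<le> k\<close> has a nonzero minor
    of size \<open>K\<close> while all minors of size \<open>K + 1\<close> vanish.\<close>
  moreover have "\<not> Q 0"
    by (auto simp: Q_def det_fun_def)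
  ultimately obtain K where "K < Suc k" "\<forall>i\<le>K. \<not> Q i" "Q (Suc K)"
    using ex_least_nat_less[of Q "Suc k"] by blast
  then have K: "K \<le> k" "\<not> Q K" "Q (Suc K)"
    by simp_all
  obtain r s where r: "\<And>i. i < K \<Longrightarrow> r i < m" and s: "\<And>i. i < K \<Longrightarrow> s i < n"
    and D: "det_fun K (\<lambda>i j. X (r i) (s j)) \<noteq> 0"
    using K(2) unfolding Q_def by blast
  let ?D = "det_fun K (\<lambda>i j. X (r i) (s j))"
  \<comment> \<open>The chosen \<open>K\<close> by \<open>K\<close> block, bordered by row
    \<open>i\<close> and column \<open>j\<close> at the index \<open>K\<close>.\<close>
  define M where "M i j = (\<lambda>a b. X (if a < K then r a else i) (if b < K then s b else j))" for i j
  \<comment> \<open>The bordering column 0 is an arbitrary choice, since the cofactors ignore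
    it.\<close>
  define C where "C i a = col_cofactor K (M i 0) a" for i a
  have cof: "col_cofactor K (M i j) a = C i a" for i j a
    unfolding C_def by (rule col_cofactor_cong) (simp add: M_def)
  have CK: "C i K = ?D" for i
    unfolding C_def col_cofactor_last by (rule det_fun_cong) (simp add: M_def)
  \<comment> \<open>Cramer's rule; zeros pad the \<open>K\<close> coefficients up to length
    \<open>k\<close>.\<close>
  define A where "A i l = (if l < K then - C i l / ?D else 0)" for i l
  define B where "B l j = X (r l) j" for l j
  have "X i j = (\<Sum>l<k. A i l * B l j)" if ij: "i < m" "j < n" for i j
  proof -
    have bordered: "det_fun (Suc K) (\<lambda>a b. X (r' a) (s' b)) = 0"
      if "\<forall>a<Suc K. r' a < m" "\<forall>b<Suc K. s' b < n" for r' s'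
      using K(3) that unfolding Q_def by simp
    have "det_fun (Suc K) (M i j) = 0"
      unfolding M_def by (rule bordered) (use r s ij in simp_all)
    then have "0 = (\<Sum>a<Suc K. M i j a K * C i a)"
      unfolding det_fun_expand_last_column cof by (rule sym)
    also have "\<dots> = (\<Sum>a<K. M i j a K * C i a) + M i j K K * C i K"
      by (rule sum.lessThan_Suc)
    also have "\<dots> = (\<Sum>a<K. X (r a) j * C i a) + X i j * ?D"
    proof -
      have "(\<Sum>a<K. M i j a K * C i a) = (\<Sum>a<K. X (r a) j * C i a)"
        by (rule sum.cong) (simp_all add: M_def)
      then show ?thesis
        by (simp only: CK) (simp add: M_def)
    qed
    finally have "X i j * ?D = - (\<Sum>a<K. X (r a) j * C i a)"
      by (simp add: eq_neg_iff_add_eq_0 add.commute)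
    then have "X i j = - (\<Sum>a<K. X (r a) j * C i a) / ?D"
      using D nonzero_eq_divide_eq by blast
    also have "\<dots> = (\<Sum>a<K. A i a * B a j)"
      by (simp add: A_def B_def sum_negf sum_divide_distrib mult.commute)
    also have "\<dots> = (\<Sum>a<k. A i a * B a j)"
      using K(1) by (intro sum.mono_neutral_left) (auto simp: A_def)
    finally show ?thesis .
  qed
  then show ?thesis
    unfolding factors_through_def by blast
qed

lemma factors_imp_minors_zero:
  fixes X :: "nat \<Rightarrow> nat \<Rightarrow> 'a::field_char_0"
  assumes "factors_through k m n X" "x \<in> minors (Suc k) m n X"
  shows "x = 0"
proof -
  obtain A B where AB: "\<And>i j. i < m \<Longrightarrow> j < n \<Longrightarrow> X i j = (\<Sum>l<k. A i l * B l j)"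
    using assms(1) unfolding factors_through_def by blast
  obtain I J where IJ: "I \<subseteq> {..<m}" "J \<subseteq> {..<n}" "card I = Suc k" "card J = Suc k"
    and x: "x = det_fun (Suc k) (\<lambda>a b. X (sorted_list_of_set I ! a) (sorted_list_of_set J ! b))"
    using assms(2) unfolding minors_def by blast
  let ?r = "\<lambda>a. sorted_list_of_set I ! a" and ?s = "\<lambda>a. sorted_list_of_set J ! a"
  have fin: "finite I" "finite J"
    using IJ finite_subset by blast+
  have r: "?r a < m" and s: "?s a < n" if "a < Suc k" for a
    using nth_mem[of a "sorted_list_of_set I"] nth_mem[of a "sorted_list_of_set J"] that IJ fin by auto
  have "x = det_fun (Suc k) (\<lambda>a b. \<Sum>l<k. A (?r a) l * B l (?s b))"
    unfolding x by (rule det_fun_cong) (simp add: AB r s)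
  then show ?thesis
    by (simp only: det_fun_rank_deficient)
qed

lemma factors_through_scale:
  assumes "factors_through k m n X" "\<And>i j. i < m \<Longrightarrow> j < n \<Longrightarrow> Y i j = s i * X i j * u j"
  shows "factors_through k m n Y"
proof -
  obtain A B where AB: "\<And>i j. i < m \<Longrightarrow> j < n \<Longrightarrow> X i j = (\<Sum>l<k. A i l * B l j)"
    using assms(1) unfolding factors_through_def by blast
  define A' B' where "A' i l = s i * A i l" and "B' l j = B l j * u j" for i l j
  have "Y i j = (\<Sum>l<k. A' i l * B' l j)" if "i < m" "j < n" for i j
    using assms(2)[OF that] AB[OF that]
    by (simp add: A'_def B'_def sum_distrib_left sum_distrib_right mult.assoc)
  then show ?thesis
    unfolding factors_through_def by blast
qed

section \<open>Toric ideals and their positive points\<close>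

definition monom_eval :: "('v \<Rightarrow> 'a::comm_semiring_1) \<Rightarrow> ('v \<Rightarrow>\<^sub>0 nat) \<Rightarrow> 'a" where
  "monom_eval x m = (\<Prod>e\<in>Poly_Mapping.keys m. x e ^ Poly_Mapping.lookup m e)"

definition poly_eval :: "('v \<Rightarrow> complex) \<Rightarrow> 'v cpoly \<Rightarrow> complex" where
  "poly_eval x p = (\<Sum>m\<in>Poly_Mapping.keys p. Poly_Mapping.lookup p m * monom_eval x m)"

lemma monom_eval_superset:
  assumes "finite S" "Poly_Mapping.keys m \<subseteq> S"
  shows "monom_eval x m = (\<Prod>e\<in>S. x e ^ Poly_Mapping.lookup m e)"
  unfolding monom_eval_def using assms
  by (intro prod.mono_neutral_left) (auto simp: in_keys_iff)

lemma poly_eval_superset: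
  assumes "finite S" "Poly_Mapping.keys p \<subseteq> S"
  shows "poly_eval x p = (\<Sum>m\<in>S. Poly_Mapping.lookup p m * monom_eval x m)"
  unfolding poly_eval_def using assms
  by (intro sum.mono_neutral_left) (auto simp: in_keys_iff)

lemma monom_eval_zero [simp]: "monom_eval x 0 = 1"
  by (simp add: monom_eval_def)

lemma monom_eval_single [simp]: "monom_eval x (Poly_Mapping.single e n) = x e ^ n"
  by (subst monom_eval_superset[of "{e}"]) auto

lemma monom_eval_add: "monom_eval x (m + n) = monom_eval x m * monom_eval x n"
proof -
  let ?S = "Poly_Mapping.keys m \<union> Poly_Mapping.keys n"
  have "monom_eval x (m + n) = (\<Prod>e\<in>?S. x e ^ Poly_Mapping.lookup (m + n) e)"
    using keys_add[of m n] by (intro monom_eval_superset) auto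
  also have "\<dots> = (\<Prod>e\<in>?S. x e ^ Poly_Mapping.lookup m e) * (\<Prod>e\<in>?S. x e ^ Poly_Mapping.lookup n e)"
    by (simp add: lookup_add power_add prod.distrib)
  also have "\<dots> = monom_eval x m * monom_eval x n"
    using monom_eval_superset[of ?S m x] monom_eval_superset[of ?S n x] by simp
  finally show ?thesis .
qed

lemma monom_eval_cong:
  "(\<And>e. e \<in> Poly_Mapping.keys m \<Longrightarrow> x e = y e) \<Longrightarrow> monom_eval x m = monom_eval y m"
  by (simp add: monom_eval_def)

lemma monom_eval_of_real: "monom_eval (\<lambda>e. of_real (x e)) m = of_real (monom_eval x m)"
  by (simp add: monom_eval_def)

lemma poly_eval_zero [simp]: "poly_eval x 0 = 0"
  by (simp add: poly_eval_def)

lemma poly_eval_single [simp]: "poly_eval x (Poly_Mapping.single m c) = c * monom_eval x m"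
  by (subst poly_eval_superset[of "{m}"]) auto

lemma poly_eval_add: "poly_eval x (p + q) = poly_eval x p + poly_eval x q"
proof -
  let ?S = "Poly_Mapping.keys p \<union> Poly_Mapping.keys q"
  have "poly_eval x (p + q) = (\<Sum>m\<in>?S. Poly_Mapping.lookup (p + q) m * monom_eval x m)"
    using keys_add[of p q] by (intro poly_eval_superset) auto
  also have "\<dots> = (\<Sum>m\<in>?S. Poly_Mapping.lookup p m * monom_eval x m)
      + (\<Sum>m\<in>?S. Poly_Mapping.lookup q m * monom_eval x m)"
    by (simp add: lookup_add distrib_right sum.distrib)
  also have "\<dots> = poly_eval x p + poly_eval x q"
    using poly_eval_superset[of ?S p x] poly_eval_superset[of ?S q x] by simp
  finally show ?thesis .
qed

lemma poly_eval_sum: "poly_eval x (\<Sum>i\<in>I. h i) = (\<Sum>i\<in>I. poly_eval x (h i))"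
  by (induction I rule: infinite_finite_induct) (auto simp: poly_eval_add)

lemma poly_mapping_sum_single:
  "p = (\<Sum>m\<in>Poly_Mapping.keys p. Poly_Mapping.single m (Poly_Mapping.lookup p m))"
proof (rule poly_mapping_eqI)
  fix k
  show "Poly_Mapping.lookup p k =
    Poly_Mapping.lookup (\<Sum>m\<in>Poly_Mapping.keys p. Poly_Mapping.single m (Poly_Mapping.lookup p m)) k"
    by (cases "k \<in> Poly_Mapping.keys p") (auto simp: lookup_sum lookup_single when_def in_keys_iff)
qed

lemma poly_eval_mult: "poly_eval x (p * q) = poly_eval x p * poly_eval x q"
proof -
  have "p * q = (\<Sum>m\<in>Poly_Mapping.keys p. \<Sum>n\<in>Poly_Mapping.keys q.
      Poly_Mapping.single m (Poly_Mapping.lookup p m) * Poly_Mapping.single n (Poly_Mapping.lookup q n))"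
    by (subst (1) poly_mapping_sum_single[of p], subst (1) poly_mapping_sum_single[of q])
      (rule sum_product)
  then have "poly_eval x (p * q) = (\<Sum>m\<in>Poly_Mapping.keys p. \<Sum>n\<in>Poly_Mapping.keys q.
      (Poly_Mapping.lookup p m * monom_eval x m) * (Poly_Mapping.lookup q n * monom_eval x n))"
    by (simp add: poly_eval_sum mult_single monom_eval_add mult.assoc mult.left_commute)
  also have "\<dots> = poly_eval x p * poly_eval x q"
    unfolding poly_eval_def by (rule sum_product[symmetric])
  finally show ?thesis .
qed

lemma poly_eval_of_int [simp]: "poly_eval x (of_int k) = of_int k"
  using poly_eval_single[of x 0 "of_int k"] by simp

lemma poly_eval_one [simp]: "poly_eval x 1 = 1"
  using poly_eval_of_int[of x 1] by simp

lemma poly_eval_prod: "poly_eval x (\<Prod>i\<in>I. h i) = (\<Prod>i\<in>I. poly_eval x (h i))"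
  by (induction I rule: infinite_finite_induct) (auto simp: poly_eval_mult)

lemma poly_eval_power: "poly_eval x (p ^ n) = poly_eval x p ^ n"
  by (induction n) (auto simp: poly_eval_mult)

lemma poly_eval_Var [simp]: "poly_eval x (Var e) = x e"
  by (simp add: Var_def)

lemma poly_eval_det_fun: "poly_eval x (det_fun k A) = det_fun k (\<lambda>i j. poly_eval x (A i j))"
  by (simp add: det_fun_def poly_eval_sum poly_eval_mult poly_eval_prod)

section \<open>Polynomial rings, ideals and saturation\<close>

lemma poly_ring_zero: "0 \<in> poly_ring E"
  by (simp add: poly_ring_def)

lemma poly_ring_single: "Poly_Mapping.keys m \<subseteq> E \<Longrightarrow> Poly_Mapping.single m c \<in> poly_ring E"
  by (simp add: poly_ring_def)

lemma poly_ring_of_int: "of_int k \<in> poly_ring E"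
  using poly_ring_single[of 0 E "of_int k"] by simp

lemma poly_ring_one: "1 \<in> poly_ring E"
  using poly_ring_of_int[of 1] by simp

lemma poly_ring_Var: "e \<in> E \<Longrightarrow> Var e \<in> poly_ring E"
  by (simp add: Var_def poly_ring_single)

lemma poly_ring_add: "p \<in> poly_ring E \<Longrightarrow> q \<in> poly_ring E \<Longrightarrow> p + q \<in> poly_ring E"
  using keys_add[of p q] unfolding poly_ring_def by blast

lemma poly_ring_mult:
  assumes "p \<in> poly_ring E" "q \<in> poly_ring E"
  shows "p * q \<in> poly_ring E"
  unfolding poly_ring_def
proof (intro CollectI ballI)
  fix k assume "k \<in> Poly_Mapping.keys (p * q)"
  then obtain m n where "m \<in> Poly_Mapping.keys p" "n \<in> Poly_Mapping.keys q" "k = m + n"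
    using keys_mult by blast
  then show "Poly_Mapping.keys k \<subseteq> E"
    using assms keys_add[of m n] unfolding poly_ring_def by blast
qed

lemma poly_ring_sum: "(\<And>i. i \<in> I \<Longrightarrow> h i \<in> poly_ring E) \<Longrightarrow> (\<Sum>i\<in>I. h i) \<in> poly_ring E"
  by (induction I rule: infinite_finite_induct) (auto simp: poly_ring_zero poly_ring_add)

lemma poly_ring_prod: "(\<And>i. i \<in> I \<Longrightarrow> h i \<in> poly_ring E) \<Longrightarrow> (\<Prod>i\<in>I. h i) \<in> poly_ring E"
  by (induction I rule: infinite_finite_induct) (auto simp: poly_ring_one poly_ring_mult)

lemma poly_ring_det_fun:
  assumes "\<And>i j. i < k \<Longrightarrow> j < k \<Longrightarrow> A i j \<in> poly_ring E"
  shows "det_fun k A \<in> poly_ring E"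
  unfolding det_fun_def
proof (intro poly_ring_sum poly_ring_mult poly_ring_prod poly_ring_of_int)
  fix \<sigma> i assume "\<sigma> \<in> {\<sigma>. \<sigma> permutes {..<k}}" "i \<in> {..<k}"
  then show "A i (\<sigma> i) \<in> poly_ring E"
    using assms permutes_in_image[of \<sigma> "{..<k}" i] by simp
qed

lemma poly_eval_ideal_gen:
  assumes "p \<in> ideal_gen R G" "\<And>g. g \<in> G \<Longrightarrow> poly_eval x g = 0"
  shows "poly_eval x p = 0"
proof -
  obtain t r where "t \<subseteq> G" "p = (\<Sum>g\<in>t. r g * g)"
    using assms(1) unfolding ideal_gen_def by blast
  then show ?thesis
    using assms(2) by (auto simp: poly_eval_sum poly_eval_mult intro!: sum.neutral)
qed

text \<open>The power of \<open>h\<close> introduced by the saturation can be cancelled at a point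
  where \<open>h\<close> does not vanish, so saturating imposes no further condition there.\<close>

lemma poly_eval_saturation:
  assumes "p \<in> saturation R (ideal_gen R G) h" "\<And>g. g \<in> G \<Longrightarrow> poly_eval x g = 0"
    and "poly_eval x h \<noteq> 0"
  shows "poly_eval x p = 0"
proof -
  obtain n where "h ^ n * p \<in> ideal_gen R G"
    using assms(1) unfolding saturation_def by blast
  then have "poly_eval x (h ^ n * p) = 0"
    using poly_eval_ideal_gen assms(2) by blast
  then show ?thesis
    using assms(3) by (simp add: poly_eval_mult poly_eval_power)
qed

lemma generator_in_saturation:
  assumes "g \<in> G" "g \<in> R" "1 \<in> R"
  shows "g \<in> saturation R (ideal_gen R G) h"
proof -
  have "g \<in> ideal_gen R G"
    unfolding ideal_gen_def using assms by (intro CollectI exI[of _ "{g}"] exI[of _ "\<lambda>_. 1"]) auto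
  then have "h ^ 0 * g \<in> ideal_gen R G"
    by simp
  then show ?thesis
    unfolding saturation_def using assms by blast
qed

section \<open>Laurent polynomials on the positive torus\<close>

text \<open>The logarithm of the Laurent monomial with exponent \<open>k\<close> at the point z_n =
  exp (w n), hence additive in \<open>k\<close> and linear in \<open>w\<close>.\<close>

definition weight :: "(nat \<Rightarrow> real) \<Rightarrow> (nat \<Rightarrow>\<^sub>0 int) \<Rightarrow> real" where
  "weight w k = (\<Sum>n\<in>Poly_Mapping.keys k. real_of_int (Poly_Mapping.lookup k n) * w n)"

definition laurent_eval :: "(nat \<Rightarrow> real) \<Rightarrow> laurent \<Rightarrow> complex" where
  "laurent_eval w L =
     (\<Sum>k\<in>Poly_Mapping.keys L. Poly_Mapping.lookup L k * of_real (exp (weight w k)))"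

definition monom_exponent :: "('v \<Rightarrow> (nat \<Rightarrow>\<^sub>0 int)) \<Rightarrow> ('v \<Rightarrow>\<^sub>0 nat) \<Rightarrow> (nat \<Rightarrow>\<^sub>0 int)" where
  "monom_exponent a m = (\<Sum>e\<in>Poly_Mapping.keys m.
     Poly_Mapping.map (\<lambda>c. int (Poly_Mapping.lookup m e) * c) (a e))"

lemma weight_superset:
  assumes "finite S" "Poly_Mapping.keys k \<subseteq> S"
  shows "weight w k = (\<Sum>n\<in>S. real_of_int (Poly_Mapping.lookup k n) * w n)"
  unfolding weight_def using assms
  by (intro sum.mono_neutral_left) (auto simp: in_keys_iff)

lemma weight_add: "weight w (k + l) = weight w k + weight w l"
proof -
  let ?S = "Poly_Mapping.keys k \<union> Poly_Mapping.keys l"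
  have "weight w (k + l) = (\<Sum>n\<in>?S. real_of_int (Poly_Mapping.lookup (k + l) n) * w n)"
    using keys_add[of k l] by (intro weight_superset) auto
  also have "\<dots> = (\<Sum>n\<in>?S. real_of_int (Poly_Mapping.lookup k n) * w n)
      + (\<Sum>n\<in>?S. real_of_int (Poly_Mapping.lookup l n) * w n)"
    by (simp add: lookup_add distrib_right sum.distrib)
  also have "\<dots> = weight w k + weight w l"
    using weight_superset[of ?S k w] weight_superset[of ?S l w] by simp
  finally show ?thesis .
qed

lemma weight_zero [simp]: "weight w 0 = 0"
  by (simp add: weight_def)

lemma weight_single [simp]: "weight w (Poly_Mapping.single n c) = real_of_int c * w n"
  by (subst weight_superset[of "{n}"]) auto

lemma weight_sum: "weight w (\<Sum>i\<in>I. h i) = (\<Sum>i\<in>I. weight w (h i))"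
  by (induction I rule: infinite_finite_induct) (auto simp: weight_add)

lemma weight_diff: "weight w (k - l) = weight w k - weight w l"
  using weight_add[of w "k - l" l] by simp

lemma lookup_map_mult:
  "Poly_Mapping.lookup (Poly_Mapping.map (\<lambda>c. b * c) k) n = b * Poly_Mapping.lookup (k :: nat \<Rightarrow>\<^sub>0 int) n"
  by (simp add: Poly_Mapping.map.rep_eq when_def)

lemma map_mult_add:
  "Poly_Mapping.map (\<lambda>x. (b + c) * x) (k :: nat \<Rightarrow>\<^sub>0 int)
    = Poly_Mapping.map (\<lambda>x. b * x) k + Poly_Mapping.map (\<lambda>x. c * x) k"
proof (rule poly_mapping_eqI)
  fix n
  show "Poly_Mapping.lookup (Poly_Mapping.map (\<lambda>x. (b + c) * x) k) n =
    Poly_Mapping.lookup (Poly_Mapping.map (\<lambda>x. b * x) k + Poly_Mapping.map (\<lambda>x. c * x) k) n"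
    unfolding lookup_add lookup_map_mult by (rule distrib_right)
qed

lemma weight_map_mult: "weight w (Poly_Mapping.map (\<lambda>c. b * c) k) = real_of_int b * weight w k"
proof -
  have "Poly_Mapping.keys (Poly_Mapping.map (\<lambda>c. b * c) k) \<subseteq> Poly_Mapping.keys k"
    by (auto simp: in_keys_iff lookup_map_mult)
  then have "weight w (Poly_Mapping.map (\<lambda>c. b * c) k)
      = (\<Sum>n\<in>Poly_Mapping.keys k. real_of_int (b * Poly_Mapping.lookup k n) * w n)"
    by (subst weight_superset[of "Poly_Mapping.keys k"]) (auto simp: lookup_map_mult)
  then show ?thesis
    by (simp add: weight_def sum_distrib_left mult.assoc)
qed

lemma monom_exponent_superset:
  assumes "finite S" "Poly_Mapping.keys m \<subseteq> S"
  shows "monom_exponent a m = (\<Sum>e\<in>S. Poly_Mapping.map (\<lambda>c. int (Poly_Mapping.lookup m e) * c) (a e))"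
  unfolding monom_exponent_def using assms
  by (intro sum.mono_neutral_left) (auto simp: in_keys_iff lookup_map_mult intro!: poly_mapping_eqI)

lemma monom_exponent_add: "monom_exponent a (m + n) = monom_exponent a m + monom_exponent a n"
proof -
  let ?S = "Poly_Mapping.keys m \<union> Poly_Mapping.keys n"
  let ?g = "\<lambda>m e. Poly_Mapping.map (\<lambda>c. int (Poly_Mapping.lookup m e) * c) (a e)"
  have "monom_exponent a (m + n) = (\<Sum>e\<in>?S. ?g (m + n) e)"
    using keys_add[of m n] by (intro monom_exponent_superset) auto
  also have "\<dots> = (\<Sum>e\<in>?S. ?g m e + ?g n e)"
    by (simp only: lookup_add of_nat_add map_mult_add)
  also have "\<dots> = monom_exponent a m + monom_exponent a n"
    using monom_exponent_superset[of ?S m a] monom_exponent_superset[of ?S n a]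
    by (simp add: sum.distrib)
  finally show ?thesis .
qed

lemma monom_exponent_zero [simp]: "monom_exponent a 0 = 0"
  by (simp add: monom_exponent_def)

lemma monom_exponent_single [simp]: "monom_exponent a (Poly_Mapping.single e 1) = a e"
  by (subst monom_exponent_superset[of "{e}"]) (auto simp: lookup_map_mult intro!: poly_mapping_eqI)

lemma monom_eval_exp_weight:
  "monom_eval (\<lambda>e. exp (weight w (a e))) m = exp (weight w (monom_exponent a m))"
  by (simp add: monom_eval_def monom_exponent_def weight_sum weight_map_mult exp_sum exp_of_nat_mult)

lemma laurent_eval_superset:
  assumes "finite S" "Poly_Mapping.keys L \<subseteq> S"
  shows "laurent_eval w L = (\<Sum>k\<in>S. Poly_Mapping.lookup L k * of_real (exp (weight w k)))"
  unfolding laurent_eval_def using assms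
  by (intro sum.mono_neutral_left) (auto simp: in_keys_iff)

lemma laurent_eval_single [simp]:
  "laurent_eval w (Poly_Mapping.single k c) = c * of_real (exp (weight w k))"
  by (subst laurent_eval_superset[of "{k}"]) auto

lemma laurent_eval_add: "laurent_eval w (L + M) = laurent_eval w L + laurent_eval w M"
proof -
  let ?S = "Poly_Mapping.keys L \<union> Poly_Mapping.keys M"
  have "laurent_eval w (L + M)
      = (\<Sum>k\<in>?S. Poly_Mapping.lookup (L + M) k * of_real (exp (weight w k)))"
    using keys_add[of L M] by (intro laurent_eval_superset) auto
  also have "\<dots> = (\<Sum>k\<in>?S. Poly_Mapping.lookup L k * of_real (exp (weight w k)))
      + (\<Sum>k\<in>?S. Poly_Mapping.lookup M k * of_real (exp (weight w k)))"
    by (simp add: lookup_add distrib_right sum.distrib)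
  also have "\<dots> = laurent_eval w L + laurent_eval w M"
    using laurent_eval_superset[of ?S L w] laurent_eval_superset[of ?S M w] by simp
  finally show ?thesis .
qed

lemma laurent_eval_zero [simp]: "laurent_eval w 0 = 0"
  by (simp add: laurent_eval_def)

lemma laurent_eval_sum: "laurent_eval w (\<Sum>i\<in>I. h i) = (\<Sum>i\<in>I. laurent_eval w (h i))"
  by (induction I rule: infinite_finite_induct) (auto simp: laurent_eval_add)

lemma monomial_map_eq:
  "monomial_map a p = (\<Sum>m\<in>Poly_Mapping.keys p.
     Poly_Mapping.single (monom_exponent a m) (Poly_Mapping.lookup p m))"
  by (simp add: monomial_map_def monom_exponent_def)

lemma laurent_eval_monomial_map:
  "laurent_eval w (monomial_map a p) = poly_eval (\<lambda>e. of_real (exp (weight w (a e)))) p"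
  by (simp add: monomial_map_eq laurent_eval_sum poly_eval_def monom_eval_of_real monom_eval_exp_weight)

text \<open>Vandermonde argument by elimination: subtracting \<open>\<mu> h\<close> times the sum
  for \<open>t\<close> from the sum for \<open>t + 1\<close> removes the node \<open>h\<close> and
  multiplies each other coefficient by the nonzero factor \<open>\<mu> k - \<mu> h\<close>.\<close>

lemma power_sums_zero:
  fixes L :: "'k \<Rightarrow> 'a::idom"
  assumes "finite K" "inj_on \<mu> K" "\<And>t::nat. (\<Sum>k\<in>K. L k * \<mu> k ^ t) = 0" "k \<in> K"
  shows "L k = 0"
  using assms
proof (induction K arbitrary: L k rule: finite_induct)
  case (insert h K)
  have 0: "L k = 0" if "k \<in> K" for k
  proof -
    have "(\<Sum>k\<in>K. L k * (\<mu> k - \<mu> h) * \<mu> k ^ t) = 0" for t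
    proof -
      have "(\<Sum>k\<in>insert h K. L k * \<mu> k ^ Suc t) - \<mu> h * (\<Sum>k\<in>insert h K. L k * \<mu> k ^ t) = 0"
        using insert.prems(2)[of t] insert.prems(2)[of "Suc t"] by simp
      then show ?thesis
        using insert.hyps by (simp add: sum_distrib_left sum_subtractf[symmetric] algebra_simps)
    qed
    then have "L k * (\<mu> k - \<mu> h) = 0"
      using insert.IH[of "\<lambda>k. L k * (\<mu> k - \<mu> h)" k] insert.prems(1) that by auto
    moreover have "\<mu> k \<noteq> \<mu> h"
      using insert.prems(1) insert.hyps that by (auto simp: inj_on_def)
    ultimately show ?thesis by simp
  qed
  moreover have "L h = 0"
    using insert.prems(2)[of 0] insert.hyps 0 by simp
  ultimately show ?case
    using insert.prems(3) by auto
qed simp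

text \<open>For \<open>w n = b ^ n\<close> the difference of two distinct exponents becomes the
  value at \<open>b\<close> of a nonzero polynomial; finitely many pairs exclude only finitely many
  \<open>b\<close>.\<close>

lemma separating_weight:
  assumes "finite K"
  obtains w where "inj_on (weight w) K"
proof -
  define poly_of where "poly_of d = (\<Sum>n\<in>Poly_Mapping.keys d. monom (real_of_int (Poly_Mapping.lookup d n)) n)"
    for d :: "nat \<Rightarrow>\<^sub>0 int"
  have eval: "poly (poly_of d) b = weight (\<lambda>n. b ^ n) d" for d b
    by (simp add: poly_of_def weight_def poly_sum poly_monom)
  have nz: "poly_of d \<noteq> 0" if "d \<noteq> 0" for d
  proof -
    have "Poly_Mapping.keys d \<noteq> {}"
      using that by simp
    then obtain n where "n \<in> Poly_Mapping.keys d"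
      by blast
    then have n: "Poly_Mapping.lookup d n \<noteq> 0"
      by (simp add: in_keys_iff)
    then have "coeff (poly_of d) n = real_of_int (Poly_Mapping.lookup d n)"
      by (simp add: poly_of_def coeff_sum in_keys_iff)
    then show ?thesis
      using n by auto
  qed
  let ?B = "\<Union>(k, l)\<in>{(k, l) \<in> K \<times> K. k \<noteq> l}. {b. poly (poly_of (k - l)) b = 0}"
  have "finite {(k, l) \<in> K \<times> K. k \<noteq> l}"
    by (rule finite_subset[of _ "K \<times> K"]) (use assms in auto)
  then have "finite ?B"
  proof (rule finite_UN_I, clarify)
    fix k l :: "nat \<Rightarrow>\<^sub>0 int" assume "k \<noteq> l"
    then show "finite {b. poly (poly_of (k - l)) b = 0}"
      by (intro poly_roots_finite nz) simp
  qed
  then obtain b where b: "b \<notin> ?B"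
    using ex_new_if_finite[OF infinite_UNIV_char_0] by blast
  have "inj_on (weight (\<lambda>n. b ^ n)) K"
  proof (rule inj_onI, rule ccontr)
    fix k l assume "k \<in> K" "l \<in> K" "weight (\<lambda>n. b ^ n) k = weight (\<lambda>n. b ^ n) l" "k \<noteq> l"
    moreover from this have "poly (poly_of (k - l)) b = 0"
      by (simp add: eval weight_diff)
    ultimately show False
      using b by auto
  qed
  then show thesis
    using that by blast
qed

text \<open>With a separating \<open>w\<close>, evaluating at the multiples \<open>t * w\<close>
  raises the distinct numbers \<open>exp (weight w k)\<close> to the power \<open>t\<close>, so
  \<open>power_sums_zero\<close> applies to the coefficients.\<close>

lemma laurent_eval_all_zero:
  assumes "\<And>w. laurent_eval w L = 0"
  shows "L = 0"
proof -
  obtain w where w: "inj_on (weight w) (Poly_Mapping.keys L)"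
    using separating_weight[of "Poly_Mapping.keys L"] by auto
  have scale: "weight (\<lambda>n. real t * w n) k = real t * weight w k" for t k
    by (simp add: weight_def sum_distrib_left mult.left_commute)
  have "Poly_Mapping.lookup L k = 0" if "k \<in> Poly_Mapping.keys L" for k
  proof (rule power_sums_zero[OF _ _ _ that])
    show "inj_on (\<lambda>k. complex_of_real (exp (weight w k))) (Poly_Mapping.keys L)"
      using w by (auto simp: inj_on_def)
    show "(\<Sum>k\<in>Poly_Mapping.keys L. Poly_Mapping.lookup L k * complex_of_real (exp (weight w k)) ^ t) = 0" for t
      using assms[of "\<lambda>n. real t * w n"]
      by (simp add: laurent_eval_def scale exp_of_nat_mult)
  qed simp
  then have nokey: "k \<notin> Poly_Mapping.keys L" for k
    using lookup_not_eq_zero_eq_in_keys by metis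
  show ?thesis
  proof (rule poly_mapping_eqI)
    show "Poly_Mapping.lookup L k = Poly_Mapping.lookup 0 k" for k
      using nokey[of k] by (simp add: in_keys_iff)
  qed
qed

lemma monomial_map_zero_iff:
  "monomial_map a p = 0 \<longleftrightarrow> (\<forall>w. poly_eval (\<lambda>e. of_real (exp (weight w (a e)))) p = 0)"
proof
  show "monomial_map a p = 0 \<Longrightarrow> \<forall>w. poly_eval (\<lambda>e. of_real (exp (weight w (a e)))) p = 0"
    using laurent_eval_monomial_map[of _ a p] by simp
  show "\<forall>w. poly_eval (\<lambda>e. of_real (exp (weight w (a e)))) p = 0 \<Longrightarrow> monomial_map a p = 0"
    by (rule laurent_eval_all_zero) (simp add: laurent_eval_monomial_map)
qed

section \<open>Positive points of the non-incidence toric ideal\<close>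

definition graph_exponent :: "nat \<times> nat \<Rightarrow> (nat \<Rightarrow>\<^sub>0 int)" where
  "graph_exponent = (\<lambda>(i, j). Poly_Mapping.single (2 * i) 1 + Poly_Mapping.single (2 * j + 1) 1)"

lemma weight_graph_exponent: "weight w (graph_exponent (i, j)) = w (2 * i) + w (2 * j + 1)"
  by (simp add: graph_exponent_def weight_add)

text \<open>Induction on the edge set. A new edge \<open>(i0, j0)\<close> either closes a cycle, and then the binomial
  of that cycle determines its weight, or it joins two components, and then the potential \<open>w\<close> may be
  shifted on the component of \<open>i0\<close>, described by the predicates \<open>R\<close> (rows) and \<open>C\<close> (columns).\<close>
lemma graph_potential:
  fixes x :: "nat \<times> nat \<Rightarrow> real"
  assumes "finite E" "\<And>e. e \<in> E \<Longrightarrow> 0 < x e"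
    and "\<And>m n. Poly_Mapping.keys m \<subseteq> E \<Longrightarrow> Poly_Mapping.keys n \<subseteq> E \<Longrightarrow>
      monom_exponent graph_exponent m = monom_exponent graph_exponent n \<Longrightarrow> monom_eval x m = monom_eval x n"
  shows "\<exists>w. \<forall>e\<in>E. x e = exp (weight w (graph_exponent e))"
  using assms
proof (induction E rule: finite_induct)
  case (insert e0 E)
  let ?T = "monom_exponent graph_exponent"
  let ?r = "\<lambda>i. Poly_Mapping.single (2 * i) (1::int)" and ?c = "\<lambda>j. Poly_Mapping.single (2 * j + 1) (1::int)"
  obtain i0 j0 where e0: "e0 = (i0, j0)"
    by (cases e0)
  obtain w where w: "\<And>e. e \<in> E \<Longrightarrow> x e = exp (weight w (graph_exponent e))"
    using insert.IH insert.prems by (metis insertI2 subset_insertI2)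
  \<comment> \<open>Connectedness is expressed by monomials instead of paths: distributing the edges
    of a path alternately to \<open>m\<close> and \<open>n\<close> gives such an identity of
    exponents. In this form \<open>C j0\<close> yields a binomial of the toric ideal once
    \<open>n\<close> is multiplied by the edge \<open>e0\<close>.\<close>
  define R where "R i \<longleftrightarrow> (\<exists>m n. Poly_Mapping.keys m \<subseteq> E \<and> Poly_Mapping.keys n \<subseteq> E \<and> ?r i0 + ?T m = ?r i + ?T n)" for i
  define C where "C j \<longleftrightarrow> (\<exists>m n. Poly_Mapping.keys m \<subseteq> E \<and> Poly_Mapping.keys n \<subseteq> E \<and> ?T m = ?r i0 + ?c j + ?T n)" for j
  have T1: "?T (Poly_Mapping.single (i, j) 1 + m) = ?r i + ?c j + ?T m" for i j m
    by (simp only: monom_exponent_add monom_exponent_single graph_exponent_def prod.case)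
  have swap: "b + z + d = a + z + c" if "a + c = b + d" for a b c d z :: "nat \<Rightarrow>\<^sub>0 int"
  proof -
    have "b + z + d = (b + d) + z" by (simp only: ac_simps)
    also have "\<dots> = a + z + c" unfolding that[symmetric] by (simp only: ac_simps)
    finally show ?thesis .
  qed
  have K1: "Poly_Mapping.keys (Poly_Mapping.single e 1 + m) \<subseteq> E'"
    if "e \<in> E'" "Poly_Mapping.keys m \<subseteq> E'" for e E' and m :: "nat \<times> nat \<Rightarrow>\<^sub>0 nat"
    using that keys_add[of "Poly_Mapping.single e 1" m] by auto
  show ?case
  proof (cases "C j0")
    case True
    then obtain m n where mn: "Poly_Mapping.keys m \<subseteq> E" "Poly_Mapping.keys n \<subseteq> E" "?T m = ?r i0 + ?c j0 + ?T n"
      unfolding C_def by blast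
    have "monom_eval x m = monom_eval x (Poly_Mapping.single e0 1 + n)"
    proof (rule insert.prems(2))
      show "Poly_Mapping.keys m \<subseteq> insert e0 E" "Poly_Mapping.keys (Poly_Mapping.single e0 1 + n) \<subseteq> insert e0 E"
        using mn K1[of e0 "insert e0 E" n] by auto
      show "?T m = ?T (Poly_Mapping.single e0 1 + n)"
        using mn(3) T1 by (simp add: e0)
    qed
    then have 1: "monom_eval x m = x e0 * monom_eval x n"
      by (simp add: monom_eval_add)
    have mono: "monom_eval x k = exp (weight w (?T k))" if "Poly_Mapping.keys k \<subseteq> E" for k
      using monom_eval_cong[of k x "\<lambda>e. exp (weight w (graph_exponent e))"] that w
        monom_eval_exp_weight[of w graph_exponent k] by auto
    have "?T m = graph_exponent e0 + ?T n"
      using mn(3) by (simp add: e0 graph_exponent_def)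
    then have "monom_eval x m = exp (weight w (graph_exponent e0)) * monom_eval x n"
      using mono mn by (simp add: weight_add exp_add)
    then have "x e0 = exp (weight w (graph_exponent e0))"
      using 1 mono[OF mn(2)] by simp
    then show ?thesis
      using w by blast
  next
    case False
    define \<delta> where "\<delta> = ln (x e0) - weight w (graph_exponent e0)"
    define w' where "w' n = (if even n then if R (n div 2) then w n + \<delta> else w n
      else if C (n div 2) then w n - \<delta> else w n)" for n
    have w'w: "weight w' (graph_exponent (i, j)) = weight w (graph_exponent (i, j))
      + (if R i then \<delta> else 0) - (if C j then \<delta> else 0)" for i j
      by (simp add: weight_graph_exponent w'_def)
    have "R i0"
      unfolding R_def by (intro exI[of _ 0]) simp
    then have "weight w' (graph_exponent e0) = ln (x e0)"
      using False by (simp add: e0 w'w) (simp add: \<delta>_def e0)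
    then have "x e0 = exp (weight w' (graph_exponent e0))"
      using insert.prems(1) by simp
    moreover have "x e = exp (weight w' (graph_exponent e))" if "e \<in> E" for e
    proof -
      obtain i j where e: "e = (i, j)"
        by (cases e)
      \<comment> \<open>An edge of \<open>E\<close> has both ends or neither in the component, so
        the shifts by \<open>\<delta>\<close> and \<open>- \<delta>\<close> cancel on it; only
        \<open>e0\<close> feels the shift.\<close>
      have "R i \<longleftrightarrow> C j"
      proof
        assume "R i"
        then obtain m n where *: "Poly_Mapping.keys m \<subseteq> E" "Poly_Mapping.keys n \<subseteq> E" "?r i0 + ?T m = ?r i + ?T n"
          unfolding R_def by blast
        then have "?T (Poly_Mapping.single (i, j) 1 + n) = ?r i0 + ?c j + ?T m"
          unfolding T1 using swap[OF *(3), of "?c j"] by simp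
        then show "C j"
          unfolding C_def using * K1 that e by blast
      next
        assume "C j"
        then obtain m n where *: "Poly_Mapping.keys m \<subseteq> E" "Poly_Mapping.keys n \<subseteq> E" "?T m = ?r i0 + ?c j + ?T n"
          unfolding C_def by blast
        then have "?r i0 + ?T (Poly_Mapping.single (i, j) 1 + n) = ?r i + ?T m"
          unfolding T1 using swap[of "?r i0 + ?c j" "?T n" "?T m" 0 "?r i"] by (simp add: ac_simps)
        then show "R i"
          unfolding R_def using * K1 that e by blast
      qed
      then have "weight w' (graph_exponent e) = weight w (graph_exponent e)"
        by (simp add: e w'w)
      then show ?thesis
        using w[OF that] by simp
    qed
    ultimately show ?thesis
      by blast
  qed
qed simp

lemma nonincidence_toric_ideal_eq:
  "nonincidence_toric_ideal v f pv pF = {p \<in> poly_ring (noninc v f pv pF). monomial_map graph_exponent p = 0}"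
  by (simp add: nonincidence_toric_ideal_def graph_exponent_def)

lemma nonincidence_toric_ideal_iff:
  "p \<in> nonincidence_toric_ideal v f pv pF \<longleftrightarrow> p \<in> poly_ring (noninc v f pv pF) \<and>
    (\<forall>w. poly_eval (\<lambda>e. of_real (exp (weight w (graph_exponent e)))) p = 0)"
  by (simp add: nonincidence_toric_ideal_eq monomial_map_zero_iff)

lemma finite_noninc: "finite (noninc v f pv pF)"
  by (rule finite_subset[of _ "{..<v} \<times> {..<f}"]) (auto simp: noninc_def)

text \<open>Only binomials of T_P are evaluated: the difference of two monomials with the same
  exponent lies in T_P, so the monomials agree at \<open>x\<close>, as
  \<open>graph_potential\<close> requires.\<close>

lemma nonincidence_toric_point:
  fixes x :: "nat \<times> nat \<Rightarrow> real"
  assumes pos: "\<And>e. e \<in> noninc v f pv pF \<Longrightarrow> 0 < x e"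
    and zero: "\<And>p. p \<in> nonincidence_toric_ideal v f pv pF \<Longrightarrow> poly_eval (\<lambda>e. of_real (x e)) p = 0"
  shows "\<exists>w. \<forall>e\<in>noninc v f pv pF. x e = exp (weight w (graph_exponent e))"
proof (rule graph_potential[OF finite_noninc pos])
  fix m n :: "nat \<times> nat \<Rightarrow>\<^sub>0 nat"
  assume mn: "Poly_Mapping.keys m \<subseteq> noninc v f pv pF" "Poly_Mapping.keys n \<subseteq> noninc v f pv pF"
    "monom_exponent graph_exponent m = monom_exponent graph_exponent n"
  let ?p = "Poly_Mapping.single m 1 + Poly_Mapping.single n (-1)"
  have "?p \<in> nonincidence_toric_ideal v f pv pF"
    unfolding nonincidence_toric_ideal_iff
    using mn by (auto intro!: poly_ring_add poly_ring_single
        simp: poly_eval_add monom_eval_of_real monom_eval_exp_weight)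
  then have "complex_of_real (monom_eval x m) = of_real (monom_eval x n)"
    using zero[of ?p] by (simp add: poly_eval_add monom_eval_of_real)
  then show "monom_eval x m = monom_eval x n"
    by simp
qed auto

section \<open>Realizations of the combinatorial type of a polytope\<close>

lemma affine_function_zero_hull:
  fixes a :: "'a::real_inner"
  assumes "\<And>y. y \<in> S \<Longrightarrow> a \<bullet> y + c = 0" and "z \<in> affine hull S"
  shows "a \<bullet> z + c = 0"
proof -
  have "affine hull S \<subseteq> {y. a \<bullet> y = - c}"
    using assms(1) by (intro hull_minimal affine_hyperplane) (auto simp: eq_neg_iff_add_eq_0)
  then show ?thesis
    using assms(2) by (auto simp: eq_neg_iff_add_eq_0)
qed

lemma affine_function_nonneg_hull:
  fixes a :: "'a::real_inner"
  assumes "\<And>y. y \<in> S \<Longrightarrow> 0 \<le> a \<bullet> y + c" and "z \<in> convex hull S"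
  shows "0 \<le> a \<bullet> z + c"
proof -
  have "convex hull S \<subseteq> {y. a \<bullet> y \<ge> - c}"
    using assms(1) by (intro hull_minimal convex_halfspace_ge) force
  then show ?thesis
    using assms(2) by force
qed

text \<open>Proper inclusion of faces raises the dimension, and no dimension lies strictly between
  those of \<open>H\<close> and \<open>G\<close>.\<close>

lemma facet_of_maximal:
  fixes G :: "'a::euclidean_space set"
  assumes "convex G" "H facet_of G" "K face_of G" "H \<subseteq> K" "K \<noteq> G"
  shows "K = H"
proof (rule ccontr)
  assume "K \<noteq> H"
  have "H face_of K"
    using assms facet_of_imp_face_of face_of_subset face_of_imp_subset by blast
  then have "aff_dim H < aff_dim K"
    using \<open>K \<noteq> H\<close> assms(3) face_of_aff_dim_lt face_of_imp_convex by metis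
  moreover have "aff_dim K < aff_dim G"
    using assms face_of_aff_dim_lt by metis
  ultimately show False
    using assms(2) by (auto simp: facet_of_def)
qed

section \<open>Faces, vertices and facets of a labelled polytope\<close>

locale labelled_polytope =
  fixes P :: "'b::euclidean_space set" and v f :: nat
    and p :: "nat \<Rightarrow> 'b" and F :: "nat \<Rightarrow> 'b set"
  assumes polytope: "polytope P"
    and vertices: "bij_betw p {..<v} {x. x extreme_point_of P}"
    and facets: "bij_betw F {..<f} {F. F facet_of P}"
begin

definition verts :: "'b set \<Rightarrow> nat set" where
  "verts G = {i. i < v \<and> p i \<in> G}"

lemma verts_subset: "verts G \<subseteq> {..<v}"
  by (auto simp: verts_def)

lemma finite_verts: "finite (verts G)"
  using verts_subset finite_subset by blast

lemma face_polytope: "G face_of P \<Longrightarrow> polytope G"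
  using face_of_polytope_polytope polytope by blast

lemma face_convex: "G face_of P \<Longrightarrow> convex G"
  by (rule face_of_imp_convex)

lemma polytope_face: "P face_of P"
  using polytope by (simp add: face_of_refl polytope_imp_convex)

lemma vertex_face: "i < v \<Longrightarrow> {p i} face_of P"
  using vertices by (auto simp: face_of_singleton bij_betw_def)

lemma facet_F: "j < f \<Longrightarrow> F j facet_of P"
  using facets by (auto simp: bij_betw_def)

lemma facet_F_face: "j < f \<Longrightarrow> F j face_of P"
  using facet_F facet_of_imp_face_of by blast

lemma facet_index: 
  assumes "K facet_of P" obtains j where "j < f" "K = F j"
  using assms facets by (auto simp: bij_betw_def)

lemma vertex_in: "i < v \<Longrightarrow> p i \<in> P"
  using vertex_face face_of_imp_subset by blast

lemma face_hull:
  assumes "G face_of P"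
  shows "G = convex hull (p ` verts G)"
proof -
  have "{x. x extreme_point_of P} = p ` {..<v}"
    using vertices by (simp add: bij_betw_def)
  then have "{x. x extreme_point_of G} = p ` verts G"
    using extreme_point_of_face[OF assms] by (auto simp: verts_def)
  then show ?thesis
    using Krein_Milman_Minkowski[of G] face_polytope[OF assms]
    by (simp add: polytope_imp_compact polytope_imp_convex)
qed

lemma face_subset:
  assumes "G face_of P" "H face_of P" "verts G \<subseteq> verts H"
  shows "G \<subseteq> H"
  using face_hull assms hull_mono image_mono by metis

lemma face_vertex:
  assumes "G face_of P" "G \<noteq> {}"
  obtains i where "i \<in> verts G"
  using face_hull[OF assms(1)] assms(2) by fastforce

lemma facet_vertex:
  assumes "G face_of P" "H face_of P" "\<not> G \<subseteq> H"
  obtains i where "i \<in> verts G" "p i \<notin> H"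
  using face_subset[OF assms(1,2)] assms(3) by (auto simp: verts_def)

text \<open>\<open>H\<close> is the intersection of the facets of \<open>P\<close> containing it.
  One of these does not contain \<open>G\<close>, and its intersection with \<open>G\<close> is a
  proper face of \<open>G\<close> above the facet \<open>H\<close>, hence equal to
  \<open>H\<close>.\<close>

lemma facet_of_face:
  assumes G: "G face_of P" and H: "H facet_of G"
  obtains j where "j < f" "H = G \<inter> F j"
proof -
  have HP: "H face_of P" and HG: "H face_of G" "H \<noteq> {}" "H \<noteq> G"
    using G H face_of_trans facet_of_imp_face_of by (auto simp: facet_of_def)
  have "H \<noteq> P"
    using G HG by (metis face_of_imp_subset subset_antisym)
  then have "H = \<Inter>{K. K facet_of P \<and> H \<subseteq> K}"
    using face_of_polyhedron polytope_imp_polyhedron polytope HP HG by blast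
  moreover have "\<not> G \<subseteq> H"
    using HG face_of_imp_subset by blast
  ultimately obtain K where K: "K facet_of P" "H \<subseteq> K" "\<not> G \<subseteq> K"
    by blast
  have "G \<inter> K face_of G"
    using G K by (metis face_of_Int face_of_subset face_of_imp_subset facet_of_imp_face_of inf_le1)
  then have "H = G \<inter> K"
    using facet_of_maximal[OF face_convex[OF G] H] K HG(1) face_of_imp_subset by blast
  then show thesis
    using that K(1) facet_index by metis
qed

text \<open>Among the faces properly containing \<open>G\<close> one of least dimension is taken; a
  facet of it that contains \<open>G\<close> cannot contain \<open>G\<close> properly.\<close>

lemma cofacet:
  assumes G: "G face_of P" "G \<noteq> {}" "G \<noteq> P"
  obtains G' where "G' face_of P" "G facet_of G'"
proof -
  define Q where "Q = (\<lambda>K. K face_of P \<and> G \<subseteq> K \<and> G \<noteq> K)"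
  have "Q P"
    using G face_of_imp_subset polytope_face by (auto simp: Q_def)
  \<comment> \<open>\<open>aff_dim\<close> is at least -1, so after adding 1 the conversion by
    \<open>nat\<close> loses nothing.\<close>
  then obtain K where K: "Q K" and min: "\<And>L. Q L \<Longrightarrow> nat (aff_dim K + 1) \<le> nat (aff_dim L + 1)"
    using ex_has_least_nat[of Q P "\<lambda>K. nat (aff_dim K + 1)"] by blast
  have KP: "K face_of P" and GK: "G face_of K"
    using K G(1) face_of_subset[OF G(1)] face_of_imp_subset[of K P] by (auto simp: Q_def)
  obtain H where H: "H facet_of K" "G \<subseteq> H"
    using face_of_polyhedron_subset_facet[of K G] GK G K face_polytope[OF KP] polytope_imp_polyhedron
    by (auto simp: Q_def)
  have "G = H"
  proof (rule ccontr)
    assume "G \<noteq> H"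
    then have "Q H"
      using H KP face_of_trans[OF facet_of_imp_face_of KP] by (auto simp: Q_def)
    then have "nat (aff_dim K + 1) \<le> nat (aff_dim H + 1)"
      using min by blast
    moreover have "aff_dim H = aff_dim K - 1" "aff_dim H \<ge> -1"
      using H aff_dim_geq[of H] by (simp_all add: facet_of_def)
    ultimately show False by linarith
  qed
  then show thesis using that KP H by blast
qed

text \<open>Meant for \<open>\<Phi>_ineq\<close>, where \<open>a\<close> and \<open>b\<close> give a
  direction that leaves through one facet and, reversed, through another. A facet missing some
  vertex \<open>b\<close> is paired with one containing \<open>b\<close>; distinct facets do not
  contain each other.\<close>

lemma two_facets:
  assumes G: "G face_of P" "0 < aff_dim G"
  obtains j k a b where "j < f" "k < f" "G \<inter> F j facet_of G" "G \<inter> F k facet_of G"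
    "a \<in> verts G" "b \<in> verts G" "p a \<in> F j" "p a \<notin> F k" "p b \<in> F k" "p b \<notin> F j"
proof -
  obtain H1 where H1: "H1 facet_of G"
    using polytope_facet_exists G face_polytope by blast
  obtain j where j: "j < f" "H1 = G \<inter> F j"
    using facet_of_face[OF G(1) H1] .
  have "\<not> G \<subseteq> F j"
    using H1 j by (metis facet_of_irrefl inf.absorb1)
  then obtain b where b: "b \<in> verts G" "p b \<notin> F j"
    using facet_vertex G facet_F_face j by metis
  have pb: "{p b} face_of G"
    using b G vertex_face by (simp add: verts_def face_of_face)
  have "{p b} \<noteq> G"
    using G by auto
  then obtain H2 where H2: "H2 facet_of G" "{p b} \<subseteq> H2"
    using face_of_polyhedron_subset_facet[of G "{p b}"] pb face_polytope[OF G(1)] polytope_imp_polyhedron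
    by (metis insert_not_empty)
  obtain k where k: "k < f" "H2 = G \<inter> F k"
    using facet_of_face[OF G(1) H2(1)] .
  have "\<not> H1 \<subseteq> H2"
  proof
    assume "H1 \<subseteq> H2"
    then have "H2 = H1"
      using facet_of_maximal[OF face_convex[OF G(1)] H1 facet_of_imp_face_of[OF H2(1)]] H2(1)
      by (metis facet_of_irrefl)
    then show False
      using H2 b j by auto
  qed
  moreover have "H1 face_of P" "H2 face_of P"
    using H1 H2 G face_of_trans facet_of_imp_face_of by blast+
  ultimately obtain a where a: "a \<in> verts H1" "p a \<notin> H2"
    using facet_vertex by metis
  show thesis
    by (rule that[of j k a b]) (use a b j k H1 H2 in \<open>auto simp: verts_def\<close>)
qed

text \<open>A vertex is the intersection of the facets containing it, so every other vertex is
  missed by one of those. This makes the row sums of a slack matrix positive.\<close>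

lemma vertex_off_facet:
  assumes "0 < aff_dim P" "i < v"
  obtains j where "j < f" "p i \<notin> F j"
proof -
  obtain j k a b where *: "j < f" "k < f" "a \<in> verts P" "b \<in> verts P" "p a \<in> F j" "p a \<notin> F k" "p b \<in> F k" "p b \<notin> F j"
    using two_facets[OF polytope_face assms(1)] by metis
  have face: "{p k} = \<Inter>{K. K facet_of P \<and> {p k} \<subseteq> K}" if "k < v" for k
  proof (rule face_of_polyhedron)
    show "{p k} \<noteq> P"
      using assms(1) by (metis aff_dim_sing less_irrefl)
  qed (use polytope polytope_imp_polyhedron vertex_face that in auto)
  have "a < v" "b < v" "p a \<noteq> p b"
    using * by (auto simp: verts_def)
  obtain c where c: "c < v" "p c \<noteq> p i"
    using \<open>a < v\<close> \<open>b < v\<close> \<open>p a \<noteq> p b\<close> by metis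
  then obtain K where "K facet_of P" "p i \<notin> K"
    using face[OF c(1)] by (metis (no_types, lifting) Inter_iff mem_Collect_eq singletonD)
  then show thesis
    using that facet_index by metis
qed

end

section \<open>Points and half-spaces with the incidences of \<open>P\<close>\<close>

text \<open>Only a sign pattern and the dimension of \<open>P\<close> are assumed: that the
  \<open>q i\<close> are vertices, that they span the space and that the inequalities cut out their
  hull all has to be derived.\<close>

locale realization = labelled_polytope P v f p F
  for P :: "'b::euclidean_space set" and v f p F +
  fixes q :: "nat \<Rightarrow> 'a::euclidean_space" and a :: "nat \<Rightarrow> 'a" and c :: "nat \<Rightarrow> real"
  assumes dim: "aff_dim P = int DIM('a)"
    and nonneg: "i < v \<Longrightarrow> j < f \<Longrightarrow> 0 \<le> a j \<bullet> q i + c j"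
    and zero_iff: "i < v \<Longrightarrow> j < f \<Longrightarrow> a j \<bullet> q i + c j = 0 \<longleftrightarrow> p i \<in> F j"
begin

definition g :: "nat \<Rightarrow> 'a \<Rightarrow> real" where
  "g j y = a j \<bullet> y + c j"

definition \<Phi> :: "'b set \<Rightarrow> 'a set" where
  "\<Phi> G = convex hull (q ` verts G)"

lemma g_nonneg: "i < v \<Longrightarrow> j < f \<Longrightarrow> 0 \<le> g j (q i)"
  by (simp add: g_def nonneg)

lemma g_zero_iff: "i < v \<Longrightarrow> j < f \<Longrightarrow> g j (q i) = 0 \<longleftrightarrow> p i \<in> F j"
  by (simp add: g_def zero_iff)

lemma g_pos: "i < v \<Longrightarrow> j < f \<Longrightarrow> p i \<notin> F j \<Longrightarrow> 0 < g j (q i)"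
  using g_nonneg g_zero_iff by (metis less_eq_real_def)

lemma dim_pos: "0 < aff_dim P"
  by (simp add: dim)

lemma q_in_\<Phi>: "i \<in> verts G \<Longrightarrow> q i \<in> \<Phi> G"
  by (simp add: \<Phi>_def hull_inc)

lemma q_in_\<Phi>_hull: "i \<in> verts G \<Longrightarrow> q i \<in> affine hull \<Phi> G"
  by (simp add: \<Phi>_def hull_inc)

lemma \<Phi>_mono: "G \<subseteq> H \<Longrightarrow> \<Phi> G \<subseteq> \<Phi> H"
  unfolding \<Phi>_def by (intro hull_mono image_mono) (auto simp: verts_def)

lemma g_nonneg_\<Phi>:
  assumes "y \<in> \<Phi> G" "j < f" shows "0 \<le> g j y"
  unfolding g_def
proof (rule affine_function_nonneg_hull)
  show "y \<in> convex hull (q ` verts G)"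
    using assms by (simp add: \<Phi>_def)
qed (use nonneg assms in \<open>auto simp: verts_def\<close>)

lemma g_zero_hull:
  assumes "j < f" "G \<subseteq> F j" "y \<in> affine hull \<Phi> G"
  shows "g j y = 0"
  unfolding g_def
proof (rule affine_function_zero_hull)
  show "y \<in> affine hull (q ` verts G)"
    using assms(3) by (simp add: \<Phi>_def)
qed (use zero_iff assms in \<open>auto simp: verts_def\<close>)

text \<open>The function of a facet cutting out \<open>H\<close> vanishes on the affine hull of
  \<open>\<Phi> H\<close>, but it is positive at \<open>q b\<close> for a vertex \<open>p b\<close>
  of \<open>G\<close> off that facet.\<close>

lemma \<Phi>_facet_dim:
  assumes G: "G face_of P" and H: "H facet_of G"
  shows "aff_dim (\<Phi> H) + 1 \<le> aff_dim (\<Phi> G)"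
proof -
  obtain j where j: "j < f" "H = G \<inter> F j"
    using facet_of_face[OF assms] .
  have "\<not> G \<subseteq> F j"
    using H j by (metis facet_of_irrefl inf.absorb1)
  then obtain b where b: "b \<in> verts G" "p b \<notin> F j"
    using facet_vertex G facet_F_face j by metis
  have "q b \<notin> affine hull \<Phi> H"
    using g_zero_hull[of j H "q b"] g_zero_iff[of b j] j b by (auto simp: verts_def)
  then have "aff_dim (insert (q b) (\<Phi> H)) = aff_dim (\<Phi> H) + 1"
    by (simp add: aff_dim_insert)
  moreover have "insert (q b) (\<Phi> H) \<subseteq> \<Phi> G"
    using q_in_\<Phi> b j \<Phi>_mono by blast
  ultimately show ?thesis
    using aff_dim_subset by metis
qed

text \<open>Induction upwards from single points: each passage from a facet to its face adds at
  least one dimension to the image.\<close>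

lemma \<Phi>_dim_ge: "G face_of P \<Longrightarrow> aff_dim G \<le> aff_dim (\<Phi> G)"
proof (induction "nat (aff_dim G + 1)" arbitrary: G)
  case 0
  then show ?case
    using aff_dim_geq[of G] aff_dim_geq[of "\<Phi> G"] by linarith
next
  case (Suc n)
  show ?case
  proof (cases "0 < aff_dim G")
    case True
    then obtain H where H: "H facet_of G"
      using polytope_facet_exists face_polytope Suc.prems by blast
    then have *: "aff_dim H = aff_dim G - 1" "H face_of P"
      using Suc.prems face_of_trans by (auto simp: facet_of_def)
    then have "aff_dim H \<le> aff_dim (\<Phi> H)"
      using Suc.hyps(1)[of H] Suc.hyps(2) by auto
    then show ?thesis
      using \<Phi>_facet_dim[OF Suc.prems H] * by linarith
  next
    case False
    have "G \<noteq> {}"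
      using Suc.hyps by auto
    then obtain i where "i \<in> verts G"
      using face_vertex[OF Suc.prems] by blast
    then have "\<Phi> G \<noteq> {}"
      using q_in_\<Phi> by auto
    then have "\<not> aff_dim (\<Phi> G) < 0"
      by simp
    then show ?thesis
      using False by linarith
  qed
qed

text \<open>Induction downwards from \<open>P\<close>, where the bound is the dimension of the
  ambient space: each passage to a facet lowers the dimension of the image by at least one.\<close>

lemma \<Phi>_dim_le: "G face_of P \<Longrightarrow> aff_dim (\<Phi> G) \<le> aff_dim G"
proof (induction "nat (int DIM('a) - aff_dim G)" arbitrary: G rule: less_induct)
  case less
  consider "G = {}" | "G = P" | "G \<noteq> {}" "G \<noteq> P" by blast
  then show ?case
  proof cases
    case 1
    then show ?thesis
      by (simp add: \<Phi>_def verts_def)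
  next
    case 2
    then show ?thesis
      using aff_dim_le_DIM dim by metis
  next
    case 3
    then obtain K where K: "K face_of P" "G facet_of K"
      using cofacet[OF less.prems] by metis
    then have *: "aff_dim G = aff_dim K - 1"
      by (simp add: facet_of_def)
    moreover have "aff_dim K \<le> int DIM('a)"
      using K dim aff_dim_subset face_of_imp_subset by metis
    ultimately have "aff_dim (\<Phi> K) \<le> aff_dim K"
      using less.hyps[of K] K by auto
    then show ?thesis
      using \<Phi>_facet_dim[OF K] * by linarith
  qed
qed

lemma \<Phi>_dim: "G face_of P \<Longrightarrow> aff_dim (\<Phi> G) = aff_dim G"
  using \<Phi>_dim_ge \<Phi>_dim_le by (simp add: antisym)

text \<open>By \<open>\<Phi>_dim\<close> the two affine hulls differ by one dimension, so a single
  point outside the smaller one spans the rest.\<close>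

lemma \<Phi>_facet_span:
  assumes G: "G face_of P" and H: "H facet_of G"
    and z: "z \<in> affine hull \<Phi> G" "z \<notin> affine hull \<Phi> H"
  shows "affine hull (insert z (\<Phi> H)) = affine hull \<Phi> G"
proof -
  have HP: "H face_of P"
    using G H face_of_trans facet_of_imp_face_of by blast
  have "aff_dim (insert z (\<Phi> H)) = aff_dim (affine hull \<Phi> G)"
    using z \<Phi>_dim[OF G] \<Phi>_dim[OF HP] H by (simp add: aff_dim_insert facet_of_def)
  moreover have "insert z (\<Phi> H) \<subseteq> affine hull \<Phi> G"
    using z \<Phi>_mono[OF facet_of_imp_subset[OF H]] hull_subset[of "\<Phi> G" affine] by auto
  ultimately have "affine hull (insert z (\<Phi> H)) = affine hull (affine hull \<Phi> G)"
    using aff_dim_eq_full_gen by blast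
  then show ?thesis
    by (simp add: hull_hull)
qed

text \<open>A further zero of \<open>g j\<close> would, together with the image of the facet, span
  the hull of \<open>\<Phi> G\<close>, and \<open>g j\<close> would vanish at the point of a vertex
  off \<open>F j\<close>.\<close>

lemma \<Phi>_facet_hull:
  assumes G: "G face_of P" and H: "G \<inter> F j facet_of G" and j: "j < f"
    and z: "z \<in> affine hull \<Phi> G" "g j z = 0"
  shows "z \<in> affine hull \<Phi> (G \<inter> F j)"
proof (rule ccontr)
  assume "z \<notin> affine hull \<Phi> (G \<inter> F j)"
  then have span: "affine hull (insert z (\<Phi> (G \<inter> F j))) = affine hull \<Phi> G"
    using \<Phi>_facet_span G H z by blast
  have "\<not> G \<subseteq> F j"
    using H by (metis facet_of_irrefl inf.absorb1)
  then obtain b where b: "b \<in> verts G" "p b \<notin> F j"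
    using facet_vertex G facet_F_face j by metis
  have "g j y = 0" if "y \<in> insert z (\<Phi> (G \<inter> F j))" for y
    using that z g_zero_hull[OF j, of "G \<inter> F j" y] by (auto intro: hull_inc)
  then have "g j (q b) = 0"
    using affine_function_zero_hull[of "insert z (\<Phi> (G \<inter> F j))" "a j" "c j" "q b"] span
      q_in_\<Phi>_hull[OF b(1)] by (simp add: g_def)
  then show False
    using b j g_zero_iff by (auto simp: verts_def)
qed

text \<open>A facet \<open>K = G \<inter> F j \<inter> F k\<close> of the facet \<open>G \<inter> F j\<close> lies in a second facet \<open>G \<inter> F l\<close> of \<open>G\<close>,
  and on the affine hull of the image of \<open>G \<inter> F j\<close> the functions \<open>g k\<close> and \<open>g l\<close> are positive
  multiples of each other.\<close>
lemma ridge_nonneg: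
  assumes G: "G face_of P" and H: "G \<inter> F j facet_of G" and jk: "j < f" "k < f"
    and K: "G \<inter> F j \<inter> F k facet_of (G \<inter> F j)"
    and z: "z \<in> affine hull \<Phi> (G \<inter> F j)"
    and nn: "\<And>l. l < f \<Longrightarrow> G \<inter> F l facet_of G \<Longrightarrow> 0 \<le> g l z"
  shows "0 \<le> g k z"
proof -
  let ?H = "G \<inter> F j" and ?K = "G \<inter> F j \<inter> F k"
  have HG: "?H face_of G" and KH: "?K face_of ?H"
    using H K facet_of_imp_face_of by blast+
  have HP: "?H face_of P" and KG: "?K face_of G"
    using HG KH G face_of_trans by blast+
  have ne: "?K \<noteq> {}" "?K \<noteq> ?H" "?H \<noteq> G"
    using H K by (auto simp: facet_of_def)
  have "?K = \<Inter>{L. L facet_of G \<and> ?K \<subseteq> L}"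
    using face_of_polyhedron[OF polytope_imp_polyhedron[OF face_polytope[OF G]] KG] ne by blast
  then obtain L where L: "L facet_of G" "?K \<subseteq> L" "L \<noteq> ?H"
    using ne H by blast
  obtain l where l: "l < f" "L = G \<inter> F l"
    using facet_of_face[OF G L(1)] .
  have "?H \<inter> L \<noteq> ?H"
  proof
    assume "?H \<inter> L = ?H"
    then have "L = ?H"
      using facet_of_maximal[OF face_convex[OF G] H facet_of_imp_face_of[OF L(1)]] L
      by (metis facet_of_irrefl inf.absorb_iff1)
    then show False
      using L by blast
  qed
  moreover have "?H \<inter> L face_of ?H"
    using HG L(1) face_of_Int face_of_subset face_of_imp_subset facet_of_imp_face_of inf_le1 by metis
  ultimately have KL: "?H \<inter> L = ?K"
    using facet_of_maximal[OF face_convex[OF HP] K, of "?H \<inter> L"] L by blast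
  have "\<not> ?H \<subseteq> F k"
    using ne by blast
  then obtain b where b: "b \<in> verts ?H" "p b \<notin> F k"
    using facet_vertex HP facet_F_face jk by metis
  then have bl: "b < v" "p b \<notin> F l"
    using KL l by (auto simp: verts_def)
  have pos: "0 < g k (q b)" "0 < g l (q b)"
    using g_pos b bl jk l by auto
  have "q b \<notin> affine hull \<Phi> ?K"
    using g_zero_hull[of k ?K "q b"] jk pos by auto
  then have span: "affine hull (insert (q b) (\<Phi> ?K)) = affine hull \<Phi> ?H"
    using \<Phi>_facet_span[OF HP K] q_in_\<Phi>_hull[OF b(1)] by blast
  \<comment> \<open>This combination of \<open>g l\<close> and \<open>g k\<close> vanishes at
    \<open>q b\<close> and on the image of \<open>?K\<close>, which together span the hull of the
    image of \<open>?H\<close>.\<close>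
  let ?a = "g k (q b) *\<^sub>R a l - g l (q b) *\<^sub>R a k" and ?c = "g k (q b) * c l - g l (q b) * c k"
  have eq: "?a \<bullet> y + ?c = g k (q b) * g l y - g l (q b) * g k y" for y
    by (simp add: g_def algebra_simps inner_diff_left)
  have "?a \<bullet> z + ?c = 0"
  proof (rule affine_function_zero_hull)
    show "z \<in> affine hull (insert (q b) (\<Phi> ?K))"
      using span z by simp
    fix y assume "y \<in> insert (q b) (\<Phi> ?K)"
    moreover have "g k y = 0 \<and> g l y = 0" if "y \<in> \<Phi> ?K"
      using that g_zero_hull[of k ?K y] g_zero_hull[of l ?K y] jk l KL by (auto intro: hull_inc)
    ultimately show "?a \<bullet> y + ?c = 0"
      unfolding eq by auto
  qed
  then have "g k (q b) * g l z = g l (q b) * g k z"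
    unfolding eq by simp
  moreover have "0 \<le> g k (q b) * g l z"
    using nn l L pos by simp
  ultimately show ?thesis
    using pos by (simp add: zero_le_mult_iff)
qed

text \<open>Induction on the dimension. A line through \<open>y\<close> runs, in both directions,
  into the image of a facet of \<open>G\<close>, where the induction hypothesis applies to the
  inequalities supplied by \<open>ridge_nonneg\<close>; then \<open>y\<close> lies between two
  points of \<open>\<Phi> G\<close>.\<close>

lemma \<Phi>_ineq:
  "G face_of P \<Longrightarrow> G \<noteq> {} \<Longrightarrow> y \<in> affine hull \<Phi> G \<Longrightarrow>
    (\<And>j. j < f \<Longrightarrow> G \<inter> F j facet_of G \<Longrightarrow> 0 \<le> g j y) \<Longrightarrow> y \<in> \<Phi> G"
proof (induction "nat (aff_dim G)" arbitrary: G y rule: less_induct)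
  case less
  note G = less.prems(1) and nn = less.prems(4)
  show ?case
  proof (cases "aff_dim G = 0")
    case True
    then show ?thesis
      using \<Phi>_dim[OF G] less.prems(3) by (metis aff_dim_eq_0 affine_hull_sing)
  next
    case False
    then have pos: "0 < aff_dim G"
      using less.prems(2) by (metis aff_dim_negative_iff not_less_iff_gr_or_eq)
    obtain j k b1 b2 where jk: "j < f" "k < f" "G \<inter> F j facet_of G" "G \<inter> F k facet_of G"
      and b: "b1 \<in> verts G" "b2 \<in> verts G" "p b1 \<in> F j" "p b1 \<notin> F k" "p b2 \<in> F k" "p b2 \<notin> F j"
      using two_facets[OF G pos] by metis
    have exit: "\<exists>t\<ge>0. y + t *\<^sub>R w \<in> \<Phi> G"
      if w: "\<And>t. y + t *\<^sub>R w \<in> affine hull \<Phi> G"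
        and neg: "j0 < f" "G \<inter> F j0 facet_of G" "a j0 \<bullet> w < 0" for w j0
    proof -
      define J where "J = {j. j < f \<and> G \<inter> F j facet_of G \<and> a j \<bullet> w < 0}"
      \<comment> \<open>Ratio test: \<open>r j\<close> is the step at which inequality
        \<open>j\<close> becomes tight. The least of these steps respects all inequalities and
        attains equality for some \<open>m\<close>.\<close>
      define r where "r j = g j y / - (a j \<bullet> w)" for j
      define t where "t = Min (r ` J)"
      have J: "finite J" "J \<noteq> {}"
        using neg by (auto simp: J_def)
      then have "t \<in> r ` J"
        unfolding t_def by (intro Min_in) auto
      then obtain m where m: "m \<in> J" "t = r m" by blast
      then have m': "m < f" "G \<inter> F m facet_of G" "a m \<bullet> w < 0"
        by (auto simp: J_def)
      have "t \<ge> 0"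
        using nn[OF m'(1,2)] m m' by (simp add: r_def divide_nonneg_neg)
      have gt: "g i (y + t *\<^sub>R w) = g i y + t * (a i \<bullet> w)" for i
        by (simp add: g_def inner_add_right)
      have gm: "g m (y + t *\<^sub>R w) = 0"
        unfolding gt using m m' by (simp add: r_def)
      have nn': "0 \<le> g i (y + t *\<^sub>R w)" if i: "i < f" "G \<inter> F i facet_of G" for i
      proof (cases "a i \<bullet> w < 0")
        case True
        then have "i \<in> J"
          using i by (simp add: J_def)
        then have "t \<le> r i"
          unfolding t_def using J by simp
        then show ?thesis
          using True unfolding gt r_def by (simp add: field_simps)
      next
        case False
        then show ?thesis
          using nn[OF i] \<open>t \<ge> 0\<close> unfolding gt by simp
      qed
      have hull: "y + t *\<^sub>R w \<in> affine hull \<Phi> (G \<inter> F m)"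
        using \<Phi>_facet_hull[OF G m'(2,1) w gm] .
      have "y + t *\<^sub>R w \<in> \<Phi> (G \<inter> F m)"
      proof (rule less.hyps)
        show "nat (aff_dim (G \<inter> F m)) < nat (aff_dim G)"
          using m'(2) pos by (auto simp: facet_of_def)
        show "G \<inter> F m face_of P" "G \<inter> F m \<noteq> {}"
          using m'(2) face_of_trans[OF facet_of_imp_face_of G] by (simp_all add: facet_of_def)
        show "0 \<le> g i (y + t *\<^sub>R w)" if "i < f" "G \<inter> F m \<inter> F i facet_of G \<inter> F m" for i
          by (rule ridge_nonneg[OF G m'(2,1) that hull nn'])
      qed (rule hull)
      moreover have "\<Phi> (G \<inter> F m) \<subseteq> \<Phi> G"
        by (rule \<Phi>_mono) simp
      ultimately show ?thesis
        using \<open>t \<ge> 0\<close> by blast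
    qed
    \<comment> \<open>Along \<open>w\<close> the function \<open>g j\<close> decreases, along
      \<open>- w\<close> the function \<open>g k\<close>, so the line leaves on both sides.\<close>
    define w where "w = q b1 - q b2"
    have w: "y + t *\<^sub>R w \<in> affine hull \<Phi> G" "y + t *\<^sub>R (- w) \<in> affine hull \<Phi> G" for t
    proof -
      have *: "y + t *\<^sub>R (x - z) \<in> affine hull \<Phi> G" if "x \<in> \<Phi> G" "z \<in> \<Phi> G" for x z
        using mem_affine_3_minus[OF affine_affine_hull less.prems(3)] that by (auto intro: hull_inc)
      show "y + t *\<^sub>R w \<in> affine hull \<Phi> G" "y + t *\<^sub>R (- w) \<in> affine hull \<Phi> G"
        using *[OF q_in_\<Phi>[OF b(1)] q_in_\<Phi>[OF b(2)]] *[OF q_in_\<Phi>[OF b(2)] q_in_\<Phi>[OF b(1)]]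
        by (simp_all add: w_def)
    qed
    have "a j \<bullet> w = g j (q b1) - g j (q b2)" "a k \<bullet> w = g k (q b1) - g k (q b2)"
      by (simp_all add: w_def g_def inner_diff_right)
    moreover have "b1 < v" "b2 < v"
      using b by (auto simp: verts_def)
    then have "g j (q b1) = 0" "0 < g j (q b2)" "0 < g k (q b1)" "g k (q b2) = 0"
      using b jk g_zero_iff g_pos by blast+
    ultimately have neg: "a j \<bullet> w < 0" "a k \<bullet> (- w) < 0"
      by auto
    obtain s where s: "s \<ge> 0" "y + s *\<^sub>R w \<in> \<Phi> G"
      using exit[OF w(1) jk(1,3) neg(1)] by blast
    obtain t where t: "t \<ge> 0" "y + t *\<^sub>R (- w) \<in> \<Phi> G"
      using exit[OF w(2) jk(2,4) neg(2)] by blast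
    note st = s t
    show ?thesis
    proof (cases "s + t = 0")
      case True
      then have "s = 0"
        using s(1) t(1) by linarith
      then show ?thesis
        using s by simp
    next
      case False
      then have pos: "s + t > 0"
        using s(1) t(1) by linarith
      \<comment> \<open>The weight at which the displacements \<open>s\<close> and
        \<open>- t\<close> along \<open>w\<close> cancel.\<close>
      define r where "r = s / (s + t)"
      have r: "0 \<le> r" "0 \<le> 1 - r" "(1 - r) * s = r * t"
        using pos s(1) t(1) by (simp_all add: r_def field_simps)
      have "(1 - r) *\<^sub>R (y + s *\<^sub>R w) + r *\<^sub>R (y + t *\<^sub>R (- w)) \<in> \<Phi> G"
        by (rule convexD[OF _ s(2) t(2) r(2,1)]) (simp_all add: \<Phi>_def)
      moreover have "(1 - r) *\<^sub>R (y + s *\<^sub>R w) + r *\<^sub>R (y + t *\<^sub>R (- w))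
          = y + ((1 - r) * s - r * t) *\<^sub>R w"
        by (simp add: algebra_simps)
      ultimately show ?thesis
        using r(3) by simp
    qed
  qed
qed

lemma \<Phi>_P_eq: "\<Phi> P = {y. \<forall>j<f. 0 \<le> g j y}"
proof
  show "\<Phi> P \<subseteq> {y. \<forall>j<f. 0 \<le> g j y}"
    using g_nonneg_\<Phi> by blast
  have "P \<noteq> {}"
    using dim_pos by auto
  moreover have "affine hull \<Phi> P = UNIV"
    using \<Phi>_dim[OF polytope_face] dim by (simp add: aff_dim_eq_full)
  ultimately show "{y. \<forall>j<f. 0 \<le> g j y} \<subseteq> \<Phi> P"
    using \<Phi>_ineq[OF polytope_face] by blast
qed

end

lemma bounded_ray_zero:
  fixes x w :: "'a::real_normed_vector"
  assumes "bounded S" "\<And>s. 0 \<le> s \<Longrightarrow> x + s *\<^sub>R w \<in> S"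
  shows "w = 0"
proof (rule ccontr)
  assume "w \<noteq> 0"
  obtain B where B: "\<And>y. y \<in> S \<Longrightarrow> norm y \<le> B"
    using assms(1) by (auto simp: bounded_iff)
  define s where "s = (\<bar>B\<bar> + norm x + 1) / norm w"
  have "s \<ge> 0"
    by (simp add: s_def)
  have "norm (s *\<^sub>R w) = \<bar>B\<bar> + norm x + 1"
    using \<open>w \<noteq> 0\<close> by (simp add: s_def)
  moreover have "norm (s *\<^sub>R w) \<le> norm (x + s *\<^sub>R w) + norm x"
    using norm_triangle_ineq4[of "x + s *\<^sub>R w" x] by simp
  moreover have "norm (x + s *\<^sub>R w) \<le> B"
    using B assms(2) \<open>s \<ge> 0\<close> by blast
  ultimately show False by linarith
qed

section \<open>The face lattice of a realization\<close>

context labelled_polytope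
begin

lemma face_mem:
  assumes "H face_of P" "H \<noteq> {}" "x \<in> P" "\<And>j. j < f \<Longrightarrow> H \<subseteq> F j \<Longrightarrow> x \<in> F j"
  shows "x \<in> H"
proof (cases "H = P")
  case False
  then have "H = \<Inter>{K. K facet_of P \<and> H \<subseteq> K}"
    using face_of_polyhedron[OF polytope_imp_polyhedron[OF polytope]] assms by blast
  moreover have "x \<in> K" if "K facet_of P" "H \<subseteq> K" for K
    using facet_index[OF that(1)] assms(4) that(2) by metis
  ultimately show ?thesis by blast
qed (use assms in auto)

lemma verts_singleton: "i < v \<Longrightarrow> verts {p i} = {i}"
  using vertices by (auto simp: verts_def bij_betw_def inj_on_def)

lemma verts_P: "verts P = {..<v}"
  using vertex_in by (auto simp: verts_def)

end

context realization
begin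

lemma g_zero_iff_\<Phi>: "g j y = 0 \<longleftrightarrow> a j \<bullet> y = - c j"
  by (auto simp: g_def)

lemma convex_\<Phi>: "convex (\<Phi> G)"
  by (simp add: \<Phi>_def)

lemma polytope_\<Phi>: "polytope (\<Phi> G)"
  using finite_verts by (simp add: \<Phi>_def polytope_convex_hull)

lemma section_face:
  assumes "J \<subseteq> {..<f}"
  shows "{y \<in> \<Phi> P. \<forall>j\<in>J. g j y = 0} face_of \<Phi> P"
proof -
  have "\<Phi> P \<inter> {y. a j \<bullet> y = - c j} face_of \<Phi> P" if "j \<in> J" for j
  proof (rule face_of_Int_supporting_hyperplane_ge[OF convex_\<Phi>])
    show "a j \<bullet> x \<ge> - c j" if "x \<in> \<Phi> P" for x
      using g_nonneg_\<Phi>[OF that, of j] assms \<open>j \<in> J\<close> by (auto simp: g_def)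
  qed
  then have "\<Inter>(insert (\<Phi> P) ((\<lambda>j. \<Phi> P \<inter> {y. a j \<bullet> y = - c j}) ` J)) face_of \<Phi> P"
    using convex_\<Phi> by (intro face_of_Inter) (auto simp: face_of_refl)
  moreover have "\<Inter>(insert (\<Phi> P) ((\<lambda>j. \<Phi> P \<inter> {y. a j \<bullet> y = - c j}) ` J))
      = {y \<in> \<Phi> P. \<forall>j\<in>J. g j y = 0}"
    by (auto simp: g_zero_iff_\<Phi>)
  ultimately show ?thesis by simp
qed

text \<open>A face of a convex hull is the hull of some of the generating points, and the generator
  \<open>q i\<close> lies on the section exactly if \<open>p i\<close> lies in all the facets
  indexed by \<open>J\<close>.\<close>

lemma section_eq:
  assumes "J \<subseteq> {..<f}"
  shows "{y \<in> \<Phi> P. \<forall>j\<in>J. g j y = 0} = \<Phi> (P \<inter> \<Inter>(F ` J))" (is "?T = _")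
proof
  have compact: "compact (q ` verts P)"
    by (intro finite_imp_compact finite_imageI finite_verts)
  have T: "?T face_of convex hull (q ` verts P)"
    using section_face[OF assms] by (simp add: \<Phi>_def)
  obtain S' where S': "S' \<subseteq> q ` verts P" "?T = convex hull S'"
    using face_of_convex_hull_subset[OF compact T] .
  have "S' \<subseteq> q ` verts (P \<inter> \<Inter>(F ` J))"
  proof
    fix y assume "y \<in> S'"
    then obtain i where i: "i \<in> verts P" "y = q i"
      using S' by blast
    have "y \<in> ?T"
      unfolding S'(2) using \<open>y \<in> S'\<close> by (simp add: hull_inc)
    then have "p i \<in> F j" if "j \<in> J" for j
      using g_zero_iff[of i j] i assms that by (auto simp: verts_def)
    then show "y \<in> q ` verts (P \<inter> \<Inter>(F ` J))"
      using i by (auto simp: verts_def)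
  qed
  then have "convex hull S' \<subseteq> \<Phi> (P \<inter> \<Inter>(F ` J))"
    unfolding \<Phi>_def by (rule hull_mono)
  then show "?T \<subseteq> \<Phi> (P \<inter> \<Inter>(F ` J))"
    by (simp only: S'(2))
  show "\<Phi> (P \<inter> \<Inter>(F ` J)) \<subseteq> ?T"
  proof
    fix y assume y: "y \<in> \<Phi> (P \<inter> \<Inter>(F ` J))"
    then have "y \<in> \<Phi> P"
      using \<Phi>_mono[of "P \<inter> \<Inter>(F ` J)" P] by blast
    moreover have "g j y = 0" if "j \<in> J" for j
    proof (rule g_zero_hull)
      show "j < f" "P \<inter> \<Inter>(F ` J) \<subseteq> F j"
        using that assms by auto
      show "y \<in> affine hull \<Phi> (P \<inter> \<Inter>(F ` J))"
        using y by (rule hull_inc)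
    qed
    ultimately show "y \<in> ?T" by blast
  qed
qed

lemma section_facet: "j < f \<Longrightarrow> {y \<in> \<Phi> P. g j y = 0} = \<Phi> (F j)"
  using section_eq[of "{j}"] face_of_imp_subset[OF facet_F_face[of j]] by (simp add: Int_absorb1)

lemma \<Phi>_face:
  assumes "G face_of P"
  shows "\<Phi> G face_of \<Phi> P"
proof (cases "G = {}")
  case True
  then show ?thesis
    by (simp add: \<Phi>_def verts_def)
next
  case False
  define J where "J = {j. j < f \<and> G \<subseteq> F j}"
  have "P \<inter> \<Inter>(F ` J) \<subseteq> G"
    using face_mem[OF assms False] by (auto simp: J_def)
  then have "G = P \<inter> \<Inter>(F ` J)"
    using face_of_imp_subset[OF assms] by (auto simp: J_def)
  then show ?thesis
    using section_face[of J] section_eq[of J] by (auto simp: J_def)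
qed

lemma \<Phi>_reflects:
  assumes "G face_of P" "H face_of P" "\<Phi> G \<subseteq> \<Phi> H"
  shows "G \<subseteq> H"
proof (rule face_subset[OF assms(1,2)], rule subsetI)
  fix i assume i: "i \<in> verts G"
  then have qi: "q i \<in> \<Phi> H"
    using assms(3) q_in_\<Phi> by blast
  then have "H \<noteq> {}"
    by (auto simp: \<Phi>_def verts_def)
  moreover have "p i \<in> P" "i < v"
    using i vertex_in by (auto simp: verts_def)
  moreover have "p i \<in> F j" if "j < f" "H \<subseteq> F j" for j
    using g_zero_hull[OF that, of "q i"] qi \<open>i < v\<close> g_zero_iff that by (simp add: hull_inc)
  ultimately show "i \<in> verts H"
    using face_mem[OF assms(2)] by (simp add: verts_def)
qed

text \<open>\<open>T\<close> is compared with the section \<open>?H\<close> given by the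
  inequalities tight at a relative interior point \<open>z\<close> of \<open>T\<close>. A face
  meeting the relative interior of \<open>T\<close> contains \<open>T\<close>; conversely a segment
  from \<open>y\<close> in \<open>?H\<close> to \<open>z\<close> can be prolonged beyond
  \<open>z\<close> inside the polytope, which puts \<open>y\<close> into the face
  \<open>T\<close>.\<close>

lemma \<Phi>_onto:
  assumes T: "T face_of \<Phi> P"
  obtains G where "G face_of P" "T = \<Phi> G"
proof (cases "T = {}")
  case True
  then show thesis
    using that[of "{}"] by (simp add: \<Phi>_def verts_def)
next
  case False
  then obtain z where z: "z \<in> rel_interior T"
    using rel_interior_eq_empty face_of_imp_convex[OF T] by blast
  then have zT: "z \<in> T" "z \<in> \<Phi> P"
    using rel_interior_subset face_of_imp_subset[OF T] by blast+
  define J where "J = {j. j < f \<and> g j z = 0}"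
  have J: "J \<subseteq> {..<f}"
    by (auto simp: J_def)
  let ?H = "{y \<in> \<Phi> P. \<forall>j\<in>J. g j y = 0}"
  have "T \<subseteq> ?H"
  proof (rule subset_of_face_of[OF section_face[OF J]])
    show "?H \<inter> rel_interior T \<noteq> {}"
      using z zT by (auto simp: J_def)
  qed (rule face_of_imp_subset[OF T])
  moreover have "?H \<subseteq> T"
  proof
    fix y assume y: "y \<in> ?H"
    \<comment> \<open>The element 1 keeps the set nonempty, and the denominators are positive even
      where \<open>g j y = 0\<close>. What matters is that \<open>e * g j y\<close> stays at most
      \<open>g j z\<close>.\<close>
    define e where "e = Min (insert 1 ((\<lambda>j. g j z / (1 + g j y)) ` ({..<f} - J)))"
    have gy: "0 \<le> g j y" "0 \<le> g j z" if "j < f" for j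
      using g_nonneg_\<Phi>[OF _ that] y zT by blast+
    have gz: "0 < g j z" if "j < f" "j \<notin> J" for j
      using that gy(2)[of j] by (simp add: J_def)
    have "e > 0"
      unfolding e_def using gy gz by (auto intro!: divide_pos_pos add_pos_nonneg)
    have e: "e * g j y \<le> g j z" if "j < f" "j \<notin> J" for j
    proof -
      have "e \<le> g j z / (1 + g j y)"
        unfolding e_def using that by (intro Min_le) auto
      then have "e * (1 + g j y) \<le> g j z"
        using gy(1)[OF that(1)] by (simp add: pos_le_divide_eq)
      then show ?thesis
        using \<open>e > 0\<close> by (simp add: algebra_simps)
    qed
    define u where "u = z + e *\<^sub>R (z - y)"
    have gu: "g j u = g j z + e * g j z - e * g j y" for j
      by (simp add: u_def g_def inner_add_right inner_diff_right algebra_simps)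
    have "0 \<le> g j u" if "j < f" for j
    proof (cases "j \<in> J")
      case True
      then show ?thesis
        using y by (simp add: gu J_def)
    next
      case False
      then show ?thesis
        using e[OF that False] gy(2)[OF that] \<open>e > 0\<close> unfolding gu by (simp add: add_increasing2)
    qed
    then have u: "u \<in> \<Phi> P"
      by (simp add: \<Phi>_P_eq)
    show "y \<in> T"
    proof (cases "y = z")
      case False
      have "z = (1 - 1 / (1 + e)) *\<^sub>R y + (1 / (1 + e)) *\<^sub>R u"
      proof -
        define r where "r = 1 / (1 + e)"
        have r: "r * (1 + e) = 1"
          using \<open>e > 0\<close> by (simp add: r_def)
        have "(1 - r) *\<^sub>R y + r *\<^sub>R u = (1 - r * (1 + e)) *\<^sub>R y + (r * (1 + e)) *\<^sub>R z"
          by (simp add: u_def algebra_simps)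
        then show ?thesis
          using r by (simp add: r_def)
      qed
      moreover have "0 < 1 / (1 + e)" "1 / (1 + e) < 1"
        using \<open>e > 0\<close> by simp_all
      moreover have "y \<noteq> u"
      proof
        assume "y = u"
        then have "(1 + e) *\<^sub>R (y - z) = 0"
          by (simp add: u_def algebra_simps)
        then show False
          using \<open>e > 0\<close> False by simp
      qed
      ultimately have "z \<in> open_segment y u"
        unfolding in_segment by blast
      then show ?thesis
        using face_ofD[OF T _ _ u zT(1)] y by blast
    qed (use zT in simp)
  qed
  ultimately have "T = \<Phi> (P \<inter> \<Inter>(F ` J))"
    using section_eq[OF J] by blast
  moreover have "P \<inter> \<Inter>(F ` J) face_of P"
  proof -
    have "\<Inter>(insert P (F ` J)) face_of P"
      using J facet_F_face polytope_face by (intro face_of_Inter) auto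
    then show ?thesis by simp
  qed
  ultimately show thesis
    using that by blast
qed

lemma \<Phi>_bij: "bij_betw \<Phi> {G. G face_of P} {T. T face_of \<Phi> P}"
proof -
  have "inj_on \<Phi> {G. G face_of P}"
    by (rule inj_onI) (metis \<Phi>_reflects mem_Collect_eq order_refl subset_antisym)
  moreover have "\<Phi> ` {G. G face_of P} = {T. T face_of \<Phi> P}"
    using \<Phi>_face \<Phi>_onto by (auto simp: image_iff) metis
  ultimately show ?thesis
    by (simp add: bij_betw_def)
qed

lemma \<Phi>_subset_iff: "G face_of P \<Longrightarrow> H face_of P \<Longrightarrow> G \<subseteq> H \<longleftrightarrow> \<Phi> G \<subseteq> \<Phi> H"
  using \<Phi>_mono[of G H] \<Phi>_reflects[of G H] by blast

lemma extreme_\<Phi>: "x extreme_point_of \<Phi> P \<longleftrightarrow> x \<in> q ` {..<v}"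
proof
  assume "x extreme_point_of \<Phi> P"
  then show "x \<in> q ` {..<v}"
    unfolding \<Phi>_def verts_P by (rule extreme_point_of_convex_hull)
next
  assume "x \<in> q ` {..<v}"
  then obtain i where "i < v" "x = q i" by blast
  then have "\<Phi> {p i} = {x}"
    by (simp add: \<Phi>_def verts_singleton)
  then show "x extreme_point_of \<Phi> P"
    using \<Phi>_face[OF vertex_face[OF \<open>i < v\<close>]] face_of_singleton by metis
qed

lemma facet_\<Phi>: "T facet_of \<Phi> P \<longleftrightarrow> (\<exists>j<f. T = \<Phi> (F j))"
proof
  assume T: "T facet_of \<Phi> P"
  obtain G where G: "G face_of P" "T = \<Phi> G"
    using \<Phi>_onto[OF facet_of_imp_face_of[OF T]] .
  have "aff_dim G = aff_dim P - 1"
    using T \<Phi>_dim[OF G(1)] \<Phi>_dim[OF polytope_face] G by (simp add: facet_of_def)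
  moreover have "G \<noteq> {}"
    using T G by (auto simp: facet_of_def \<Phi>_def verts_def)
  ultimately have "G facet_of P"
    using G by (simp add: facet_of_def)
  then show "\<exists>j<f. T = \<Phi> (F j)"
    using facet_index G by metis
next
  assume "\<exists>j<f. T = \<Phi> (F j)"
  then obtain j where j: "j < f" "T = \<Phi> (F j)" by blast
  have "F j \<noteq> {}"
    using facet_F[OF j(1)] by (simp add: facet_of_def)
  then obtain i where "i \<in> verts (F j)"
    using face_vertex[OF facet_F_face[OF j(1)]] by blast
  then have "\<Phi> (F j) \<noteq> {}"
    using q_in_\<Phi> by auto
  then show "T facet_of \<Phi> P"
    using \<Phi>_face[OF facet_F_face[OF j(1)]] \<Phi>_dim[OF facet_F_face[OF j(1)]] \<Phi>_dim[OF polytope_face]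
      facet_F[OF j(1)] j by (simp add: facet_of_def)
qed

text \<open>For \<open>t = 0\<close> a nonzero \<open>w\<close> would be a direction in which the
  polytope is unbounded. For \<open>t \<noteq> 0\<close> all facet hyperplanes would meet in the
  point \<open>w /\<^sub>R t\<close>, the polytope would contain the rays pointing away from it, and
  boundedness would collapse the polytope to this point.\<close>

lemma coefficients_independent:
  assumes zero: "\<And>j. j < f \<Longrightarrow> a j \<bullet> w + t * c j = 0"
  shows "w = 0" "t = 0"
proof -
  have bdd: "bounded (\<Phi> P)"
    using polytope_\<Phi> polytope_imp_bounded by blast
  have ray: "u = 0" if "i < v" "\<And>j. j < f \<Longrightarrow> 0 \<le> a j \<bullet> u" for i u
  proof (rule bounded_ray_zero[OF bdd])
    show "q i + s *\<^sub>R u \<in> \<Phi> P" if "0 \<le> s" for s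
    proof -
      have "0 \<le> g j (q i) + s * (a j \<bullet> u)" if "j < f" for j
        using \<open>i < v\<close> \<open>\<And>j. j < f \<Longrightarrow> 0 \<le> a j \<bullet> u\<close> g_nonneg \<open>0 \<le> s\<close> that by simp
      then show ?thesis
        unfolding \<Phi>_P_eq by (simp add: g_def inner_add_right algebra_simps)
    qed
  qed
  have "P \<noteq> {}"
    using dim_pos by auto
  then obtain i where i: "i < v"
    using face_vertex[OF polytope_face] by (metis verts_P lessThan_iff)
  show "t = 0"
  proof (rule ccontr)
    assume t: "t \<noteq> 0"
    have gz: "a j \<bullet> (w /\<^sub>R t) + c j = 0" if "j < f" for j
      using zero[OF that] t by (simp add: field_simps)
    have "q i - w /\<^sub>R t = 0" if "i < v" for i
    proof (rule ray[OF that])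
      show "0 \<le> a j \<bullet> (q i - w /\<^sub>R t)" if "j < f" for j
        using gz[OF that] nonneg[OF \<open>i < v\<close> that] by (simp only: inner_diff_right)
    qed
    then have "\<Phi> P \<subseteq> {w /\<^sub>R t}"
      unfolding \<Phi>_def verts_P by (intro hull_minimal) auto
    then have "aff_dim (\<Phi> P) \<le> 0"
      using aff_dim_subset aff_dim_sing by metis
    then show False
      using \<Phi>_dim[OF polytope_face] dim_pos by linarith
  qed
  then show "w = 0"
    using ray[OF i, of w] zero by simp
qed

end

text \<open>The hull determines its vertices and facets but not their labels, hence the maps
  \<open>\<kappa>\<close> and \<open>\<mu>\<close>. Two affine functions that vanish on the same
  facet and are positive at a vertex off it are proportional, since facet and vertex span the
  space.\<close>

lemma realization_unique:
  assumes R: "realization P v f p F q a c" and R': "realization P v f p F q' a' c'"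
    and hull: "convex hull (q ` {..<v}) = convex hull (q' ` {..<v})"
  shows "\<exists>\<kappa> \<mu> \<beta>. (\<forall>k<v. \<kappa> k < v \<and> q k = q' (\<kappa> k)) \<and>
    (\<forall>l<f. \<mu> l < f \<and> 0 < \<beta> l \<and> (\<forall>y. a l \<bullet> y + c l = \<beta> l * (a' (\<mu> l) \<bullet> y + c' (\<mu> l))))"
proof -
  interpret R: realization P v f p F q a c by (rule R)
  interpret R': realization P v f p F q' a' c' by (rule R')
  have eq: "R.\<Phi> P = R'.\<Phi> P"
    using hull by (simp add: R.\<Phi>_def R'.\<Phi>_def R.verts_P)
  have "\<exists>m<v. q k = q' m" if "k < v" for k
    using R.extreme_\<Phi>[of "q k"] R'.extreme_\<Phi>[of "q k"] eq that by auto
  then obtain \<kappa> where \<kappa>: "\<forall>k<v. \<kappa> k < v \<and> q k = q' (\<kappa> k)"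
    by metis
  have "\<exists>m<f. \<exists>b>0. \<forall>y. R.g l y = b * R'.g m y" if l: "l < f" for l
  proof -
    obtain m where m: "m < f" "R.\<Phi> (F l) = R'.\<Phi> (F m)"
      using R.facet_\<Phi>[of "R.\<Phi> (F l)"] R'.facet_\<Phi>[of "R.\<Phi> (F l)"] eq l by auto
    have "\<not> P \<subseteq> F l"
      using R.facet_F[OF l] facet_of_imp_subset by (metis facet_of_irrefl subset_antisym)
    then obtain b where b: "b \<in> R.verts P" "p b \<notin> F l"
      using R.facet_vertex[OF R.polytope_face R.facet_F_face[OF l]] by blast
    have pos: "0 < R.g l (q b)"
      using R.g_pos b l by (simp add: R.verts_def)
    have qb: "q b \<in> R.\<Phi> P"
      using R.q_in_\<Phi> b by blast
    have "q b \<notin> R.\<Phi> (F l)"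
      using R.section_facet[OF l] pos by (metis (mono_tags, lifting) less_irrefl mem_Collect_eq)
    then have "R'.g m (q b) \<noteq> 0"
      using R'.section_facet[OF m(1)] m(2) qb eq by blast
    then have pos': "0 < R'.g m (q b)"
      using R'.g_nonneg_\<Phi>[of "q b" P m] qb eq m by simp
    have "q b \<notin> affine hull R.\<Phi> (F l)"
      using R.g_zero_hull[OF l, of "F l" "q b"] pos by auto
    then have "affine hull (insert (q b) (R.\<Phi> (F l))) = affine hull (R.\<Phi> P)"
      using R.\<Phi>_facet_span[OF R.polytope_face R.facet_F[OF l]] R.q_in_\<Phi>_hull[OF b(1)] by blast
    also have "\<dots> = UNIV"
      using R.\<Phi>_dim[OF R.polytope_face] R.dim by (simp add: aff_dim_eq_full)
    finally have span: "affine hull (insert (q b) (R.\<Phi> (F l))) = UNIV" .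
    let ?a = "R'.g m (q b) *\<^sub>R a l - R.g l (q b) *\<^sub>R a' m"
      and ?c = "R'.g m (q b) * c l - R.g l (q b) * c' m"
    have e: "?a \<bullet> y + ?c = R'.g m (q b) * R.g l y - R.g l (q b) * R'.g m y" for y
      by (simp add: R.g_def R'.g_def algebra_simps)
    have "?a \<bullet> y + ?c = 0" for y
    proof (rule affine_function_zero_hull)
      show "y \<in> affine hull (insert (q b) (R.\<Phi> (F l)))"
        using span by simp
      fix z assume "z \<in> insert (q b) (R.\<Phi> (F l))"
      moreover have "R.g l z = 0" "R'.g m z = 0" if "z \<in> R.\<Phi> (F l)"
        using that R.section_facet[OF l] R'.section_facet[OF m(1)] m(2) by blast+
      ultimately show "?a \<bullet> z + ?c = 0"
        unfolding e by auto
    qed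
    then have "R.g l y = (R.g l (q b) / R'.g m (q b)) * R'.g m y" for y
      using pos' unfolding e by (simp add: field_simps)
    then show ?thesis
      using m(1) pos pos' by (meson divide_pos_pos)
  qed
  then obtain \<mu> \<beta> where "\<forall>l<f. \<mu> l < f \<and> 0 < \<beta> l \<and> (\<forall>y. R.g l y = \<beta> l * R'.g (\<mu> l) y)"
    by metis
  then show ?thesis
    using \<kappa> unfolding R.g_def R'.g_def by blast
qed

section \<open>Slack matrices and projective maps\<close>

lemma inner_option:
  fixes x y :: "real ^ ('d::finite option)"
  shows "x \<bullet> y = vec_nth x None * vec_nth y None + (\<chi> i. vec_nth x (Some i)) \<bullet> (\<chi> i. vec_nth y (Some i))"
  by (simp add: inner_vec_def UNIV_option_conv sum.reindex)

lemma vec_option_eqI: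
  fixes x y :: "real ^ ('d::finite option)"
  assumes "vec_nth x None = vec_nth y None" "\<And>i. vec_nth x (Some i) = vec_nth y (Some i)"
  shows "x = y"
  unfolding vec_eq_iff using assms by (metis not_Some_eq)

text \<open>The affine function \<open>a \<bullet> y + c\<close> as a vector dual to the homogeneous
  coordinates \<open>homog y\<close>.\<close>

definition affine_vec :: "real ^ 'd \<Rightarrow> real \<Rightarrow> real ^ ('d::finite option)" where
  "affine_vec a c = (\<chi> k. case k of None \<Rightarrow> c | Some i \<Rightarrow> vec_nth a i)"

lemma homog_nth [simp]: "vec_nth (homog x) None = 1" "vec_nth (homog x) (Some i) = vec_nth x i"
  by (simp_all add: homog_def)

lemma affine_vec_nth [simp]: "vec_nth (affine_vec a c) None = c" "vec_nth (affine_vec a c) (Some i) = vec_nth a i"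
  by (simp_all add: affine_vec_def)

lemma homog_inner_affine_vec: "homog y \<bullet> affine_vec a c = a \<bullet> y + c"
  by (simp add: inner_option inner_commute)

lemma affine_vec_exhaust: "b = affine_vec (\<chi> i. vec_nth b (Some i)) (vec_nth b None)"
  by (rule vec_option_eqI) auto

lemma homog_exhaust:
  assumes "vec_nth y None \<noteq> 0"
  shows "y = vec_nth y None *\<^sub>R homog (\<chi> i. vec_nth y (Some i) / vec_nth y None)"
  using assms by (intro vec_option_eqI) auto

lemma homog_convex_comb: "u + v = 1 \<Longrightarrow> homog (u *\<^sub>R x + v *\<^sub>R y) = u *\<^sub>R homog x + v *\<^sub>R homog y"
  by (intro vec_option_eqI) auto

lemma factors_through_inner:
  "factors_through CARD('n) m k X \<longleftrightarrow>
    (\<exists>\<alpha> \<beta> :: nat \<Rightarrow> real ^ 'n. \<forall>i<m. \<forall>j<k. X i j = \<alpha> i \<bullet> \<beta> j)"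
proof
  obtain h :: "'n \<Rightarrow> nat" where h: "bij_betw h UNIV {..<CARD('n)}"
    using ex_bij_betw_finite_nat[OF finite_class.finite_UNIV] unfolding atLeast0LessThan by blast
  {
    assume "factors_through CARD('n) m k X"
    then obtain A B where AB: "\<And>i j. i < m \<Longrightarrow> j < k \<Longrightarrow> X i j = (\<Sum>l<CARD('n). A i l * B l j)"
      unfolding factors_through_def by blast
    define \<alpha> \<beta> :: "nat \<Rightarrow> real ^ 'n" where "\<alpha> i = (\<chi> l. A i (h l))" and "\<beta> j = (\<chi> l. B (h l) j)" for i j
    have "X i j = \<alpha> i \<bullet> \<beta> j" if "i < m" "j < k" for i j
      using AB[OF that] sum.reindex_bij_betw[OF h, of "\<lambda>l. A i l * B l j"]
      by (simp add: inner_vec_def \<alpha>_def \<beta>_def)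
    then show "\<exists>\<alpha> \<beta> :: nat \<Rightarrow> real ^ 'n. \<forall>i<m. \<forall>j<k. X i j = \<alpha> i \<bullet> \<beta> j"
      by blast
  }
  {
    assume "\<exists>\<alpha> \<beta> :: nat \<Rightarrow> real ^ 'n. \<forall>i<m. \<forall>j<k. X i j = \<alpha> i \<bullet> \<beta> j"
    then obtain \<alpha> \<beta> :: "nat \<Rightarrow> real ^ 'n" where X: "\<And>i j. i < m \<Longrightarrow> j < k \<Longrightarrow> X i j = \<alpha> i \<bullet> \<beta> j"
      by blast
    define g where "g = inv_into UNIV h"
    have g: "bij_betw g {..<CARD('n)} UNIV"
      unfolding g_def by (rule bij_betw_inv_into[OF h])
    define A B where "A i l = vec_nth (\<alpha> i) (g l)" and "B l j = vec_nth (\<beta> j) (g l)" for i l j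
    have "X i j = (\<Sum>l<CARD('n). A i l * B l j)" if "i < m" "j < k" for i j
      using X[OF that] sum.reindex_bij_betw[OF g, of "\<lambda>l. vec_nth (\<alpha> i) l * vec_nth (\<beta> j) l"]
      by (simp add: inner_vec_def A_def B_def)
    then show "factors_through CARD('n) m k X"
      unfolding factors_through_def by blast
  }
qed

lemma face_functional:
  fixes Q :: "'a::euclidean_space set"
  assumes "polytope Q" "G face_of Q"
  shows "\<exists>a c. \<forall>x\<in>Q. 0 \<le> a \<bullet> x + c \<and> (a \<bullet> x + c = 0 \<longleftrightarrow> x \<in> G)"
proof -
  obtain a b where "Q \<subseteq> {x. a \<bullet> x \<le> b}" "G = Q \<inter> {x. a \<bullet> x = b}"
    using exposed_face_of_polyhedron[OF polytope_imp_polyhedron] assms unfolding exposed_face_of_def by metis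
  then show ?thesis
    by (intro exI[of _ "- a"] exI[of _ b]) auto
qed

lemma (in labelled_polytope) self_realization:
  assumes "aff_dim P = int DIM('b)"
  obtains a c where "realization P v f p F p a c"
proof -
  have "\<forall>j. \<exists>a c. j < f \<longrightarrow> (\<forall>x\<in>P. 0 \<le> a \<bullet> x + c \<and> (a \<bullet> x + c = 0 \<longleftrightarrow> x \<in> F j))"
    using face_functional[OF polytope facet_F_face] by blast
  then obtain a c where ac: "\<And>j x. j < f \<Longrightarrow> x \<in> P \<Longrightarrow> 0 \<le> a j \<bullet> x + c j \<and> (a j \<bullet> x + c j = 0 \<longleftrightarrow> x \<in> F j)"
    by metis
  have "realization P v f p F p a c"
  proof unfold_locales
    show "aff_dim P = int DIM('b)" by (rule assms)
    show "0 \<le> a j \<bullet> p i + c j" "a j \<bullet> p i + c j = 0 \<longleftrightarrow> p i \<in> F j" if "i < v" "j < f" for i j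
      using ac[OF that(2) vertex_in[OF that(1)]] by auto
  qed
  then show thesis by (rule that)
qed

lemma (in labelled_polytope) P_hull: "P = convex hull (p ` {..<v})"
  using face_hull[OF polytope_face] by (simp add: verts_P)

text \<open>The orthogonal map \<open>T\<close> turns the row-sum functional into a multiple of the homogenising
  coordinate, so that the rows become homogenised points after scaling.\<close>
lemma factorization_realization:
  fixes P :: "(real ^ 'd) set"
  assumes L: "labelled_polytope P v f p F" and dim: "aff_dim P = int CARD('d)"
    and nonneg: "\<And>i j. i < v \<Longrightarrow> j < f \<Longrightarrow> 0 \<le> X i j"
    and zero: "\<And>i j. i < v \<Longrightarrow> j < f \<Longrightarrow> X i j = 0 \<longleftrightarrow> p i \<in> F j"
    and fact: "factors_through (CARD('d) + 1) v f X"
  obtains q :: "nat \<Rightarrow> real ^ 'd" and a c r where "realization P v f p F q a c"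
    "\<And>i. i < v \<Longrightarrow> 0 < r i" "\<And>i j. i < v \<Longrightarrow> j < f \<Longrightarrow> a j \<bullet> q i + c j = r i * X i j"
proof -
  interpret labelled_polytope P v f p F by (rule L)
  have "factors_through CARD('d option) v f X"
    using fact by (simp add: card_UNIV_option)
  then obtain \<alpha> \<beta> :: "nat \<Rightarrow> real ^ ('d option)" where X: "\<And>i j. i < v \<Longrightarrow> j < f \<Longrightarrow> X i j = \<alpha> i \<bullet> \<beta> j"
    unfolding factors_through_inner by blast
  \<comment> \<open>\<open>\<alpha> i \<bullet> b\<close> is the sum of row \<open>i\<close>,
    positive because each vertex misses some facet.\<close>
  define b where "b = (\<Sum>j<f. \<beta> j)"
  have row: "0 < \<alpha> i \<bullet> b" if i: "i < v" for i
  proof -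
    obtain j where j: "j < f" "p i \<notin> F j"
      using vertex_off_facet[of i] dim i by auto
    have "0 < (\<Sum>j<f. X i j)"
      using nonneg[OF i] zero[OF i] j by (intro sum_pos2[of _ j]) (auto simp: less_le)
    then show ?thesis
      using X[OF i] by (simp add: b_def inner_sum_right)
  qed
  let ?e = "axis None (norm b) :: real ^ ('d option)"
  have "norm b = norm ?e"
    using norm_eq_sqrt_inner[of ?e] by (simp add: inner_axis_axis)
  then obtain T where T: "orthogonal_transformation T" "T b = ?e"
    using orthogonal_transformation_exists by blast
  have inner_T: "T x \<bullet> T y = x \<bullet> y" for x y
    using T(1) by (simp add: orthogonal_transformation_def)
  define t where "t i = vec_nth (T (\<alpha> i)) None" for i
  have tpos: "0 < t i" if "i < v" for i
  proof -
    have "\<alpha> i \<bullet> b = t i * norm b"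
      using inner_T[of "\<alpha> i" b] T(2) by (simp add: inner_axis t_def)
    then show ?thesis
      using row[OF that] by (auto simp: zero_less_mult_iff)
  qed
  define q where "q i = (\<chi> k. vec_nth (T (\<alpha> i)) (Some k) / t i)" for i
  define a where "a j = (\<chi> k. vec_nth (T (\<beta> j)) (Some k))" for j
  define c where "c j = vec_nth (T (\<beta> j)) None" for j
  have eq: "a j \<bullet> q i + c j = (1 / t i) * X i j" if "i < v" "j < f" for i j
  proof -
    have "T (\<alpha> i) = t i *\<^sub>R homog (q i)"
      using homog_exhaust[of "T (\<alpha> i)"] tpos[OF that(1)] by (simp add: t_def q_def)
    moreover have "T (\<beta> j) = affine_vec (a j) (c j)"
      using affine_vec_exhaust[of "T (\<beta> j)"] by (simp add: a_def c_def)
    ultimately have "X i j = t i * (a j \<bullet> q i + c j)"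
      using X[OF that] inner_T[of "\<alpha> i" "\<beta> j"] by (simp add: homog_inner_affine_vec)
    then show ?thesis
      using tpos[OF that(1)] by simp
  qed
  have "realization P v f p F q a c"
  proof unfold_locales
    show "aff_dim P = int DIM(real ^ 'd)"
      using dim by simp
    show "0 \<le> a j \<bullet> q i + c j" "a j \<bullet> q i + c j = 0 \<longleftrightarrow> p i \<in> F j" if "i < v" "j < f" for i j
      unfolding eq[OF that] using nonneg[OF that] zero[OF that] tpos[OF that(1)] by auto
  qed
  then show thesis
    using that[of q a c "\<lambda>i. 1 / t i"] eq tpos by simp
qed

lemma realization_factors:
  fixes P :: "(real ^ 'd) set" and q :: "nat \<Rightarrow> real ^ 'd"
  shows "factors_through (CARD('d) + 1) v f (\<lambda>i j. a j \<bullet> q i + c j)"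
proof -
  define \<alpha> \<beta> :: "nat \<Rightarrow> real ^ ('d option)"
    where "\<alpha> i = homog (q i)" and "\<beta> j = affine_vec (a j) (c j)" for i j
  have "a j \<bullet> q i + c j = \<alpha> i \<bullet> \<beta> j" for i j
    by (simp add: \<alpha>_def \<beta>_def homog_inner_affine_vec)
  then have "factors_through CARD('d option) v f (\<lambda>i j. a j \<bullet> q i + c j)"
    unfolding factors_through_inner by blast
  then show ?thesis
    by (simp add: card_UNIV_option)
qed

text \<open>\<open>\<phi>\<close> maps vertices to vertices: an extreme point of
  \<open>\<phi> {p i}\<close> is a face of \<open>Q\<close>, hence the image of a nonempty face
  inside \<open>{p i}\<close>. The affine functions come from supporting hyperplanes of the faces
  \<open>\<phi> (F j)\<close>.\<close>

lemma comb_equiv_realization: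
  fixes P Q :: "'a::euclidean_space set"
  assumes L: "labelled_polytope P v f p F" and dim: "aff_dim P = int DIM('a)"
    and Q: "polytope Q" and comb: "comb_equiv P Q"
  obtains q a c where "realization P v f p F q a c" "convex hull (q ` {..<v}) = Q"
proof -
  interpret labelled_polytope P v f p F by (rule L)
  obtain \<phi> where bij: "bij_betw \<phi> {G. G face_of P} {T. T face_of Q}"
    and mono: "\<And>G H. G face_of P \<Longrightarrow> H face_of P \<Longrightarrow> G \<subseteq> H \<longleftrightarrow> \<phi> G \<subseteq> \<phi> H"
    using comb unfolding comb_equiv_def by blast
  have face: "\<phi> G face_of Q" if "G face_of P" for G
    using bij that by (auto simp: bij_betw_def)
  have onto: "\<exists>G. G face_of P \<and> T = \<phi> G" if "T face_of Q" for T
    using bij that unfolding bij_betw_def by blast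
  have empty: "\<phi> G = {} \<longleftrightarrow> G = {}" if G: "G face_of P" for G
  proof -
    obtain H where H: "H face_of P" "{} = \<phi> H"
      using onto[OF empty_face_of] by blast
    have "H \<subseteq> {}"
      using mono[OF H(1) empty_face_of] H(2) by simp
    then have "\<phi> {} = {}"
      using H(2) by simp
    then show ?thesis
      using mono[OF G empty_face_of] by auto
  qed
  have ext: "\<exists>x. \<phi> {p i} = {x}" if i: "i < v" for i
  proof -
    have poly: "polytope (\<phi> {p i})"
      using face_of_polytope_polytope[OF Q face[OF vertex_face[OF i]]] .
    have "\<phi> {p i} \<noteq> {}"
      using empty[OF vertex_face[OF i]] by simp
    then obtain x where x: "x extreme_point_of \<phi> {p i}"
      using extreme_point_exists_convex poly polytope_imp_compact polytope_imp_convex by metis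
    then have "{x} face_of \<phi> {p i}" and xi: "x \<in> \<phi> {p i}"
      by (simp_all add: face_of_singleton extreme_point_of_def)
    then have xQ: "{x} face_of Q"
      using face_of_trans face[OF vertex_face[OF i]] by metis
    obtain G where G: "G face_of P" "{x} = \<phi> G"
      using onto[OF xQ] by blast
    have "G \<subseteq> {p i}"
      unfolding mono[OF G(1) vertex_face[OF i]] G(2)[symmetric] using xi by blast
    moreover have "G \<noteq> {}"
      using empty[OF G(1)] G(2) by auto
    ultimately have "G = {p i}"
      by blast
    then show ?thesis
      using G(2) by metis
  qed
  then obtain q where q: "\<And>i. i < v \<Longrightarrow> \<phi> {p i} = {q i}"
    by metis
  have mem: "q i \<in> \<phi> G \<longleftrightarrow> p i \<in> G" if "i < v" "G face_of P" for i G
    using mono[OF vertex_face[OF that(1)] that(2)] q[OF that(1)] by simp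
  have extQ: "{x. x extreme_point_of Q} = q ` {..<v}"
  proof
    show "q ` {..<v} \<subseteq> {x. x extreme_point_of Q}"
    proof
      fix x assume "x \<in> q ` {..<v}"
      then obtain i where "i < v" "x = q i" by blast
      then have "{x} face_of Q"
        using face[OF vertex_face] q by metis
      then show "x \<in> {x. x extreme_point_of Q}"
        using face_of_singleton by blast
    qed
    show "{x. x extreme_point_of Q} \<subseteq> q ` {..<v}"
    proof
      fix x assume "x \<in> {x. x extreme_point_of Q}"
      then have "{x} face_of Q"
        using face_of_singleton by blast
      then obtain G where G: "G face_of P" "{x} = \<phi> G"
        using onto by blast
      then have "G \<noteq> {}"
        using empty by blast
      then obtain i where i: "i < v" "p i \<in> G"
        using face_vertex[OF G(1)] unfolding verts_def by blast
      then have "q i \<in> {x}"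
        using mem[OF i(1) G(1)] G(2) by blast
      then show "x \<in> q ` {..<v}"
        using i by blast
    qed
  qed
  have "\<forall>j. \<exists>a c. j < f \<longrightarrow> (\<forall>x\<in>Q. 0 \<le> a \<bullet> x + c \<and> (a \<bullet> x + c = 0 \<longleftrightarrow> x \<in> \<phi> (F j)))"
    using face_functional[OF Q face[OF facet_F_face]] by blast
  then obtain a c where ac: "\<And>j x. j < f \<Longrightarrow> x \<in> Q \<Longrightarrow>
      0 \<le> a j \<bullet> x + c j \<and> (a j \<bullet> x + c j = 0 \<longleftrightarrow> x \<in> \<phi> (F j))"
    by metis
  have qQ: "q i \<in> Q" if "i < v" for i
    using extQ that by (auto simp: extreme_point_of_def)
  have "realization P v f p F q a c"
  proof unfold_locales
    show "aff_dim P = int DIM('a)" by (rule dim)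
    show "0 \<le> a j \<bullet> q i + c j" "a j \<bullet> q i + c j = 0 \<longleftrightarrow> p i \<in> F j" if "i < v" "j < f" for i j
      using ac[OF that(2) qQ[OF that(1)]] mem[OF that(1) facet_F_face[OF that(2)]] by auto
  qed
  moreover have "convex hull (q ` {..<v}) = Q"
    using Krein_Milman_Minkowski[of Q] Q extQ by (simp add: polytope_imp_compact polytope_imp_convex)
  ultimately show thesis by (rule that)
qed

lemma realization_comb_equiv:
  fixes P :: "'a::euclidean_space set" and q :: "nat \<Rightarrow> 'a"
  assumes "realization P v f p F q a c"
  shows "comb_equiv P (convex hull (q ` {..<v}))" "polytope (convex hull (q ` {..<v}))"
proof -
  interpret realization P v f p F q a c by (rule assms)
  have P: "\<Phi> P = convex hull (q ` {..<v})"
    by (simp add: \<Phi>_def verts_P)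
  have "\<exists>\<phi>. bij_betw \<phi> {G. G face_of P} {T. T face_of \<Phi> P} \<and>
      (\<forall>G H. G face_of P \<longrightarrow> H face_of P \<longrightarrow> (G \<subseteq> H \<longleftrightarrow> \<phi> G \<subseteq> \<phi> H))"
    using \<Phi>_bij \<Phi>_subset_iff by blast
  then show "comb_equiv P (convex hull (q ` {..<v}))"
    unfolding comb_equiv_def P[symmetric] .
  show "polytope (convex hull (q ` {..<v}))"
    using polytope_\<Phi>[of P] by (simp only: P)
qed

section \<open>Projective maps in homogeneous coordinates\<close>

lemma homog_proj_map:
  assumes "vec_nth (M *v homog x) None \<noteq> 0"
  shows "M *v homog x = vec_nth (M *v homog x) None *\<^sub>R homog (proj_map M x)"
  using homog_exhaust[OF assms] by (simp add: proj_map_def)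

lemma proj_map_eqI:
  assumes "M *v homog x = t *\<^sub>R homog z" "t \<noteq> 0"
  shows "vec_nth (M *v homog x) None = t" "proj_map M x = z"
  using assms by (simp_all add: proj_map_def vec_eq_iff)

lemma matrix_vector_comb:
  fixes M :: "real ^ 'n ^ 'm"
  shows "M *v (u *\<^sub>R x + v *\<^sub>R y) = u *\<^sub>R (M *v x) + v *\<^sub>R (M *v y)"
  by (simp add: matrix_vector_right_distrib matrix_vector_mult_scaleR)

lemma proj_map_neg: "proj_map (- M) x = proj_map M x"
proof -
  have "(- M) *v y = - (M *v y)" for y
    by (simp add: vec_eq_iff matrix_vector_mult_def sum_negf)
  then show ?thesis
    by (simp add: proj_map_def)
qed

text \<open>Where the denominator is positive, convex combinations go to convex combinations with
  weights rescaled by the denominators, and the rescaling can be undone; so preimage and image of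
  convex sets are convex, and each gives one inclusion.\<close>

lemma proj_map_convex_hull:
  assumes pos: "\<And>x. x \<in> S \<Longrightarrow> 0 < vec_nth (M *v homog x) None"
  shows "\<And>x. x \<in> convex hull S \<Longrightarrow> 0 < vec_nth (M *v homog x) None"
    and "proj_map M ` (convex hull S) = convex hull (proj_map M ` S)"
proof -
  let ?N = "\<lambda>x. vec_nth (M *v homog x) None"
  have comb: "?N (u *\<^sub>R x + w *\<^sub>R y) = u * ?N x + w * ?N y" if "u + w = 1" for u w x y
    by (simp add: homog_convex_comb[OF that] matrix_vector_comb)
  have pos2: "0 < u * s + w * t" if "0 \<le> u" "0 \<le> w" "u + w = 1" "0 < s" "0 < t" for u w s t :: real
    using that by (metis add_cancel_left_left add_nonneg_pos add_pos_nonneg less_eq_real_def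
        mult_eq_0_iff mult_nonneg_nonneg mult_pos_pos zero_neq_one)
  have "convex {x. 0 < ?N x}"
    unfolding convex_def using comb pos2 by simp
  then have hull_pos: "convex hull S \<subseteq> {x. 0 < ?N x}"
    using pos by (intro hull_minimal) auto
  then show N: "\<And>x. x \<in> convex hull S \<Longrightarrow> 0 < ?N x"
    by blast
  let ?T = "{x. 0 < ?N x \<and> proj_map M x \<in> convex hull (proj_map M ` S)}"
  have "convex ?T"
  proof (rule convexI)
    fix x y and u w :: real
    assume x: "x \<in> ?T" and y: "y \<in> ?T" and uw: "0 \<le> u" "0 \<le> w" "u + w = 1"
    let ?z = "u *\<^sub>R x + w *\<^sub>R y" and ?s = "u * ?N x + w * ?N y"
    let ?r = "(u * ?N x / ?s) *\<^sub>R proj_map M x + (w * ?N y / ?s) *\<^sub>R proj_map M y"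
    have s: "0 < ?s"
      using pos2[OF uw] x y by blast
    have one: "u * ?N x / ?s + w * ?N y / ?s = 1"
      using s by (simp add: add_divide_distrib[symmetric])
    have "M *v homog ?z = u *\<^sub>R (?N x *\<^sub>R homog (proj_map M x)) + w *\<^sub>R (?N y *\<^sub>R homog (proj_map M y))"
      using homog_proj_map[of M x] homog_proj_map[of M y] x y
      by (simp add: homog_convex_comb[OF uw(3)] matrix_vector_comb)
    also have "\<dots> = ?s *\<^sub>R homog ?r"
      using s by (simp add: homog_convex_comb[OF one] scaleR_add_right)
    finally have eq: "M *v homog ?z = ?s *\<^sub>R homog ?r" .
    have "proj_map M ?z = ?r" "?N ?z = ?s"
      using proj_map_eqI[OF eq] s by auto
    moreover have "?r \<in> convex hull (proj_map M ` S)"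
      by (rule convexD[OF convex_convex_hull]) (use x y uw s one in auto)
    ultimately show "?z \<in> ?T"
      using s by simp
  qed
  moreover have "S \<subseteq> ?T"
    using pos by (auto intro: hull_inc)
  ultimately have "convex hull S \<subseteq> ?T"
    by (rule hull_minimal[rotated])
  then have sub: "proj_map M ` (convex hull S) \<subseteq> convex hull (proj_map M ` S)"
    by blast
  have "convex (proj_map M ` (convex hull S))"
  proof (rule convexI)
    fix z z' and u w :: real
    assume "z \<in> proj_map M ` (convex hull S)" "z' \<in> proj_map M ` (convex hull S)"
      and uw: "0 \<le> u" "0 \<le> w" "u + w = 1"
    then obtain x y where x: "x \<in> convex hull S" "z = proj_map M x"
      and y: "y \<in> convex hull S" "z' = proj_map M y" by blast
    have Nx: "0 < ?N x" and Ny: "0 < ?N y"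
      using N x y by auto
    \<comment> \<open>The weights of the preimage are \<open>u\<close> and \<open>w\<close> divided
      by the denominators and normalised by \<open>?s\<close>.\<close>
    let ?s = "u * (1 / ?N x) + w * (1 / ?N y)"
    have s: "0 < ?s"
      by (rule pos2[OF uw]) (use Nx Ny in auto)
    let ?u = "u * (1 / ?N x) / ?s" and ?w = "w * (1 / ?N y) / ?s"
    have one: "?u + ?w = 1"
      unfolding add_divide_distrib[symmetric] by (rule divide_self) (use s in linarith)
    have "?N x *\<^sub>R homog z = M *v homog x" "?N y *\<^sub>R homog z' = M *v homog y"
      using homog_proj_map[of M x] homog_proj_map[of M y] Nx Ny x(2) y(2) by simp_all
    then have "M *v homog (?u *\<^sub>R x + ?w *\<^sub>R y)
        = ?u *\<^sub>R (?N x *\<^sub>R homog z) + ?w *\<^sub>R (?N y *\<^sub>R homog z')"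
      by (simp only: homog_convex_comb[OF one] matrix_vector_comb)
    also have "\<dots> = (1 / ?s) *\<^sub>R (u *\<^sub>R homog z + w *\<^sub>R homog z')"
      using Nx Ny by (simp add: scaleR_add_right)
    finally have eq: "M *v homog (?u *\<^sub>R x + ?w *\<^sub>R y) = (1 / ?s) *\<^sub>R homog (u *\<^sub>R z + w *\<^sub>R z')"
      by (simp add: homog_convex_comb[OF uw(3)])
    have "?u *\<^sub>R x + ?w *\<^sub>R y \<in> convex hull S"
    proof (rule convexD[OF convex_convex_hull x(1) y(1)])
      show "0 \<le> ?u" "0 \<le> ?w"
        using uw s Nx Ny by (intro divide_nonneg_pos mult_nonneg_nonneg; simp)+
    qed (rule one)
    moreover have "proj_map M (?u *\<^sub>R x + ?w *\<^sub>R y) = u *\<^sub>R z + w *\<^sub>R z'"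
      using proj_map_eqI(2)[OF eq] s by simp
    ultimately show "u *\<^sub>R z + w *\<^sub>R z' \<in> proj_map M ` (convex hull S)"
      by (metis imageI)
  qed
  moreover have "proj_map M ` S \<subseteq> proj_map M ` (convex hull S)"
    by (intro image_mono hull_subset)
  ultimately show "proj_map M ` (convex hull S) = convex hull (proj_map M ` S)"
    using sub by (intro subset_antisym hull_minimal)
qed

text \<open>The denominator is affine and has no zero on the convex set \<open>P\<close>, so its
  sign is constant there; if it is negative, \<open>- M\<close> defines the same projective
  map.\<close>

lemma proj_equiv_positive:
  assumes "proj_equiv P Q" "convex P"
  obtains M where "invertible M" "\<And>x. x \<in> P \<Longrightarrow> 0 < vec_nth (M *v homog x) None" "proj_map M ` P = Q"
proof -
  obtain M where M: "invertible M" "\<And>x. x \<in> P \<Longrightarrow> vec_nth (M *v homog x) None \<noteq> 0" "proj_map M ` P = Q"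
    using assms(1) unfolding proj_equiv_def by blast
  let ?N = "\<lambda>x. vec_nth (M *v homog x) None"
  have mixed: False if xy: "x \<in> P" "y \<in> P" "0 < ?N x" "?N y < 0" for x y
  proof -
    \<comment> \<open>The parameter at which the denominator vanishes on the segment from
      \<open>x\<close> to \<open>y\<close>.\<close>
    let ?t = "?N x / (?N x - ?N y)"
    have "?t \<le> 1"
      using xy by (subst pos_divide_le_eq) auto
    then have t: "0 \<le> 1 - ?t" "0 \<le> ?t" "(1 - ?t) + ?t = 1"
      using xy by (simp_all add: zero_le_divide_iff)
    have "?N ((1 - ?t) *\<^sub>R x + ?t *\<^sub>R y) = (1 - ?t) * ?N x + ?t * ?N y"
      by (simp add: homog_convex_comb[OF t(3)] matrix_vector_comb)
    also have "\<dots> = 0"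
    proof -
      have "(1 - s / (s - t)) * s + s / (s - t) * t = 0" if "s \<noteq> t" for s t :: real
        using that by (simp add: field_simps)
      then show ?thesis
        using xy by simp
    qed
    finally show False
      using M(2)[OF convexD[OF assms(2) xy(1,2) t]] by blast
  qed
  have neg: "(- M) *v y = - (M *v y)" for y
    by (simp add: vec_eq_iff matrix_vector_mult_def sum_negf)
  consider "\<forall>x\<in>P. 0 < ?N x" | "\<forall>x\<in>P. ?N x < 0"
    using mixed M(2) by (metis linorder_neqE_linordered_idom)
  then show thesis
  proof cases
    case 1
    then show thesis using M that by blast
  next
    case 2
    have inv: "invertible (- M)"
    proof -
      obtain M' where M': "M ** M' = mat 1" "M' ** M = mat 1"
        using M(1) unfolding invertible_def by blast
      have "(- M) ** (- M') = mat 1" "(- M') ** (- M) = mat 1"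
        using M' by (simp_all add: matrix_matrix_mult_def)
      then show ?thesis
        unfolding invertible_def by blast
    qed
    have im: "proj_map (- M) ` P = Q"
      using M(3) by (simp add: proj_map_neg)
    have pos: "0 < vec_nth ((- M) *v homog x) None" if "x \<in> P" for x
      using 2 that by (simp add: neg)
    show thesis
      by (rule that[OF inv pos im])
  qed
qed

context
  fixes P :: "'b::euclidean_space set" and v f p F and q :: "nat \<Rightarrow> real ^ 'd" and a c
  assumes R: "realization P v f p F q a c"
begin

interpretation realization P v f p F q a c by (rule R)

lemma facet_vectors_separate:
  assumes "\<And>j. j < f \<Longrightarrow> y \<bullet> affine_vec (a j) (c j) = 0"
  shows "y = 0"
proof -
  let ?w = "\<chi> i. vec_nth y (Some i)"
  have "a j \<bullet> ?w + vec_nth y None * c j = 0" if "j < f" for j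
    using assms[OF that] by (simp add: inner_option inner_commute add.commute)
  then have "?w = 0" "vec_nth y None = 0"
    using coefficients_independent by blast+
  then show ?thesis
    by (intro vec_option_eqI) (auto simp: vec_eq_iff)
qed

text \<open>By \<open>\<Phi>_dim\<close> the points \<open>q i\<close> affinely span the space, so
  an affine function vanishing at all of them is zero.\<close>

lemma vertex_vectors_separate:
  assumes "\<And>i. i < v \<Longrightarrow> homog (q i) \<bullet> z = 0"
  shows "z = 0"
proof -
  let ?a = "\<chi> i. vec_nth z (Some i)" and ?c = "vec_nth z None"
  have z: "z = affine_vec ?a ?c"
    by (rule affine_vec_exhaust)
  have hull: "affine hull (q ` {..<v}) = UNIV"
    using \<Phi>_dim[OF polytope_face] dim aff_dim_eq_full[of "q ` {..<v}"]
    by (simp add: \<Phi>_def verts_P aff_dim_convex_hull)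
  have "?a \<bullet> y + ?c = 0" for y
  proof (rule affine_function_zero_hull)
    show "y \<in> affine hull (q ` {..<v})"
      by (simp add: hull)
    fix x assume "x \<in> q ` {..<v}"
    then show "?a \<bullet> x + ?c = 0"
      using assms z homog_inner_affine_vec by (metis imageE lessThan_iff)
  qed
  from this[of 0] this[of ?a] have "?c = 0" "?a = 0"
    by auto
  then show ?thesis
    using z by (intro vec_option_eqI) (auto simp: vec_eq_iff)
qed

end

text \<open>The map \<open>N'\<close> is the Gram operator of the second system of facet vectors, so it is invertible;
  \<open>inv N' \<circ> N\<close> sends each \<open>homog (q i)\<close> to a multiple of \<open>homog (q' i)\<close>.\<close>
lemma scaled_realizations_proj_equiv:
  fixes q q' :: "nat \<Rightarrow> real ^ 'd"
  assumes R: "realization P v f p F q a c" and R': "realization P v f p F q' a' c'"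
    and pos: "\<And>i. i < v \<Longrightarrow> 0 < s i"
    and scale: "\<And>i j. i < v \<Longrightarrow> j < f \<Longrightarrow> a' j \<bullet> q' i + c' j = s i * u j * (a j \<bullet> q i + c j)"
  shows "proj_equiv (convex hull (q ` {..<v})) (convex hull (q' ` {..<v}))"
proof -
  let ?b = "\<lambda>j. affine_vec (a j) (c j)" and ?b' = "\<lambda>j. affine_vec (a' j) (c' j)"
  define N where "N y = (\<Sum>j<f. (u j * (y \<bullet> ?b j)) *\<^sub>R ?b' j)" for y
  define N' where "N' y = (\<Sum>j<f. (y \<bullet> ?b' j) *\<^sub>R ?b' j)" for y
  have lin: "linear N"
    by (rule linearI) (simp_all add: N_def inner_add_left distrib_left scaleR_add_left sum.distrib scaleR_sum_right mult.left_commute)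
  have lin': "linear N'"
    by (rule linearI) (simp_all add: N'_def inner_add_left scaleR_add_left sum.distrib scaleR_sum_right)
  have "inj N'"
    unfolding linear_injective_0[OF lin']
  proof (intro allI impI)
    fix y assume "N' y = 0"
    then have "0 = y \<bullet> N' y"
      by simp
    also have "\<dots> = (\<Sum>j<f. (y \<bullet> ?b' j)\<^sup>2)"
      by (simp add: N'_def inner_sum_right power2_eq_square)
    finally have "y \<bullet> ?b' j = 0" if "j < f" for j
      using that by (simp add: sum_nonneg_eq_0_iff)
    then show "y = 0"
      by (rule facet_vectors_separate[OF R'])
  qed
  then obtain G where G: "linear G" "G \<circ> N' = id"
    using linear_injective_left_inverse[OF lin'] by blast
  define M where "M = matrix (G \<circ> N)"
  have M: "M *v y = G (N y)" for y
    unfolding M_def using fun_cong[OF matrix_vector_mul(2)[OF linear_compose[OF lin G(1)]], of y] by simp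
  have Mq: "M *v homog (q i) = (1 / s i) *\<^sub>R homog (q' i)" if i: "i < v" for i
  proof -
    have "N' ((1 / s i) *\<^sub>R homog (q' i)) = N (homog (q i))"
      unfolding N_def N'_def
    proof (rule sum.cong)
      fix j assume "j \<in> {..<f}"
      then have "homog (q' i) \<bullet> ?b' j = s i * u j * (homog (q i) \<bullet> ?b j)"
        unfolding homog_inner_affine_vec using scale[OF i] by simp
      then show "((1 / s i) *\<^sub>R homog (q' i) \<bullet> ?b' j) *\<^sub>R ?b' j = (u j * (homog (q i) \<bullet> ?b j)) *\<^sub>R ?b' j"
        using pos[OF i] by simp
    qed simp
    then show ?thesis
      using M G(2) by (metis comp_apply id_apply)
  qed
  \<comment> \<open>\<open>M\<close> attains a nonzero multiple of each \<open>homog (q' i)\<close>,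
    and these vectors span; surjectivity is expressed by the trivial kernel of the
    transpose.\<close>
  have "invertible (transpose M)"
  proof -
    have "y = 0" if y: "transpose M *v y = 0" for y
    proof (rule vertex_vectors_separate[OF R'])
      fix i assume i: "i < v"
      have "0 = homog (q i) \<bullet> (transpose M *v y)"
        using y by simp
      also have "\<dots> = (M *v homog (q i)) \<bullet> y"
        by (metis dot_lmul_matrix transpose_matrix_vector transpose_transpose)
      also have "\<dots> = (1 / s i) * (homog (q' i) \<bullet> y)"
        by (simp add: Mq[OF i])
      finally show "homog (q' i) \<bullet> y = 0"
        using pos[OF i] by simp
    qed
    then show ?thesis
      using matrix_left_invertible_ker invertible_left_inverse by blast
  qed
  then have inv: "invertible M"
    using transpose_invertible transpose_transpose by metis
  have N: "0 < vec_nth (M *v homog x) None" if "x \<in> q ` {..<v}" for x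
    using that Mq pos by auto
  have "proj_map M (q i) = q' i" if "i < v" for i
    using proj_map_eqI(2)[OF Mq[OF that]] pos[OF that] by simp
  then have "proj_map M ` q ` {..<v} = q' ` {..<v}"
    by (auto simp: image_image)
  then have "proj_map M ` (convex hull (q ` {..<v})) = convex hull (q' ` {..<v})"
    using proj_map_convex_hull(2)[of "q ` {..<v}" M, OF N] by simp
  moreover have "\<forall>x\<in>convex hull (q ` {..<v}). vec_nth (M *v homog x) None \<noteq> 0"
    using proj_map_convex_hull(1)[of "q ` {..<v}" M, OF N] by force
  ultimately show ?thesis
    unfolding proj_equiv_def using inv by blast
qed

text \<open>Affine functions transform by the inverse of the transpose, so their values at the
  images are the old ones divided by positive denominators and the sign pattern is
  unchanged.\<close>

lemma realization_proj_image:
  fixes q :: "nat \<Rightarrow> real ^ 'd"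
  assumes R: "realization P v f p F q a c" and inv: "invertible M"
    and pos: "\<And>i. i < v \<Longrightarrow> 0 < vec_nth (M *v homog (q i)) None"
  obtains a' c' where "realization P v f p F (\<lambda>i. proj_map M (q i)) a' c'"
    "\<And>i j. i < v \<Longrightarrow> a' j \<bullet> proj_map M (q i) + c' j = (a j \<bullet> q i + c j) / vec_nth (M *v homog (q i)) None"
proof -
  interpret realization P v f p F q a c by (rule R)
  obtain W where W: "transpose M ** W = mat 1"
    using transpose_invertible[OF inv] unfolding invertible_def by blast
  define b where "b j = W *v affine_vec (a j) (c j)" for j
  define a' where "a' j = (\<chi> i. vec_nth (b j) (Some i))" for j
  define c' where "c' j = vec_nth (b j) None" for j
  have b: "b j = affine_vec (a' j) (c' j)" for j
    unfolding a'_def c'_def by (rule affine_vec_exhaust)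
  have eq: "a' j \<bullet> proj_map M (q i) + c' j = (a j \<bullet> q i + c j) / vec_nth (M *v homog (q i)) None"
    if i: "i < v" for i j
  proof -
    let ?n = "vec_nth (M *v homog (q i)) None"
    have "?n * (homog (proj_map M (q i)) \<bullet> b j) = (M *v homog (q i)) \<bullet> b j"
      using homog_proj_map[of M "q i"] pos[OF i] by (metis inner_scaleR_left less_irrefl)
    also have "\<dots> = homog (q i) \<bullet> (transpose M *v b j)"
      by (metis dot_lmul_matrix transpose_matrix_vector transpose_transpose)
    also have "transpose M *v b j = affine_vec (a j) (c j)"
      unfolding b_def by (simp add: matrix_vector_mul_assoc W)
    finally show ?thesis
      using pos[OF i] unfolding b homog_inner_affine_vec by (simp add: field_simps)
  qed
  have "realization P v f p F (\<lambda>i. proj_map M (q i)) a' c'"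
  proof unfold_locales
    show "aff_dim P = int DIM(real ^ 'd)"
      by (rule dim)
    show "0 \<le> a' j \<bullet> proj_map M (q i) + c' j" "a' j \<bullet> proj_map M (q i) + c' j = 0 \<longleftrightarrow> p i \<in> F j"
      if "i < v" "j < f" for i j
      unfolding eq[OF that(1)] using nonneg[OF that] zero_iff[OF that] pos[OF that(1)] by auto
  qed
  then show thesis
    using that eq by blast
qed

text \<open>A projective transformation carries the vertices and facets of \<open>P\<close> to those of \<open>Q\<close> in some
  order, possibly not the given labelling; hence the index maps \<open>\<kappa>\<close> and \<open>\<mu>\<close>.\<close>
lemma projectively_unique_slack:
  fixes P :: "(real ^ 'd) set"
  assumes L: "labelled_polytope P v f p F" and dim: "aff_dim P = int CARD('d)"
    and unique: "projectively_unique P" and self: "realization P v f p F p a c"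
    and nonneg: "\<And>i j. i < v \<Longrightarrow> j < f \<Longrightarrow> 0 \<le> X i j"
    and zero: "\<And>i j. i < v \<Longrightarrow> j < f \<Longrightarrow> X i j = 0 \<longleftrightarrow> p i \<in> F j"
    and fact: "factors_through (CARD('d) + 1) v f X"
  shows "\<exists>\<kappa> \<mu> s u. (\<forall>i<v. \<kappa> i < v \<and> 0 < s i) \<and> (\<forall>j<f. \<mu> j < f \<and> 0 < u j) \<and>
      (\<forall>i<v. \<forall>j<f. X i j = s i * u j * (a (\<mu> j) \<bullet> p (\<kappa> i) + c (\<mu> j)))" (is ?A)
    and "\<exists>\<kappa> \<mu> s u. (\<forall>i<v. \<kappa> i < v \<and> 0 < s i) \<and> (\<forall>j<f. \<mu> j < f \<and> 0 < u j) \<and>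
      (\<forall>i<v. \<forall>j<f. a j \<bullet> p i + c j = s i * u j * X (\<kappa> i) (\<mu> j))" (is ?B)
proof -
  interpret labelled_polytope P v f p F by (rule L)
  obtain q :: "nat \<Rightarrow> real ^ 'd" and a' c' r where R: "realization P v f p F q a' c'"
    and r: "\<And>i. i < v \<Longrightarrow> 0 < r i" "\<And>i j. i < v \<Longrightarrow> j < f \<Longrightarrow> a' j \<bullet> q i + c' j = r i * X i j"
    using factorization_realization[OF L dim nonneg zero fact] by blast
  let ?Q = "convex hull (q ` {..<v})"
  have "proj_equiv P ?Q"
    using unique realization_comb_equiv[OF R] unfolding projectively_unique_def by blast
  then obtain M where M: "invertible M" "\<And>x. x \<in> P \<Longrightarrow> 0 < vec_nth (M *v homog x) None" "proj_map M ` P = ?Q"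
    using proj_equiv_positive polytope polytope_imp_convex by metis
  let ?n = "\<lambda>i. vec_nth (M *v homog (p i)) None"
  have n: "0 < ?n i" if "i < v" for i
    using M(2) vertex_in[OF that] by blast
  obtain a'' c'' where R'': "realization P v f p F (\<lambda>i. proj_map M (p i)) a'' c''"
    and eq: "\<And>i j. i < v \<Longrightarrow> a'' j \<bullet> proj_map M (p i) + c'' j = (a j \<bullet> p i + c j) / ?n i"
    using realization_proj_image[OF self M(1) n] by blast
  have hull: "?Q = convex hull ((\<lambda>i. proj_map M (p i)) ` {..<v})"
  proof -
    have "\<And>x. x \<in> p ` {..<v} \<Longrightarrow> 0 < vec_nth (M *v homog x) None"
      using n by auto
    from proj_map_convex_hull(2)[OF this] show ?thesis
      using M(3) P_hull by (simp add: image_image)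
  qed
  show ?A
  proof -
    obtain \<kappa> \<mu> \<beta> where \<kappa>: "\<forall>k<v. \<kappa> k < v \<and> q k = proj_map M (p (\<kappa> k))"
      and \<mu>: "\<forall>l<f. \<mu> l < f \<and> 0 < \<beta> l \<and> (\<forall>y. a' l \<bullet> y + c' l = \<beta> l * (a'' (\<mu> l) \<bullet> y + c'' (\<mu> l)))"
      using realization_unique[OF R R'' hull] by blast
    define s where "s i = 1 / (r i * ?n (\<kappa> i))" for i
    have "X i j = s i * \<beta> j * (a (\<mu> j) \<bullet> p (\<kappa> i) + c (\<mu> j))" if ij: "i < v" "j < f" for i j
    proof -
      have k: "\<kappa> i < v" "q i = proj_map M (p (\<kappa> i))"
        using \<kappa> ij by auto
      have "r i * X i j = \<beta> j * ((a (\<mu> j) \<bullet> p (\<kappa> i) + c (\<mu> j)) / ?n (\<kappa> i))"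
        using r(2)[OF ij] \<mu> ij eq[OF k(1)] k(2) by metis
      then show ?thesis
        using r(1)[OF ij(1)] n[OF k(1)] by (simp add: s_def field_simps)
    qed
    moreover have "0 < s i" if "i < v" for i
      using that r(1) n \<kappa> by (simp add: s_def)
    ultimately show ?A
      using \<kappa> \<mu> by blast
  qed
  \<comment> \<open>\<open>realization_unique\<close> does not provide bijective index maps, so
    \<open>?A\<close> is not inverted; the uniqueness is applied again with the realizations
    exchanged.\<close>
  show ?B
  proof -
    obtain \<kappa> \<mu> \<beta> where \<kappa>: "\<forall>k<v. \<kappa> k < v \<and> proj_map M (p k) = q (\<kappa> k)"
      and \<mu>: "\<forall>l<f. \<mu> l < f \<and> 0 < \<beta> l \<and> (\<forall>y. a'' l \<bullet> y + c'' l = \<beta> l * (a' (\<mu> l) \<bullet> y + c' (\<mu> l)))"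
      using realization_unique[OF R'' R hull[symmetric]] by blast
    define s where "s i = ?n i * r (\<kappa> i)" for i
    have "a j \<bullet> p i + c j = s i * \<beta> j * X (\<kappa> i) (\<mu> j)" if ij: "i < v" "j < f" for i j
    proof -
      have k: "\<kappa> i < v" "proj_map M (p i) = q (\<kappa> i)" and l: "\<mu> j < f"
        using \<kappa> \<mu> ij by auto
      have "(a j \<bullet> p i + c j) / ?n i = \<beta> j * (r (\<kappa> i) * X (\<kappa> i) (\<mu> j))"
        using r(2)[OF k(1) l] \<mu> ij eq[OF ij(1)] k(2) by metis
      then show ?thesis
        using n[OF ij(1)] by (simp add: s_def field_simps)
    qed
    moreover have "0 < s i" if "i < v" for i
      using that r(1) n \<kappa> by (simp add: s_def)
    ultimately show ?B
      using \<kappa> \<mu> by blast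
  qed
qed

section \<open>The slack ideal\<close>

definition extend_zero :: "(nat \<times> nat) set \<Rightarrow> (nat \<times> nat \<Rightarrow> real) \<Rightarrow> nat \<Rightarrow> nat \<Rightarrow> real" where
  "extend_zero E x i j = (if (i, j) \<in> E then x (i, j) else 0)"

text \<open>The minors lie in the saturation, so their vanishing is necessary; it is sufficient
  because the product of the variables is nonzero at a positive point. At a real point the minors
  evaluate to real determinants, so the factorization exists over the reals.\<close>

lemma slack_ideal_positive_points:
  fixes v f :: nat and pv :: "nat \<Rightarrow> 'x" and pF :: "nat \<Rightarrow> 'x set" and x :: "nat \<times> nat \<Rightarrow> real"
  defines "E \<equiv> noninc v f pv pF"
  assumes pos: "\<And>e. e \<in> E \<Longrightarrow> 0 < x e"
  shows "(\<forall>p\<in>slack_ideal d v f pv pF. poly_eval (\<lambda>e. of_real (x e)) p = 0) \<longleftrightarrow>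
    factors_through (d + 1) v f (extend_zero E x)"
proof -
  let ?X = "extend_zero E x" and ?S = "symbolic_slack pv pF" and ?x = "\<lambda>e. complex_of_real (x e)"
  let ?G = "minors (d + 2) v f ?S"
  have ev: "poly_eval ?x (?S i j) = of_real (?X i j)" if "i < v" "j < f" for i j
    using that by (simp add: symbolic_slack_def extend_zero_def E_def noninc_def)
  have det: "poly_eval ?x (det_fun (d + 2) (\<lambda>a b. ?S (sorted_list_of_set I ! a) (sorted_list_of_set J ! b)))
      = of_real (det_fun (d + 2) (\<lambda>a b. ?X (sorted_list_of_set I ! a) (sorted_list_of_set J ! b)))"
    if IJ: "I \<subseteq> {..<v}" "J \<subseteq> {..<f}" "card I = d + 2" "card J = d + 2" for I J
  proof -
    have fin: "finite I" "finite J"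
      using IJ finite_subset by blast+
    have mem: "sorted_list_of_set I ! a < v" "sorted_list_of_set J ! a < f" if "a < d + 2" for a
      using nth_mem[of a "sorted_list_of_set I"] nth_mem[of a "sorted_list_of_set J"] that IJ fin by auto
    have "(\<Prod>i<d + 2. poly_eval ?x (?S (sorted_list_of_set I ! i) (sorted_list_of_set J ! \<sigma> i)))
        = of_real (\<Prod>i<d + 2. ?X (sorted_list_of_set I ! i) (sorted_list_of_set J ! \<sigma> i))"
      if \<sigma>: "\<sigma> permutes {..<d + 2}" for \<sigma>
      unfolding of_real_prod
    proof (rule prod.cong)
      fix i assume "i \<in> {..<d + 2}"
      then have "i < d + 2" "\<sigma> i < d + 2"
        using permutes_in_image[OF \<sigma>, of i] by auto
      then show "poly_eval ?x (?S (sorted_list_of_set I ! i) (sorted_list_of_set J ! \<sigma> i))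
          = of_real (?X (sorted_list_of_set I ! i) (sorted_list_of_set J ! \<sigma> i))"
        using ev mem by blast
    qed simp
    then show ?thesis
      unfolding poly_eval_det_fun unfolding det_fun_def of_real_sum of_real_mult of_real_of_int_eq
      by (intro sum.cong) auto
  qed
  show ?thesis
  proof
    assume vanish: "\<forall>p\<in>slack_ideal d v f pv pF. poly_eval ?x p = 0"
    have "y = 0" if "y \<in> minors (d + 2) v f ?X" for y
    proof -
      obtain I J where IJ: "I \<subseteq> {..<v}" "J \<subseteq> {..<f}" "card I = d + 2" "card J = d + 2"
        and y: "y = det_fun (d + 2) (\<lambda>a b. ?X (sorted_list_of_set I ! a) (sorted_list_of_set J ! b))"
        using \<open>y \<in> minors (d + 2) v f ?X\<close> unfolding minors_def by blast
      let ?p = "det_fun (d + 2) (\<lambda>a b. ?S (sorted_list_of_set I ! a) (sorted_list_of_set J ! b))"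
      have "sorted_list_of_set I ! a < v" "sorted_list_of_set J ! a < f" if "a < d + 2" for a
        using nth_mem[of a "sorted_list_of_set I"] nth_mem[of a "sorted_list_of_set J"] that IJ
          finite_subset[OF IJ(1)] finite_subset[OF IJ(2)] by auto
      then have "?S (sorted_list_of_set I ! a) (sorted_list_of_set J ! b) \<in> poly_ring E"
        if "a < d + 2" "b < d + 2" for a b
        using that by (auto simp: symbolic_slack_def E_def noninc_def intro!: poly_ring_Var poly_ring_zero)
      then have "?p \<in> poly_ring E"
        by (rule poly_ring_det_fun)
      moreover have "?p \<in> ?G"
        unfolding minors_def using IJ by blast
      ultimately have "?p \<in> slack_ideal d v f pv pF"
        unfolding slack_ideal_def Let_def E_def
        by (intro generator_in_saturation poly_ring_one)
      then have "complex_of_real y = 0"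
        using vanish det[OF IJ] y by simp
      then show ?thesis by simp
    qed
    then show "factors_through (d + 1) v f ?X"
      using minors_zero_imp_factors[of "d + 1" v f ?X] by simp
  next
    assume fact: "factors_through (d + 1) v f ?X"
    have gen: "poly_eval ?x g = 0" if "g \<in> ?G" for g
    proof -
      obtain I J where IJ: "I \<subseteq> {..<v}" "J \<subseteq> {..<f}" "card I = d + 2" "card J = d + 2"
        and g: "g = det_fun (d + 2) (\<lambda>a b. ?S (sorted_list_of_set I ! a) (sorted_list_of_set J ! b))"
        using \<open>g \<in> ?G\<close> unfolding minors_def by blast
      have "det_fun (d + 2) (\<lambda>a b. ?X (sorted_list_of_set I ! a) (sorted_list_of_set J ! b))
          \<in> minors (Suc (d + 1)) v f ?X"
        unfolding minors_def using IJ by auto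
      then show ?thesis
        using factors_imp_minors_zero[OF fact] det[OF IJ] g by simp
    qed
    have h: "poly_eval ?x (\<Prod>e\<in>noninc v f pv pF. Var e) \<noteq> 0"
    proof -
      have "x e \<noteq> 0" if "e \<in> noninc v f pv pF" for e
        using pos[of e] that by (simp add: E_def)
      then show ?thesis
        by (simp add: poly_eval_prod finite_noninc)
    qed
    show "\<forall>p\<in>slack_ideal d v f pv pF. poly_eval ?x p = 0"
      unfolding slack_ideal_def Let_def using poly_eval_saturation[OF _ gen h] by blast
  qed
qed

lemma is_toric_iff:
  "is_toric E I \<longleftrightarrow> (\<exists>a. \<forall>p. p \<in> I \<longleftrightarrow> p \<in> poly_ring E \<and>
    (\<forall>w. poly_eval (\<lambda>e. of_real (exp (weight w (a e)))) p = 0))"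
  unfolding is_toric_def set_eq_iff by (simp add: monomial_map_zero_iff)

lemma poly_eval_cong:
  assumes "p \<in> poly_ring E" "\<And>e. e \<in> E \<Longrightarrow> x e = y e"
  shows "poly_eval x p = poly_eval y p"
  unfolding poly_eval_def
proof (rule sum.cong)
  fix m assume "m \<in> Poly_Mapping.keys p"
  then have "monom_eval x m = monom_eval y m"
    using assms by (intro monom_eval_cong) (auto simp: poly_ring_def)
  then show "Poly_Mapping.lookup p m * monom_eval x m = Poly_Mapping.lookup p m * monom_eval y m"
    by simp
qed simp

section \<open>The two implications\<close>

context
  fixes P :: "(real ^ 'd) set" and v f :: nat and pv pF
  assumes L: "labelled_polytope P v f pv pF" and dim: "aff_dim P = int CARD('d)"
begin

interpretation labelled_polytope P v f pv pF by (rule L)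

text \<open>The slack matrix of a realization has rank at most \<open>CARD('d) + 1\<close>, so it is
  a positive point of the slack ideal and, by the assumed equality, one of the toric ideal.\<close>

lemma realization_slack_point:
  fixes q :: "nat \<Rightarrow> real ^ 'd"
  assumes R: "realization P v f pv pF q a c"
    and eq: "slack_ideal CARD('d) v f pv pF = nonincidence_toric_ideal v f pv pF"
  shows "\<exists>w. \<forall>i<v. \<forall>j<f. pv i \<notin> pF j \<longrightarrow> a j \<bullet> q i + c j = exp (w (2 * i)) * exp (w (2 * j + 1))"
proof -
  interpret R: realization P v f pv pF q a c by (rule R)
  let ?E = "noninc v f pv pF"
  define x where "x = (\<lambda>(i, j). a j \<bullet> q i + c j)"
  have pos: "0 < x e" if "e \<in> ?E" for e
    using that R.g_pos by (auto simp: x_def noninc_def R.g_def)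
  have "factors_through (CARD('d) + 1) v f (extend_zero ?E x)"
  proof (rule factors_through_scale[OF realization_factors])
    show "extend_zero ?E x i j = 1 * (a j \<bullet> q i + c j) * 1" if "i < v" "j < f" for i j
      using R.zero_iff[OF that] that by (auto simp: extend_zero_def x_def noninc_def)
  qed
  then have "\<forall>p\<in>slack_ideal CARD('d) v f pv pF. poly_eval (\<lambda>e. of_real (x e)) p = 0"
    using slack_ideal_positive_points[of v f pv pF x] pos by blast
  then obtain w where "\<forall>e\<in>?E. x e = exp (weight w (graph_exponent e))"
    using nonincidence_toric_point[of v f pv pF x] pos eq by metis
  then show ?thesis
    by (intro exI[of _ w]) (auto simp: x_def noninc_def weight_graph_exponent exp_add)
qed

lemma projectively_unique_if_graphic:
  assumes eq: "slack_ideal CARD('d) v f pv pF = nonincidence_toric_ideal v f pv pF"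
  shows "projectively_unique P"
  unfolding projectively_unique_def
proof (intro allI impI)
  fix Q :: "(real ^ 'd) set" assume Q: "polytope Q \<and> comb_equiv P Q"
  have dimE: "aff_dim P = int DIM(real ^ 'd)"
    using dim by simp
  obtain a c where S: "realization P v f pv pF pv a c"
    using self_realization[OF dimE] by blast
  obtain q a' c' where R: "realization P v f pv pF q a' c'" and hull: "convex hull (q ` {..<v}) = Q"
    using comb_equiv_realization[OF L dimE] Q by blast
  interpret S: realization P v f pv pF pv a c by (rule S)
  interpret R: realization P v f pv pF q a' c' by (rule R)
  obtain w where w: "\<forall>i<v. \<forall>j<f. pv i \<notin> pF j \<longrightarrow> a j \<bullet> pv i + c j = exp (w (2 * i)) * exp (w (2 * j + 1))"
    using realization_slack_point[OF S eq] by blast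
  obtain w' where w': "\<forall>i<v. \<forall>j<f. pv i \<notin> pF j \<longrightarrow> a' j \<bullet> q i + c' j = exp (w' (2 * i)) * exp (w' (2 * j + 1))"
    using realization_slack_point[OF R eq] by blast
  \<comment> \<open>\<open>s\<close> and \<open>u\<close> are the quotients of the row and column
    factors of the two slack matrices.\<close>
  define s where "s i = exp (w' (2 * i) - w (2 * i))" for i
  define u where "u j = exp (w' (2 * j + 1) - w (2 * j + 1))" for j
  have "proj_equiv (convex hull (pv ` {..<v})) (convex hull (q ` {..<v}))"
  proof (rule scaled_realizations_proj_equiv[OF S R])
    show "0 < s i" for i
      by (simp add: s_def)
    show "a' j \<bullet> q i + c' j = s i * u j * (a j \<bullet> pv i + c j)" if "i < v" "j < f" for i j
    proof (cases "pv i \<in> pF j")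
      case True
      then show ?thesis
        using S.zero_iff[OF that] R.zero_iff[OF that] by simp
    next
      case False
      then have "a' j \<bullet> q i + c' j = exp (w' (2 * i)) * exp (w' (2 * j + 1))"
        "a j \<bullet> pv i + c j = exp (w (2 * i)) * exp (w (2 * j + 1))"
        using w w' that by blast+
      then show ?thesis
        by (simp only: s_def u_def exp_diff) simp
    qed
  qed
  then show "proj_equiv P Q"
    using P_hull hull by simp
qed

lemma graphic_if_projectively_unique:
  assumes unique: "projectively_unique P"
    and toric: "is_toric (noninc v f pv pF) (slack_ideal CARD('d) v f pv pF)"
  shows "slack_ideal CARD('d) v f pv pF = nonincidence_toric_ideal v f pv pF"
proof -
  let ?E = "noninc v f pv pF" and ?I = "slack_ideal CARD('d) v f pv pF"
  obtain \<alpha> where \<alpha>: "\<And>p. p \<in> ?I \<longleftrightarrow> p \<in> poly_ring ?E \<and>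
      (\<forall>w. poly_eval (\<lambda>e. of_real (exp (weight w (\<alpha> e)))) p = 0)"
    using toric unfolding is_toric_iff by blast
  have point: "factors_through (CARD('d) + 1) v f (extend_zero ?E (\<lambda>e. exp (weight w (\<alpha> e))))" for w
  proof (rule iffD1[OF slack_ideal_positive_points])
    show "\<forall>p\<in>?I. poly_eval (\<lambda>e. of_real (exp (weight w (\<alpha> e)))) p = 0"
      using \<alpha> by blast
  qed simp
  let ?one = "extend_zero ?E (\<lambda>e. 1)"
  have one: "factors_through (CARD('d) + 1) v f ?one"
    using point[of "\<lambda>_. 0"] by (simp add: weight_def)
  have dimE: "aff_dim P = int DIM(real ^ 'd)"
    using dim by simp
  obtain a c where S: "realization P v f pv pF pv a c"
    using self_realization[OF dimE] by blast
  interpret S: realization P v f pv pF pv a c by (rule S)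
  have nonneg: "0 \<le> extend_zero ?E x i j" if "\<And>e. 0 < x e" for x i j
    using less_imp_le[OF that] by (simp add: extend_zero_def)
  have zero: "extend_zero ?E x i j = 0 \<longleftrightarrow> pv i \<in> pF j" if "\<And>e. 0 < x e" "i < v" "j < f" for x i j
    using that(1)[of "(i, j)"] that(2,3) by (auto simp: extend_zero_def noninc_def)
  have "\<exists>\<kappa> \<mu> s u. (\<forall>i<v. \<kappa> i < v \<and> 0 < s i) \<and> (\<forall>j<f. \<mu> j < f \<and> 0 < u j) \<and>
      (\<forall>i<v. \<forall>j<f. a j \<bullet> pv i + c j = s i * u j * ?one (\<kappa> i) (\<mu> j))"
    by (rule projectively_unique_slack(2)[OF L dim unique S nonneg zero one]) simp_all
  then obtain \<kappa> \<mu> s u where su: "\<forall>i<v. \<kappa> i < v \<and> 0 < s i" "\<forall>j<f. \<mu> j < f \<and> 0 < u j"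
    and Sone: "\<forall>i<v. \<forall>j<f. a j \<bullet> pv i + c j = s i * u j * ?one (\<kappa> i) (\<mu> j)"
    by blast
  \<comment> \<open>A nonzero slack forces the entry of \<open>?one\<close> at
    \<open>(\<kappa> i, \<mu> j)\<close> to be nonzero, hence 1, so the index maps drop out of the
    formula.\<close>
  have slack: "a j \<bullet> pv i + c j = s i * u j" if "i < v" "j < f" "pv i \<notin> pF j" for i j
  proof -
    have "?one (\<kappa> i) (\<mu> j) \<noteq> 0"
      using Sone S.zero_iff[OF that(1,2)] that by auto
    then have "?one (\<kappa> i) (\<mu> j) = 1"
      by (simp add: extend_zero_def split: if_splits)
    then show ?thesis
      using Sone that by simp
  qed
  have product: "\<exists>w'. \<forall>e\<in>?E. exp (weight w (\<alpha> e)) = exp (weight w' (graph_exponent e))" for w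
  proof -
    let ?X = "extend_zero ?E (\<lambda>e. exp (weight w (\<alpha> e)))"
    have "\<exists>\<kappa> \<mu> s u. (\<forall>i<v. \<kappa> i < v \<and> 0 < s i) \<and> (\<forall>j<f. \<mu> j < f \<and> 0 < u j) \<and>
      (\<forall>i<v. \<forall>j<f. ?X i j = s i * u j * (a (\<mu> j) \<bullet> pv (\<kappa> i) + c (\<mu> j)))"
      by (rule projectively_unique_slack(1)[OF L dim unique S nonneg zero point]) simp_all
    then obtain \<kappa>' \<mu>' s' u' where su': "\<forall>i<v. \<kappa>' i < v \<and> 0 < s' i" "\<forall>j<f. \<mu>' j < f \<and> 0 < u' j"
      and X: "\<forall>i<v. \<forall>j<f. ?X i j = s' i * u' j * (a (\<mu>' j) \<bullet> pv (\<kappa>' i) + c (\<mu>' j))"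
      by blast
    \<comment> \<open>Logarithms of the combined scalings, rows at even and columns at odd indices
      as in \<open>graph_exponent\<close>.\<close>
    define w' where "w' n = (if even n then ln (s' (n div 2) * s (\<kappa>' (n div 2)))
      else ln (u' (n div 2) * u (\<mu>' (n div 2))))" for n
    have "exp (weight w (\<alpha> e)) = exp (weight w' (graph_exponent e))" if e: "e \<in> ?E" for e
    proof -
      obtain i j where ij: "e = (i, j)" "i < v" "j < f"
        using e by (auto simp: noninc_def)
      have kl: "\<kappa>' i < v" "\<mu>' j < f"
        using su' ij by blast+
      have X': "exp (weight w (\<alpha> e)) = s' i * u' j * (a (\<mu>' j) \<bullet> pv (\<kappa>' i) + c (\<mu>' j))"
      proof -
        have "?X i j = s' i * u' j * (a (\<mu>' j) \<bullet> pv (\<kappa>' i) + c (\<mu>' j))"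
          using X ij by blast
        then show ?thesis
          using e by (simp add: extend_zero_def ij(1))
      qed
      then have "a (\<mu>' j) \<bullet> pv (\<kappa>' i) + c (\<mu>' j) \<noteq> 0"
        using exp_not_eq_zero[of "weight w (\<alpha> e)"] by auto
      then have "a (\<mu>' j) \<bullet> pv (\<kappa>' i) + c (\<mu>' j) = s (\<kappa>' i) * u (\<mu>' j)"
        using S.zero_iff[OF kl] slack[OF kl] by blast
      then have "exp (weight w (\<alpha> e)) = (s' i * s (\<kappa>' i)) * (u' j * u (\<mu>' j))"
        using X' by simp
      also have "\<dots> = exp (w' (2 * i)) * exp (w' (2 * j + 1))"
        using su su' kl ij by (simp add: w'_def)
      finally show ?thesis
        by (simp add: ij(1) weight_graph_exponent exp_add)
    qed
    then show ?thesis by blast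
  qed
  show ?thesis
  proof (intro set_eqI iffI)
    fix p assume p: "p \<in> ?I"
    \<comment> \<open>Each product point is a row and column scaling of \<open>?one\<close>, so it
      satisfies the same rank bound and is a point of the slack ideal.\<close>
    have "poly_eval (\<lambda>e. of_real (exp (weight w (graph_exponent e)))) p = 0" for w
    proof -
      have "factors_through (CARD('d) + 1) v f (extend_zero ?E (\<lambda>e. exp (weight w (graph_exponent e))))"
      proof (rule factors_through_scale[OF one])
        show "extend_zero ?E (\<lambda>e. exp (weight w (graph_exponent e))) i j
            = exp (w (2 * i)) * ?one i j * exp (w (2 * j + 1))" for i j
          by (simp add: extend_zero_def weight_graph_exponent exp_add)
      qed
      then have "\<forall>p\<in>?I. poly_eval (\<lambda>e. of_real (exp (weight w (graph_exponent e)))) p = 0"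
        by (rule iffD2[OF slack_ideal_positive_points, rotated]) simp
      then show ?thesis
        using p by blast
    qed
    then show "p \<in> nonincidence_toric_ideal v f pv pF"
      unfolding nonincidence_toric_ideal_iff using p \<alpha> by blast
  next
    fix p assume p: "p \<in> nonincidence_toric_ideal v f pv pF"
    then have pR: "p \<in> poly_ring ?E"
      unfolding nonincidence_toric_ideal_iff by blast
    \<comment> \<open>Since the slack ideal is toric, membership can be tested on its torus points,
      and by \<open>product\<close> these are product points.\<close>
    have "poly_eval (\<lambda>e. of_real (exp (weight w (\<alpha> e)))) p = 0" for w
    proof -
      obtain w' where "\<forall>e\<in>?E. exp (weight w (\<alpha> e)) = exp (weight w' (graph_exponent e))"
        using product by blast
      then have "poly_eval (\<lambda>e. of_real (exp (weight w (\<alpha> e)))) p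
          = poly_eval (\<lambda>e. of_real (exp (weight w' (graph_exponent e)))) p"
        by (intro poly_eval_cong[OF pR]) simp
      then show ?thesis
        using p unfolding nonincidence_toric_ideal_iff by simp
    qed
    then show "p \<in> ?I"
      using pR \<alpha> by blast
  qed
qed

end

theorem theorem4p3:
  fixes P :: "(real ^ 'd) set"
    and v f :: nat
    and pv :: "nat \<Rightarrow> real ^ 'd"
    and pF :: "nat \<Rightarrow> (real ^ 'd) set"
  assumes "polytope P"
    and "aff_dim P = int CARD('d)"
    and "bij_betw pv {..<v} {x. x extreme_point_of P}"
    and "bij_betw pF {..<f} {F. F facet_of P}"
  shows "slack_ideal CARD('d) v f pv pF = nonincidence_toric_ideal v f pv pF \<longleftrightarrow>
           (projectively_unique P \<and> is_toric (noninc v f pv pF) (slack_ideal CARD('d) v f pv pF))"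
proof -
  have L: "labelled_polytope P v f pv pF"
    by (rule labelled_polytope.intro[OF assms(1,3,4)])
  have "is_toric (noninc v f pv pF) (nonincidence_toric_ideal v f pv pF)"
    unfolding is_toric_def nonincidence_toric_ideal_eq by (rule exI[of _ graph_exponent]) (rule refl)
  then show ?thesis
    using projectively_unique_if_graphic[OF L assms(2)] graphic_if_projectively_unique[OF L assms(2)]
    by metis
qed

end
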